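(* Let $\mathcal{G}$ be a locally compact (not necessarily Hausdorff) étale groupoid, $Y\subset\mathcal{G}^{(0)}$ a $\mathcal{G}$-invariant subset and $x\in(\mathcal{G}^{(0)}\cap\bar Y)\setminus Y$. Assume that for every finite set of distinct cyclic nontrivial subgroups $G_1,\dots,G_n$ of $\mathcal{G}^x_x$ we have $$\sum_{k=1}^n\frac{1}{|G_k|}<1$$ (with $1/|G_k|=0$ if $G_k$ is infinite). Then $\rho_x$ is weakly contained in $\bigoplus_{y\in Y}\rho_y$ (as representations of $C^*_r(\mathcal{G})$) if and only if the following condition is not satisfied: for some $n\ge1$ there are elements $g_1,\dots,g_n\in\mathcal{G}^x_x\setminus\{x\}$, open bisections $U_1,\dots,U_n$ with $g_k\in U_k$, and a neighbourhood $U$ of $x$ in $\mathcal{G}^{(0)}$ such that $Y\cap U\subset U_1\cup\dots\cup U_n$. Equivalently, $\rho_x$ is weakly contained in $\bigoplus_{y\in Y}\rho_y$ if and only if there is a net in $Y$ such that $x$ is its unique accumulation point in $\mathcal{G}^x_x$.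
   Context: A locally compact étale groupoid is a groupoid $\mathcal{G}$ with a locally compact, not necessarily Hausdorff, topology such that the groupoid operations are continuous, the unit space $\mathcal{G}^{(0)}$ is locally compact Hausdorff in the relative topology, and the range and source maps $r,s\colon\mathcal{G}\to\mathcal{G}^{(0)}$ are local homeomorphisms. Write $\mathcal{G}_x=s^{-1}(x)$, $\mathcal{G}^x=r^{-1}(x)$, $\mathcal{G}^x_x=\mathcal{G}_x\cap\mathcal{G}^x$ (isotropy group, with unit $x$); accumulation points of nets are with respect to the topology of $\mathcal{G}$. An open bisection is an open subset of $\mathcal{G}$ on which $r$ and $s$ are injective (hence homeomorphisms onto open subsets of $\mathcal{G}^{(0)}$). A subset $Y\subset\mathcal{G}^{(0)}$ is $\mathcal{G}$-invariant if $r^{-1}(Y)=s^{-1}(Y)$. For an open Hausdorff $V\subset\mathcal{G}$, functions in $C_c(V)$ are extended by zero to $\mathcal{G}$; $C_c(\mathcal{G})$ is the linear span, inside all functions on $\mathcal{G}$, of the spaces $C_c(V)$ over all open Hausdorff $V\subset\mathcal{G}$. It is a $*$-algebra with $(f_1*f_2)(g)=\sum_{h\in\mathcal{G}^{r(g)}}f_1(h)f_2(h^{-1}g)$ and $f^*(g)=\overline{f(g^{-1})}$. For $x\in\mathcal{G}^{(0)}$, $\rho_x\colon C_c(\mathcal{G})\to B(\ell^2(\mathcal{G}_x))$ is $(\rho_x(f)\xi)(g)=\sum_{h\in\mathcal{G}^{r(g)}}f(h)\xi(h^{-1}g)$. The reduced C$^*$-algebra $C^*_r(\mathcal{G})$ is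 the completion of $C_c(\mathcal{G})$ in the norm $\|f\|_r=\sup_{x\in\mathcal{G}^{(0)}}\|\rho_x(f)\|$; each $\rho_x$ extends to $C^*_r(\mathcal{G})$. A representation $\pi$ is weakly contained in a representation $\sigma$ if $\ker\sigma\subset\ker\pi$. *)

theory Defs
  imports
    "HOL-Analysis.Analysis"
    "HOL-Algebra.Elementary_Groups"
    "HOL-Library.Function_Algebras"
begin

section \<open>Locally compact etale groupoids\<close>

(* The set of arrows is the carrier of the topology, topspace (gtop G); the four maps are
   only relevant there. The topology on arrows is not assumed to be Hausdorff. *)
record 'a top_groupoid =
  gtop :: "'a topology"
  rangemap :: "'a \<Rightarrow> 'a"
  sourcemap :: "'a \<Rightarrow> 'a"
  gmult :: "'a \<Rightarrow> 'a \<Rightarrow> 'a"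
  ginv :: "'a \<Rightarrow> 'a"

definition arrows :: "'a top_groupoid \<Rightarrow> 'a set" where
  "arrows G = topspace (gtop G)"

definition units :: "'a top_groupoid \<Rightarrow> 'a set" where
  "units G = {u \<in> arrows G. rangemap G u = u \<and> sourcemap G u = u}"

definition composable :: "'a top_groupoid \<Rightarrow> ('a \<times> 'a) set" where
  "composable G = {(g, h). g \<in> arrows G \<and> h \<in> arrows G \<and> sourcemap G g = rangemap G h}"

definition local_homeo :: "'a topology \<Rightarrow> 'b topology \<Rightarrow> ('a \<Rightarrow> 'b) \<Rightarrow> bool" where
  "local_homeo X Z f \<longleftrightarrow>
     (\<forall>p \<in> topspace X. \<exists>W. openin X W \<and> p \<in> W \<and> openin Z (f ` W) \<and>
        homeomorphic_map (subtopology X W) (subtopology Z (f ` W)) f)"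

locale groupoid =
  fixes G :: "'a top_groupoid"
  assumes range_unit: "g \<in> arrows G \<Longrightarrow> rangemap G g \<in> units G"
    and source_unit: "g \<in> arrows G \<Longrightarrow> sourcemap G g \<in> units G"
    and mult_closed: "(g, h) \<in> composable G \<Longrightarrow> gmult G g h \<in> arrows G"
    and range_mult: "(g, h) \<in> composable G \<Longrightarrow> rangemap G (gmult G g h) = rangemap G g"
    and source_mult: "(g, h) \<in> composable G \<Longrightarrow> sourcemap G (gmult G g h) = sourcemap G h"
    and mult_assoc: "(g, h) \<in> composable G \<Longrightarrow> (h, k) \<in> composable G \<Longrightarrow>
        gmult G (gmult G g h) k = gmult G g (gmult G h k)"
    and unit_left: "g \<in> arrows G \<Longrightarrow> gmult G (rangemap G g) g = g"
    and unit_right: "g \<in> arrows G \<Longrightarrow> gmult G g (sourcemap G g) = g"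
    and inv_closed: "g \<in> arrows G \<Longrightarrow> ginv G g \<in> arrows G"
    and range_inv: "g \<in> arrows G \<Longrightarrow> rangemap G (ginv G g) = sourcemap G g"
    and source_inv: "g \<in> arrows G \<Longrightarrow> sourcemap G (ginv G g) = rangemap G g"
    and inv_right: "g \<in> arrows G \<Longrightarrow> gmult G g (ginv G g) = rangemap G g"
    and inv_left: "g \<in> arrows G \<Longrightarrow> gmult G (ginv G g) g = sourcemap G g"

locale etale_groupoid = groupoid +
  assumes locally_compact: "locally_compact_space (gtop G)"
    and continuous_mult:
      "continuous_map (subtopology (prod_topology (gtop G) (gtop G)) (composable G)) (gtop G)
         (\<lambda>(g, h). gmult G g h)"
    and continuous_inv: "continuous_map (gtop G) (gtop G) (ginv G)"
    and units_locally_compact: "locally_compact_space (subtopology (gtop G) (units G))"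
    and units_Hausdorff: "Hausdorff_space (subtopology (gtop G) (units G))"
    and range_local_homeo: "local_homeo (gtop G) (subtopology (gtop G) (units G)) (rangemap G)"
    and source_local_homeo: "local_homeo (gtop G) (subtopology (gtop G) (units G)) (sourcemap G)"

definition source_fibre :: "'a top_groupoid \<Rightarrow> 'a \<Rightarrow> 'a set" where
  "source_fibre G x = {g \<in> arrows G. sourcemap G g = x}"

definition range_fibre :: "'a top_groupoid \<Rightarrow> 'a \<Rightarrow> 'a set" where
  "range_fibre G x = {g \<in> arrows G. rangemap G g = x}"

definition isotropy :: "'a top_groupoid \<Rightarrow> 'a \<Rightarrow> 'a monoid" where
  "isotropy G x = \<lparr>carrier = source_fibre G x \<inter> range_fibre G x, mult = gmult G, one = x\<rparr>"

definition open_bisection :: "'a top_groupoid \<Rightarrow> 'a set \<Rightarrow> bool" where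
  "open_bisection G U \<longleftrightarrow>
     openin (gtop G) U \<and> inj_on (rangemap G) U \<and> inj_on (sourcemap G) U"

definition invariant_set :: "'a top_groupoid \<Rightarrow> 'a set \<Rightarrow> bool" where
  "invariant_set G Y \<longleftrightarrow> Y \<subseteq> units G \<and>
     {g \<in> arrows G. rangemap G g \<in> Y} = {g \<in> arrows G. sourcemap G g \<in> Y}"

definition unit_neighbourhood :: "'a top_groupoid \<Rightarrow> 'a \<Rightarrow> 'a set \<Rightarrow> bool" where
  "unit_neighbourhood G x U \<longleftrightarrow> U \<subseteq> units G \<and>
     (\<exists>W. openin (subtopology (gtop G) (units G)) W \<and> x \<in> W \<and> W \<subseteq> U)"


section \<open>The convolution algebra and the regular representations\<close>

definition Cc_on :: "'a top_groupoid \<Rightarrow> 'a set \<Rightarrow> ('a \<Rightarrow> complex) set" where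
  "Cc_on G V = {f. continuous_map (subtopology (gtop G) V) euclidean f \<and>
     compactin (subtopology (gtop G) V)
       (subtopology (gtop G) V closure_of {g \<in> V. f g \<noteq> 0}) \<and>
     (\<forall>g. g \<notin> V \<longrightarrow> f g = 0)}"

(* For non-Hausdorff G the members of this span need not be continuous. *)
definition Cc :: "'a top_groupoid \<Rightarrow> ('a \<Rightarrow> complex) set" where
  "Cc G = {f. \<exists>(n::nat) (c :: nat \<Rightarrow> complex) (F :: nat \<Rightarrow> 'a \<Rightarrow> complex).
     (\<forall>k<n. \<exists>V. openin (gtop G) V \<and> Hausdorff_space (subtopology (gtop G) V) \<and>
        F k \<in> Cc_on G V) \<and>
     f = (\<lambda>g. \<Sum>k<n. c k * F k g)}"

definition convolution ::
  "'a top_groupoid \<Rightarrow> ('a \<Rightarrow> complex) \<Rightarrow> ('a \<Rightarrow> complex) \<Rightarrow> 'a \<Rightarrow> complex" where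
  "convolution G f \<xi> g =
     (\<Sum>\<^sub>\<infinity>h \<in> range_fibre G (rangemap G g). f h * \<xi> (gmult G (ginv G h) g))"

(* l^2(S) for a subset S of a type: square-summable functions vanishing off S. *)
definition ell2 :: "'a set \<Rightarrow> ('a \<Rightarrow> complex) set" where
  "ell2 S = {\<xi>. (\<forall>g. g \<notin> S \<longrightarrow> \<xi> g = 0) \<and> (\<lambda>g. (cmod (\<xi> g))\<^sup>2) summable_on UNIV}"

definition l2norm :: "('a \<Rightarrow> complex) \<Rightarrow> real" where
  "l2norm \<xi> = sqrt (\<Sum>\<^sub>\<infinity>g. (cmod (\<xi> g))\<^sup>2)"

definition op_norm :: "'a set \<Rightarrow> (('a \<Rightarrow> complex) \<Rightarrow> ('a \<Rightarrow> complex)) \<Rightarrow> ennreal" where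
  "op_norm S T = (SUP \<xi> \<in> {\<xi> \<in> ell2 S. l2norm \<xi> \<le> 1}. ennreal (l2norm (T \<xi>)))"

definition rho :: "'a top_groupoid \<Rightarrow> 'a \<Rightarrow> ('a \<Rightarrow> complex) \<Rightarrow> ('a \<Rightarrow> complex) \<Rightarrow> 'a \<Rightarrow> complex" where
  "rho G x f \<xi> = (\<lambda>g. if g \<in> source_fibre G x then convolution G f \<xi> g else 0)"

definition reduced_norm :: "'a top_groupoid \<Rightarrow> ('a \<Rightarrow> complex) \<Rightarrow> ennreal" where
  "reduced_norm G f = (SUP x \<in> units G. op_norm (source_fibre G x) (rho G x f))"


section \<open>The reduced C*-algebra\<close>

(* The completion of Cc G in the reduced norm, realised as Cauchy sequences modulo null
   sequences. *)
definition Cc_Cauchy :: "'a top_groupoid \<Rightarrow> (nat \<Rightarrow> 'a \<Rightarrow> complex) set" where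
  "Cc_Cauchy G = {F. (\<forall>n. F n \<in> Cc G) \<and>
     (\<forall>\<epsilon>>0. \<exists>N. \<forall>m\<ge>N. \<forall>n\<ge>N. reduced_norm G (F m - F n) < ennreal \<epsilon>)}"

definition Cc_equiv ::
  "'a top_groupoid \<Rightarrow> ((nat \<Rightarrow> 'a \<Rightarrow> complex) \<times> (nat \<Rightarrow> 'a \<Rightarrow> complex)) set" where
  "Cc_equiv G = {(F, F'). F \<in> Cc_Cauchy G \<and> F' \<in> Cc_Cauchy G \<and>
     (\<lambda>n. reduced_norm G (F n - F' n)) \<longlonglongrightarrow> 0}"

definition reduced_Cstar :: "'a top_groupoid \<Rightarrow> (nat \<Rightarrow> 'a \<Rightarrow> complex) set set" where
  "reduced_Cstar G = Cc_Cauchy G // Cc_equiv G"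

(* Extension of rho by continuity: the vector is the l^2-limit of rho G x (F n) \<xi> along any
   sequence F representing the element a of the completion. *)
definition rho_ext :: "'a top_groupoid \<Rightarrow> 'a \<Rightarrow> (nat \<Rightarrow> 'a \<Rightarrow> complex) set \<Rightarrow>
    ('a \<Rightarrow> complex) \<Rightarrow> ('a \<Rightarrow> complex)" where
  "rho_ext G x a \<xi> = (THE \<eta>. \<eta> \<in> ell2 (source_fibre G x) \<and>
     (\<forall>F \<in> a. (\<lambda>n. l2norm (rho G x (F n) \<xi> - \<eta>)) \<longlonglongrightarrow> 0))"


section \<open>Representations and weak containment\<close>

(* A representation is given by its Hilbert space (a set of vectors) and its action. *)
type_synonym ('c, 'v) representation = "'v set \<times> ('c \<Rightarrow> 'v \<Rightarrow> 'v)"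

definition regular_rep :: "'a top_groupoid \<Rightarrow> 'a \<Rightarrow>
    ((nat \<Rightarrow> 'a \<Rightarrow> complex) set, 'a \<Rightarrow> complex) representation" where
  "regular_rep G x = (ell2 (source_fibre G x), rho_ext G x)"

definition direct_sum_rep :: "'i set \<Rightarrow> ('i \<Rightarrow> ('c, 'a \<Rightarrow> complex) representation) \<Rightarrow>
    ('c, 'i \<Rightarrow> 'a \<Rightarrow> complex) representation" where
  "direct_sum_rep I R =
     ({\<Xi>. (\<forall>i\<in>I. \<Xi> i \<in> fst (R i)) \<and> (\<forall>i. i \<notin> I \<longrightarrow> \<Xi> i = 0) \<and>
          (\<lambda>i. (l2norm (\<Xi> i))\<^sup>2) summable_on I},
      (\<lambda>a \<Xi> i. if i \<in> I then snd (R i) a (\<Xi> i) else 0))"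

definition rep_kernel :: "'c set \<Rightarrow> ('c, 'v::zero) representation \<Rightarrow> 'c set" where
  "rep_kernel A R = {a \<in> A. \<forall>v \<in> fst R. snd R a v = 0}"

definition weakly_contained ::
  "'c set \<Rightarrow> ('c, 'v::zero) representation \<Rightarrow> ('c, 'w::zero) representation \<Rightarrow> bool" where
  "weakly_contained A R S \<longleftrightarrow> rep_kernel A S \<subseteq> rep_kernel A R"


section \<open>Nets\<close>

definition directed_set :: "'i set \<Rightarrow> ('i \<Rightarrow> 'i \<Rightarrow> bool) \<Rightarrow> bool" where
  "directed_set I leq \<longleftrightarrow> I \<noteq> {} \<and> (\<forall>i\<in>I. leq i i) \<and>
     (\<forall>i\<in>I. \<forall>j\<in>I. \<forall>k\<in>I. leq i j \<longrightarrow> leq j k \<longrightarrow> leq i k) \<and>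
     (\<forall>i\<in>I. \<forall>j\<in>I. \<exists>k\<in>I. leq i k \<and> leq j k)"

definition net_accumulation_points ::
  "'a topology \<Rightarrow> 'i set \<Rightarrow> ('i \<Rightarrow> 'i \<Rightarrow> bool) \<Rightarrow> ('i \<Rightarrow> 'a) \<Rightarrow> 'a set" where
  "net_accumulation_points X I leq \<nu> = {p \<in> topspace X.
     \<forall>W. openin X W \<and> p \<in> W \<longrightarrow> (\<forall>i\<in>I. \<exists>j\<in>I. leq i j \<and> \<nu> j \<in> W)}"

(* One cannot quantify existentially over index types inside a formula. This loses nothing: a net
   over an arbitrary index type can be replaced by one indexed by pairs (tail, point of the tail),
   with the same accumulation points. *)
lemma net_canonical_index:
  fixes \<nu> :: "'i \<Rightarrow> 'a"
  assumes dir: "directed_set I leq" and vals: "\<nu> ` I \<subseteq> Y"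
  shows "\<exists>(J :: ('a set \<times> 'a) set) leq' \<mu>. directed_set J leq' \<and> \<mu> ` J \<subseteq> Y \<and>
           net_accumulation_points X J leq' \<mu> = net_accumulation_points X I leq \<nu>"
proof -
  define tail where "tail i = \<nu> ` {j \<in> I. leq i j}" for i
  define J where "J = {(A, a). \<exists>i\<in>I. A = tail i \<and> a \<in> A}"
  define leq' where "leq' = (\<lambda>(p :: 'a set \<times> 'a) (q :: 'a set \<times> 'a). fst q \<subseteq> fst p)"
  have refl: "leq i i" if "i \<in> I" for i
    using dir that by (simp add: directed_set_def)
  have tail_mono: "tail j \<subseteq> tail i" if "i \<in> I" "j \<in> I" "leq i j" for i j
    using dir that unfolding directed_set_def tail_def by blast
  have inJ: "(tail i, \<nu> i) \<in> J" if "i \<in> I" for i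
    using that refl[OF that] by (auto simp: J_def tail_def)
  have "directed_set J leq'"
    unfolding directed_set_def
  proof (intro conjI ballI impI)
    show "J \<noteq> {}" using inJ dir by (auto simp: directed_set_def)
  next
    fix p q assume "p \<in> J" "q \<in> J"
    then obtain i j where ij: "i \<in> I" "fst p = tail i" "j \<in> I" "fst q = tail j"
      by (auto simp: J_def)
    then obtain k where k: "k \<in> I" "leq i k" "leq j k"
      using dir unfolding directed_set_def by blast
    then have "leq' p (tail k, \<nu> k)" "leq' q (tail k, \<nu> k)"
      using ij tail_mono by (auto simp: leq'_def)
    then show "\<exists>r\<in>J. leq' p r \<and> leq' q r" using inJ k(1) by blast
  qed (auto simp: leq'_def)
  moreover have "snd ` J \<subseteq> Y"
    using vals by (auto simp: J_def tail_def)
  moreover have "(\<forall>p\<in>J. \<exists>q\<in>J. leq' p q \<and> snd q \<in> W) \<longleftrightarrow> (\<forall>i\<in>I. \<exists>j\<in>I. leq i j \<and> \<nu> j \<in> W)" for W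
  proof
    assume L: "\<forall>p\<in>J. \<exists>q\<in>J. leq' p q \<and> snd q \<in> W"
    show "\<forall>i\<in>I. \<exists>j\<in>I. leq i j \<and> \<nu> j \<in> W"
    proof
      fix i assume "i \<in> I"
      then obtain q where "q \<in> J" "leq' (tail i, \<nu> i) q" "snd q \<in> W"
        using L inJ by blast
      then have "snd q \<in> tail i" by (auto simp: J_def leq'_def)
      then show "\<exists>j\<in>I. leq i j \<and> \<nu> j \<in> W"
        using \<open>snd q \<in> W\<close> by (auto simp: tail_def)
    qed
  next
    assume R: "\<forall>i\<in>I. \<exists>j\<in>I. leq i j \<and> \<nu> j \<in> W"
    show "\<forall>p\<in>J. \<exists>q\<in>J. leq' p q \<and> snd q \<in> W"
    proof
      fix p assume "p \<in> J"
      then obtain i where i: "i \<in> I" "fst p = tail i" by (auto simp: J_def)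
      then obtain j where j: "j \<in> I" "leq i j" "\<nu> j \<in> W" using R by blast
      then have "leq' p (tail j, \<nu> j)" using i tail_mono by (simp add: leq'_def)
      then show "\<exists>q\<in>J. leq' p q \<and> snd q \<in> W"
        using inJ[OF j(1)] j(3) by force
    qed
  qed
  then have "net_accumulation_points X J leq' snd = net_accumulation_points X I leq \<nu>"
    by (simp add: net_accumulation_points_def)
  ultimately show ?thesis by blast
qed

end

theory Submission
  imports Defs
begin

text \<open>If no cover exists, the sets \<open>Y \<inter> N - (U\<^sub>1 \<union> \<dots> \<union> U\<^sub>n)\<close> generate a proper filter on \<open>Y\<close>. Lifting
  the points of \<open>Y\<close> through bisections around elements of the source fibre of \<open>x\<close>, the matrix
  coefficients \<open>f (h \<cdot> g\<^sup>-\<^sup>1)\<close> of the regular representation at \<open>x\<close> are limits, along this filter, of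
  coefficients at points of \<open>Y\<close>; this bounds the norm of \<open>f\<close> at \<open>x\<close> by its norms over \<open>Y\<close>.

  Conversely, given a cover, let \<open>H\<close> range over the finitely many subgroups generated by the \<open>g\<^sub>k\<close>
  and let \<open>q\<^sub>H\<close> be the average of bump functions on bisections through finitely many elements of \<open>H\<close>.
  A unit of \<open>Y\<close> near \<open>x\<close> that lies in \<open>U\<^sub>k\<close> lies in all the bisections entering \<open>q\<^sub>H\<close> for the group \<open>H\<close>
  generated by \<open>g\<^sub>k\<close>, so \<open>T = \<Sum>\<^sub>H q\<^sub>H\<^sup>* q\<^sub>H - b\<^sup>* b\<close>, with \<open>b\<close> the bump function on the units, is positive
  over \<open>Y\<close>; but at \<open>x\<close> its diagonal coefficient is less than \<open>0\<close> by the hypothesis on \<open>\<Sum> 1 / |H|\<close>.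
  Hence \<open>|T| - T\<close> vanishes over \<open>Y\<close> but not at \<open>x\<close>.\<close>

section \<open>Square summable functions\<close>

text \<open>Without Hausdorffness a function in \<open>Cc G\<close> may jump, and a quotient of two
  lifts may approach several arrows at once. Two such limits differ by a nontrivial isotropy element
  at \<open>x\<close>, and then the units being lifted enter every bisection through that element.
  Removing these bisections from the filter is therefore what forces the coefficients to converge.
  In the other direction the kernels live in a completion made of Cauchy sequences, so
  \<open>|T|\<close> has to be produced as an explicit sequence in \<open>Cc G\<close> whose rate of
  convergence is the same at all units. This dictates the polynomial iteration: its rate depends on
  a scalar majorant alone, and it has no constant term because the algebra need not have a unit. The
  function \<open>b\<close> stands in for the unit. The number \<open>1 / |H|\<close> is the squared
  l2 norm of the uniform average over \<open>H\<close>. For infinite \<open>H\<close> the average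
  runs over a large finite subset, whose contribution can be made as small as desired.\<close>

lemma square_summable_iff:
  fixes f :: "'a \<Rightarrow> complex"
  shows "(\<lambda>i. (cmod (f i))\<^sup>2) summable_on UNIV \<longleftrightarrow>
     (\<exists>C. \<forall>F. finite F \<longrightarrow> (\<Sum>i\<in>F. (cmod (f i))\<^sup>2) \<le> C)"
proof
  assume "(\<lambda>i. (cmod (f i))\<^sup>2) summable_on UNIV"
  then show "\<exists>C. \<forall>F. finite F \<longrightarrow> (\<Sum>i\<in>F. (cmod (f i))\<^sup>2) \<le> C"
    by (intro exI[of _ "infsum (\<lambda>i. (cmod (f i))\<^sup>2) UNIV"] allI impI finite_sum_le_infsum) auto
next
  assume "\<exists>C. \<forall>F. finite F \<longrightarrow> (\<Sum>i\<in>F. (cmod (f i))\<^sup>2) \<le> C"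
  then obtain C where "\<And>F. finite F \<Longrightarrow> (\<Sum>i\<in>F. (cmod (f i))\<^sup>2) \<le> C" by blast
  then show "(\<lambda>i. (cmod (f i))\<^sup>2) summable_on UNIV"
    by (intro nonneg_bdd_above_summable_on bdd_aboveI2[where M = C]) auto
qed

text \<open>A type is needed for completeness, limits and inner products from the type classes. The
  spaces \<open>ell2 S\<close> for all fibres \<open>S\<close> sit inside this one type, so
  operators at different units can be compared without changing the space.\<close>

typedef 'a l2 = "{f :: 'a \<Rightarrow> complex. (\<lambda>i. (cmod (f i))\<^sup>2) summable_on UNIV}"
  morphisms coord Abs_l2
  by (rule exI[of _ "\<lambda>_. 0"]) simp

lemma coord_summable: "(\<lambda>i. (cmod (coord x i))\<^sup>2) summable_on UNIV"
  using coord by auto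

lemma coord_Abs_l2 [simp]:
  "(\<lambda>i. (cmod (f i))\<^sup>2) summable_on UNIV \<Longrightarrow> coord (Abs_l2 f) = f"
  by (simp add: Abs_l2_inverse)

lemma l2_eqI: "(\<And>i. coord x i = coord y i) \<Longrightarrow> x = y"
  by (metis coord_inject ext)

lemma square_summable_add:
  fixes f g :: "'a \<Rightarrow> complex"
  assumes "(\<lambda>i. (cmod (f i))\<^sup>2) summable_on UNIV" "(\<lambda>i. (cmod (g i))\<^sup>2) summable_on UNIV"
  shows "(\<lambda>i. (cmod (f i + g i))\<^sup>2) summable_on UNIV"
proof (rule summable_on_comparison_test)
  show "(\<lambda>i. 2 * (cmod (f i))\<^sup>2 + 2 * (cmod (g i))\<^sup>2) summable_on UNIV"
    using assms by (intro summable_on_add summable_on_cmult_right)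
  fix i
  have "(cmod (f i + g i))\<^sup>2 \<le> (cmod (f i) + cmod (g i))\<^sup>2"
    by (simp add: norm_triangle_ineq power_mono)
  also have "\<dots> \<le> 2 * (cmod (f i))\<^sup>2 + 2 * (cmod (g i))\<^sup>2"
    using sum_squares_bound[of "cmod (f i)" "cmod (g i)"] by (simp add: power2_sum)
  finally show "(cmod (f i + g i))\<^sup>2 \<le> 2 * (cmod (f i))\<^sup>2 + 2 * (cmod (g i))\<^sup>2" .
qed auto

lemma square_summable_scaleR:
  fixes f :: "'a \<Rightarrow> complex"
  assumes "(\<lambda>i. (cmod (f i))\<^sup>2) summable_on UNIV"
  shows "(\<lambda>i. (cmod (r *\<^sub>R f i))\<^sup>2) summable_on UNIV"
  using summable_on_cmult_right[OF assms, of "r\<^sup>2"] by (simp add: power_mult_distrib)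

lemma square_summable_inner:
  fixes f g :: "'a \<Rightarrow> complex"
  assumes "(\<lambda>i. (cmod (f i))\<^sup>2) summable_on UNIV" "(\<lambda>i. (cmod (g i))\<^sup>2) summable_on UNIV"
  shows "(\<lambda>i. inner (f i) (g i)) summable_on UNIV"
proof (rule abs_summable_summable, rule summable_on_comparison_test)
  show "(\<lambda>i. (cmod (f i))\<^sup>2 + (cmod (g i))\<^sup>2) summable_on UNIV"
    using assms by (rule summable_on_add)
  fix i
  have "norm (inner (f i) (g i)) \<le> cmod (f i) * cmod (g i)"
    using Cauchy_Schwarz_ineq2 by auto
  also have "\<dots> \<le> (cmod (f i))\<^sup>2 + (cmod (g i))\<^sup>2"
    using sum_squares_bound[of "cmod (f i)" "cmod (g i)"]
      mult_nonneg_nonneg[OF norm_ge_zero[of "f i"] norm_ge_zero[of "g i"]]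
    by linarith
  finally show "norm (inner (f i) (g i)) \<le> (cmod (f i))\<^sup>2 + (cmod (g i))\<^sup>2" .
qed auto

instantiation l2 :: (type) real_vector
begin
definition zero_l2 :: "'a l2" where "0 = Abs_l2 (\<lambda>_. 0)"
definition plus_l2 :: "'a l2 \<Rightarrow> 'a l2 \<Rightarrow> 'a l2" where
  "x + y = Abs_l2 (\<lambda>i. coord x i + coord y i)"
definition scaleR_l2 :: "real \<Rightarrow> 'a l2 \<Rightarrow> 'a l2" where
  "r *\<^sub>R x = Abs_l2 (\<lambda>i. r *\<^sub>R coord x i)"
definition uminus_l2 :: "'a l2 \<Rightarrow> 'a l2" where "- x = (-1) *\<^sub>R (x :: 'a l2)"
definition minus_l2 :: "'a l2 \<Rightarrow> 'a l2 \<Rightarrow> 'a l2" where "x - y = x + - (y :: 'a l2)"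

lemma coord_zero [simp]: "coord 0 i = 0"
  by (simp add: zero_l2_def)
lemma coord_add [simp]: "coord (x + y) i = coord x i + coord y i"
  by (simp add: plus_l2_def square_summable_add coord_summable)
lemma coord_scaleR [simp]: "coord (r *\<^sub>R x) i = r *\<^sub>R coord x i"
  by (simp only: scaleR_l2_def square_summable_scaleR coord_summable coord_Abs_l2)
lemma coord_uminus [simp]: "coord (- x) i = - coord x i"
  by (simp add: uminus_l2_def)
lemma coord_minus [simp]: "coord (x - y) i = coord x i - coord y i"
  by (simp add: minus_l2_def)

instance
  by standard (auto intro!: l2_eqI simp: algebra_simps)
end

text \<open>This is the real part of the hermitian product. Symmetry and positivity of a quadratic
  form can be expressed through the real part, so real linearity is enough for the absolute
  value.\<close>

instantiation l2 :: (type) real_inner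
begin
definition inner_l2 :: "'a l2 \<Rightarrow> 'a l2 \<Rightarrow> real" where
  "inner x y = infsum (\<lambda>i. inner (coord x i) (coord y i)) UNIV"
definition norm_l2 :: "'a l2 \<Rightarrow> real" where "norm_l2 x = sqrt (inner x x)"
definition sgn_l2 :: "'a l2 \<Rightarrow> 'a l2" where "sgn_l2 x = x /\<^sub>R norm x"
definition dist_l2 :: "'a l2 \<Rightarrow> 'a l2 \<Rightarrow> real" where "dist_l2 x y = norm (x - y)"
definition uniformity_l2 :: "('a l2 \<times> 'a l2) filter" where
  "uniformity_l2 = (INF e\<in>{0<..}. principal {(x, y). dist x y < e})"
definition open_l2 :: "'a l2 set \<Rightarrow> bool" where
  "open_l2 U \<longleftrightarrow> (\<forall>x\<in>U. \<forall>\<^sub>F (x', y) in uniformity. x' = x \<longrightarrow> y \<in> U)"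

instance
proof
  fix x y z :: "'a l2" and r :: real
  show "inner x y = inner y x" by (simp add: inner_l2_def inner_commute)
  show "inner (x + y) z = inner x z + inner y z"
    by (simp add: inner_l2_def inner_add_left infsum_add square_summable_inner coord_summable)
  show "inner (r *\<^sub>R x) y = r * inner x y"
    by (simp add: inner_l2_def infsum_cmult_right square_summable_inner coord_summable)
  show "0 \<le> inner x x" by (simp add: inner_l2_def infsum_nonneg)
  show "inner x x = 0 \<longleftrightarrow> x = 0"
  proof
    assume "inner x x = 0"
    then have "inner (coord x i) (coord x i) = 0" for i
      using nonneg_infsum_le_0D[of "\<lambda>i. inner (coord x i) (coord x i)" UNIV i]
      by (simp add: inner_l2_def square_summable_inner coord_summable)
    then show "x = 0" by (intro l2_eqI) simp
  qed (simp add: inner_l2_def)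
qed (simp_all add: norm_l2_def sgn_l2_def dist_l2_def uniformity_l2_def open_l2_def)
end

lemma norm_l2_square: "(norm x)\<^sup>2 = infsum (\<lambda>i. (cmod (coord x i))\<^sup>2) UNIV"
  by (simp add: power2_norm_eq_inner inner_l2_def)

lemma norm_l2_eq_l2norm: "norm x = l2norm (coord x)"
  by (simp add: l2norm_def norm_l2_square[symmetric])

lemma finite_sum_le_norm_l2: "finite F \<Longrightarrow> (\<Sum>i\<in>F. (cmod (coord x i))\<^sup>2) \<le> (norm x)\<^sup>2"
  unfolding norm_l2_square by (rule finite_sum_le_infsum) (auto simp: coord_summable)

lemma norm_l2_leI:
  assumes "0 \<le> C" "\<And>F. finite F \<Longrightarrow> (\<Sum>i\<in>F. (cmod (coord x i))\<^sup>2) \<le> C\<^sup>2"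
  shows "norm x \<le> C"
proof (rule power2_le_imp_le)
  show "(norm x)\<^sup>2 \<le> C\<^sup>2"
    unfolding norm_l2_square using assms(2) by (intro infsum_le_finite_sums coord_summable)
qed fact

lemma norm_coord_le: "cmod (coord x i) \<le> norm x"
  using finite_sum_le_norm_l2[of "{i}" x] by (auto intro: power2_le_imp_le[OF _ norm_ge_zero])

instance l2 :: (type) complete_space
proof
  fix X :: "nat \<Rightarrow> 'a l2"
  assume X: "Cauchy X"
  have "Cauchy (\<lambda>n. coord (X n) i)" for i
  proof (rule metric_CauchyI)
    fix e :: real assume "0 < e"
    then obtain M where "\<forall>m\<ge>M. \<forall>n\<ge>M. dist (X m) (X n) < e"
      using metric_CauchyD[OF X] by blast
    moreover have "dist (coord (X m) i) (coord (X n) i) \<le> dist (X m) (X n)" for m n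
      using norm_coord_le[of "X m - X n" i] by (simp add: dist_norm)
    ultimately show "\<exists>M. \<forall>m\<ge>M. \<forall>n\<ge>M. dist (coord (X m) i) (coord (X n) i) < e"
      by (meson le_less_trans)
  qed
  then have "\<forall>i. \<exists>l. (\<lambda>n. coord (X n) i) \<longlonglongrightarrow> l"
    using Cauchy_convergent convergent_def by blast
  then obtain g where g: "\<And>i. (\<lambda>n. coord (X n) i) \<longlonglongrightarrow> g i" by metis
  \<comment> \<open>The coordinatewise limit \<open>g\<close> is not yet known to be square
    summable, so convergence is phrased through finite partial sums. The same estimate then yields
    summability and norm convergence.\<close>
  have *: "\<exists>M. \<forall>n\<ge>M. \<forall>F. finite F \<longrightarrow> (\<Sum>i\<in>F. (cmod (coord (X n) i - g i))\<^sup>2) \<le> e\<^sup>2"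
    if "0 < e" for e :: real
  proof -
    from X that obtain M where M: "\<forall>m\<ge>M. \<forall>n\<ge>M. dist (X m) (X n) < e"
      using metric_CauchyD by blast
    have "(\<Sum>i\<in>F. (cmod (coord (X n) i - g i))\<^sup>2) \<le> e\<^sup>2" if "M \<le> n" "finite F" for n F
    proof (rule tendsto_upperbound)
      show "(\<lambda>m. \<Sum>i\<in>F. (cmod (coord (X n) i - coord (X m) i))\<^sup>2)
          \<longlonglongrightarrow> (\<Sum>i\<in>F. (cmod (coord (X n) i - g i))\<^sup>2)"
        by (intro tendsto_intros g)
      show "\<forall>\<^sub>F m in sequentially. (\<Sum>i\<in>F. (cmod (coord (X n) i - coord (X m) i))\<^sup>2) \<le> e\<^sup>2"
      proof (rule eventually_sequentiallyI)
        fix m assume "M \<le> m"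
        then have "norm (X n - X m) \<le> e" using M \<open>M \<le> n\<close> by (auto simp: dist_norm less_imp_le)
        then have "(norm (X n - X m))\<^sup>2 \<le> e\<^sup>2" by (simp add: power_mono)
        then show "(\<Sum>i\<in>F. (cmod (coord (X n) i - coord (X m) i))\<^sup>2) \<le> e\<^sup>2"
          using finite_sum_le_norm_l2[OF \<open>finite F\<close>, of "X n - X m"] by simp
      qed
    qed simp
    then show ?thesis by blast
  qed
  obtain M where M: "\<And>F. finite F \<Longrightarrow> (\<Sum>i\<in>F. (cmod (coord (X M) i - g i))\<^sup>2) \<le> 1"
    using *[of 1] by auto
  have "(\<lambda>i. (cmod (coord (X M) i - g i))\<^sup>2) summable_on UNIV"
    using M square_summable_iff[of "\<lambda>i. coord (X M) i - g i"] by blast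
  \<comment> \<open>Here \<open>g\<close> is written as \<open>X M\<close> minus the difference
    \<open>X M - g\<close>, both square summable.\<close>
  then have "(\<lambda>i. (cmod (coord (X M) i + (-1) *\<^sub>R (coord (X M) i - g i)))\<^sup>2) summable_on UNIV"
    by (intro square_summable_add square_summable_scaleR coord_summable)
  then have g2: "coord (Abs_l2 g) = g" by simp
  have "X \<longlonglongrightarrow> Abs_l2 g"
  proof (rule metric_LIMSEQ_I)
    fix r :: real assume r: "0 < r"
    then obtain M where M: "\<forall>n\<ge>M. \<forall>F. finite F \<longrightarrow>
        (\<Sum>i\<in>F. (cmod (coord (X n) i - g i))\<^sup>2) \<le> (r / 2)\<^sup>2"
      using *[of "r / 2"] by auto
    have "dist (X n) (Abs_l2 g) < r" if "M \<le> n" for n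
      using norm_l2_leI[of "r / 2" "X n - Abs_l2 g"] M that r by (auto simp: g2 dist_norm)
    then show "\<exists>no. \<forall>n\<ge>no. dist (X n) (Abs_l2 g) < r" by blast
  qed
  then show "convergent X" by (rule convergentI)
qed

instance l2 :: (type) banach ..

section \<open>The absolute value of a symmetric contraction\<close>

text \<open>The iteration \<open>Z\<^sub>n\<^sub>+\<^sub>1 = (1 - T\<^sup>2 + Z\<^sub>n\<^sup>2) / 2\<close> converges to \<open>1 - |T|\<close>; \<open>z\<^sub>n\<close> below is its scalar
  majorant, and \<open>X\<^sub>n = z\<^sub>n - Z\<^sub>n\<close> is a polynomial in \<open>T\<close> without constant term.\<close>

fun maj :: "nat \<Rightarrow> real" where
  "maj 0 = 0"
| "maj (Suc n) = (1 + (maj n)\<^sup>2) / 2"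

lemma maj_bounds: "0 \<le> maj n" "maj n \<le> 1"
proof (induction n)
  case (Suc n)
  { case 1 show ?case by simp next case 2 show ?case using Suc by (simp add: power_le_one) }
qed auto

lemma maj_le_Suc: "maj n \<le> maj (Suc n)"
proof -
  have "0 \<le> (1 - maj n)\<^sup>2" by simp
  then show ?thesis by (simp add: power2_diff)
qed

lemma maj_mono: "m \<le> n \<Longrightarrow> maj m \<le> maj n"
  by (rule lift_Suc_mono_le[of maj]) (rule maj_le_Suc)

lemma maj_tendsto: "maj \<longlonglongrightarrow> 1"
proof -
  have "incseq maj" by (simp add: mono_def maj_mono)
  then obtain l where l: "maj \<longlonglongrightarrow> l"
    using incseq_convergent[of maj 1] maj_bounds(2) by blast
  have "(\<lambda>n. maj (Suc n)) \<longlonglongrightarrow> (1 + l\<^sup>2) / 2"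
    unfolding maj.simps by (intro tendsto_intros l) auto
  moreover have "(\<lambda>n. maj (Suc n)) \<longlonglongrightarrow> l" using l by (rule LIMSEQ_Suc)
  ultimately have "(1 + l\<^sup>2) / 2 = l" by (rule LIMSEQ_unique)
  then have "(l - 1)\<^sup>2 = 0" by (simp add: power2_diff)
  then show ?thesis using l by simp
qed

text \<open>The recursion results from putting \<open>maj n - X\<close> for \<open>Z\<close> in the
  iteration for \<open>Z\<close>, which cancels the constant 1. Only products and linear
  combinations remain, so the same recursion can be run with convolution in an algebra without
  unit.\<close>

fun abs_approx :: "('h::real_normed_vector \<Rightarrow> 'h) \<Rightarrow> nat \<Rightarrow> 'h \<Rightarrow> 'h" where
  "abs_approx T 0 v = 0"
| "abs_approx T (Suc n) v = (1 / 2) *\<^sub>R T (T v) + maj n *\<^sub>R abs_approx T n v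
     - (1 / 2) *\<^sub>R abs_approx T n (abs_approx T n v)"

locale symmetric_contraction =
  fixes T :: "'h::{real_inner, complete_space} \<Rightarrow> 'h"
  assumes linear: "linear T"
    and sym: "inner (T v) w = inner v (T w)"
    and contraction: "norm (T v) \<le> norm v"
begin

interpretation T: linear T by (rule linear)

abbreviation X where "X \<equiv> abs_approx T"

definition Z where "Z n v = maj n *\<^sub>R v - X n v"

lemma linear_X: "linear (X n)"
proof (induction n)
  case 0
  then show ?case using linear_zero by (simp add: module_hom_zero)
next
  case (Suc n)
  interpret X: linear "X n" by fact
  show ?case
    by (rule linearI) (auto simp: T.add X.add T.scaleR X.scaleR algebra_simps)
qed

lemma linear_Z: "linear (Z n)"
proof -
  interpret X: linear "X n" by (rule linear_X)
  show ?thesis unfolding Z_def by (rule linearI) (auto simp: X.add X.scaleR algebra_simps)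
qed

lemma Z_Suc: "Z (Suc n) v = (1 / 2) *\<^sub>R (v - T (T v) + Z n (Z n v))"
proof -
  interpret X: linear "X n" by (rule linear_X)
  show ?thesis
    by (simp add: Z_def X.diff X.scaleR algebra_simps power2_eq_square add_divide_distrib
        flip: scaleR_add_left)
qed

text \<open>In the expansion of the square, the term \<open>(norm (T v))\<^sup>2\<close> occurs
  twice with a minus sign and absorbs the last term, because \<open>T\<close> is a
  contraction.\<close>

lemma norm_one_minus_square: "norm (v - T (T v)) \<le> norm v"
proof (rule power2_le_imp_le)
  have "(norm (v - T (T v)))\<^sup>2 = (norm v)\<^sup>2 - 2 * (norm (T v))\<^sup>2 + (norm (T (T v)))\<^sup>2"
    by (simp add: power2_norm_eq_inner inner_diff_left inner_diff_right sym inner_commute)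
  moreover have "(norm (T (T v)))\<^sup>2 \<le> (norm (T v))\<^sup>2" by (simp add: contraction power_mono)
  moreover have "0 \<le> (norm (T v))\<^sup>2" by simp
  ultimately show "(norm (v - T (T v)))\<^sup>2 \<le> (norm v)\<^sup>2" by linarith
qed simp

lemma norm_Z: "norm (Z n v) \<le> maj n * norm v"
proof (induction n arbitrary: v)
  case (Suc n)
  have "norm (Z n (Z n v)) \<le> maj n * norm (Z n v)" by (rule Suc)
  also have "\<dots> \<le> maj n * (maj n * norm v)"
    by (intro mult_left_mono Suc maj_bounds)
  finally have "norm (Z n (Z n v)) \<le> (maj n)\<^sup>2 * norm v" by (simp add: power2_eq_square)
  then have "norm (v - T (T v) + Z n (Z n v)) \<le> norm v + (maj n)\<^sup>2 * norm v"
    using norm_one_minus_square[of v] norm_triangle_ineq by (smt (verit))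
  then show ?case unfolding Z_Suc norm_scaleR by (simp add: algebra_simps)
qed (simp add: Z_def)

text \<open>A difference of squares splits as
  \<open>Z (n+1) (Z (n+1) - Z n) + (Z (n+1) - Z n) Z n\<close>. The squares of the majorants split
  in the same way, so bounding each factor reproduces the scalar recursion.\<close>

lemma norm_Z_diff_Suc: "norm (Z (Suc n) v - Z n v) \<le> (maj (Suc n) - maj n) * norm v"
proof (induction n arbitrary: v)
  case 0
  then show ?case using norm_Z[of 1 v] by (simp add: Z_def)
next
  case (Suc n)
  interpret Z: linear "Z (Suc n)" by (rule linear_Z)
  let ?d = "maj (Suc n) - maj n"
  have "Z (Suc (Suc n)) v - Z (Suc n) v = (1 / 2) *\<^sub>R (Z (Suc n) (Z (Suc n) v) - Z n (Z n v))"
    unfolding Z_Suc[of "Suc n" v] Z_Suc[of n v] by (simp add: algebra_simps)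
  also have "\<dots> = (1 / 2) *\<^sub>R (Z (Suc n) (Z (Suc n) v - Z n v) + (Z (Suc n) (Z n v) - Z n (Z n v)))"
    by (simp add: Z.diff)
  finally have "norm (Z (Suc (Suc n)) v - Z (Suc n) v) \<le>
      (1 / 2) * (norm (Z (Suc n) (Z (Suc n) v - Z n v)) + norm (Z (Suc n) (Z n v) - Z n (Z n v)))"
    using norm_triangle_ineq by simp
  moreover have "norm (Z (Suc n) (Z (Suc n) v - Z n v)) \<le> maj (Suc n) * (?d * norm v)"
    using norm_Z[of "Suc n"] mult_left_mono[OF Suc maj_bounds(1)[of "Suc n"]] order_trans by blast
  moreover have "norm (Z (Suc n) (Z n v) - Z n (Z n v)) \<le> ?d * (maj n * norm v)"
    using Suc[of "Z n v"] mult_left_mono[OF norm_Z[of n v]] maj_le_Suc[of n]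
    by (smt (verit, best))
  ultimately have "norm (Z (Suc (Suc n)) v - Z (Suc n) v)
      \<le> (1 / 2) * (maj (Suc n) * (?d * norm v) + ?d * (maj n * norm v))"
    by (meson add_mono mult_left_mono order_trans zero_le_divide_1_iff zero_le_numeral)
  also have "\<dots> = (maj (Suc (Suc n)) - maj (Suc n)) * norm v"
    unfolding maj.simps(2)[of "Suc n"] unfolding maj.simps(2)[of n]
    by (simp add: power2_eq_square field_simps)
  finally show ?case .
qed

lemma norm_Z_diff: "m \<le> n \<Longrightarrow> norm (Z n v - Z m v) \<le> (maj n - maj m) * norm v"
proof (induction n rule: dec_induct)
  case (step n)
  have "norm (Z (Suc n) v - Z m v) \<le> norm (Z (Suc n) v - Z n v) + norm (Z n v - Z m v)"
    using norm_triangle_ineq[of "Z (Suc n) v - Z n v" "Z n v - Z m v"] by simp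
  then show ?case using norm_Z_diff_Suc[of n v] step.IH by (simp add: algebra_simps)
qed simp

lemma norm_Z_le: "norm (Z n v) \<le> norm v"
  using norm_Z[of n v] mult_right_mono[OF maj_bounds(2)[of n] norm_ge_zero[of v]] by linarith

text \<open>One half of the bound comes from the scalars and the other from
  \<open>norm_Z_diff\<close>. The factor in front of \<open>norm v\<close> involves neither
  \<open>T\<close> nor the space, which later gives a Cauchy sequence in the supremum over all
  units.\<close>

lemma norm_X_diff:
  assumes "m \<le> n"
  shows "norm (X n v - X m v) \<le> 2 * (1 - maj m) * norm v"
proof -
  have "X n v - X m v = (maj n - maj m) *\<^sub>R v - (Z n v - Z m v)"
    by (simp add: Z_def algebra_simps)
  then have "norm (X n v - X m v) \<le> \<bar>maj n - maj m\<bar> * norm v + norm (Z n v - Z m v)"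
    by (metis norm_triangle_ineq4 norm_scaleR)
  also have "\<dots> \<le> (maj n - maj m) * norm v + (maj n - maj m) * norm v"
    using norm_Z_diff[OF assms] maj_mono[OF assms] by (simp del: maj.simps add: algebra_simps)
  also have "\<dots> = 2 * (maj n - maj m) * norm v" by simp
  also have "\<dots> \<le> 2 * (1 - maj m) * norm v"
    using maj_bounds(2)[of n] by (intro mult_right_mono) auto
  finally show ?thesis .
qed

text \<open>The strong limit of the approximants is \<open>|T|\<close>, characterised below by being
  symmetric and positive with square \<open>T\<^sup>2\<close>.\<close>

definition A where "A v = lim (\<lambda>n. X n v)"

lemma X_tendsto: "(\<lambda>n. X n v) \<longlonglongrightarrow> A v"
proof -
  have "Cauchy (\<lambda>n. X n v)"
  proof (rule metric_CauchyI)
    fix e :: real assume "0 < e"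
    have "(\<lambda>m. 2 * (1 - maj m) * norm v) \<longlonglongrightarrow> 2 * (1 - 1) * norm v"
      by (intro tendsto_intros maj_tendsto)
    then have "\<forall>\<^sub>F m in sequentially. 2 * (1 - maj m) * norm v < e / 2"
      by (rule order_tendstoD) (use \<open>0 < e\<close> in auto)
    then obtain M where M: "2 * (1 - maj M) * norm v < e / 2"
      by (meson eventually_sequentially order_refl)
    have "dist (X n v) (X M v) < e / 2" if "M \<le> n" for n
      using norm_X_diff[OF that, of v] M by (simp add: dist_norm)
    then show "\<exists>M. \<forall>m\<ge>M. \<forall>n\<ge>M. dist (X m v) (X n v) < e"
      by (intro exI[of _ M]) (meson dist_triangle_half_l)
  qed
  then show ?thesis unfolding A_def
    using Cauchy_convergent convergent_LIMSEQ_iff by blast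
qed

lemma Z_tendsto: "(\<lambda>n. Z n v) \<longlonglongrightarrow> v - A v"
  using tendsto_diff[OF tendsto_scaleR[OF maj_tendsto tendsto_const[of v]] X_tendsto[of v]]
  by (simp add: Z_def)

lemma linear_A: "linear A"
proof (rule linearI)
  fix v w :: 'h and r :: real
  have "(\<lambda>n. X n (v + w)) \<longlonglongrightarrow> A v + A w"
    using tendsto_add[OF X_tendsto[of v] X_tendsto[of w]] by (simp add: linear_add[OF linear_X])
  then show "A (v + w) = A v + A w" using X_tendsto LIMSEQ_unique by blast
  have "(\<lambda>n. X n (r *\<^sub>R v)) \<longlonglongrightarrow> r *\<^sub>R A v"
    using tendsto_scaleR[OF tendsto_const X_tendsto] by (simp add: linear_scale[OF linear_X])
  then show "A (r *\<^sub>R v) = r *\<^sub>R A v" using X_tendsto LIMSEQ_unique by blast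
qed

lemma sym_X: "inner (X n v) w = inner v (X n w)"
  by (induction n arbitrary: v w)
    (simp_all add: inner_diff_left inner_diff_right inner_add_left inner_add_right sym)

lemma sym_A: "inner (A v) w = inner v (A w)"
proof (rule LIMSEQ_unique)
  show "(\<lambda>n. inner (X n v) w) \<longlonglongrightarrow> inner (A v) w"
    by (intro tendsto_intros X_tendsto)
  show "(\<lambda>n. inner (X n v) w) \<longlonglongrightarrow> inner v (A w)"
    unfolding sym_X by (intro tendsto_intros X_tendsto)
qed

lemma X_commute: "X n (T v) = T (X n v)"
  by (induction n arbitrary: v) (simp_all add: T.diff T.add T.scaleR T.zero)

lemma bounded_linear_T: "bounded_linear T"
  using linear contraction by (intro bounded_linear_intro[of T 1]) (auto simp: T.add T.scaleR)

lemma A_commute: "A (T v) = T (A v)"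
proof (rule LIMSEQ_unique)
  show "(\<lambda>n. X n (T v)) \<longlonglongrightarrow> A (T v)" by (rule X_tendsto)
  show "(\<lambda>n. X n (T v)) \<longlonglongrightarrow> T (A v)"
    unfolding X_commute by (intro bounded_linear.tendsto[OF bounded_linear_T] X_tendsto)
qed

lemma norm_id_minus_A: "norm (v - A v) \<le> norm v"
proof (rule tendsto_upperbound)
  show "(\<lambda>n. norm (Z n v)) \<longlonglongrightarrow> norm (v - A v)" by (intro tendsto_intros Z_tendsto)
  show "\<forall>\<^sub>F n in sequentially. norm (Z n v) \<le> norm v"
    using norm_Z_le by simp
qed simp

text \<open>Since \<open>1 - A\<close> is a contraction, \<open>inner (v - A v) v\<close> is at most
  the squared norm of \<open>v\<close>.\<close>

lemma A_nonneg: "0 \<le> inner (A v) v"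
proof -
  have "inner (v - A v) v \<le> norm (v - A v) * norm v" by (rule norm_cauchy_schwarz)
  also have "\<dots> \<le> norm v * norm v" by (intro mult_right_mono norm_id_minus_A) simp
  finally show ?thesis by (simp add: inner_diff_left dot_square_norm power2_eq_square)
qed

text \<open>The fixed point equation of the iteration reads
  \<open>2 (1 - A) = 1 - T\<^sup>2 + (1 - A)\<^sup>2\<close>. Strong convergence passes to the
  composition \<open>Z n (Z n v)\<close> because all \<open>Z n\<close> are contractions.\<close>

lemma A_square: "A (A v) = T (T v)"
proof -
  interpret A: linear A by (rule linear_A)
  have "(\<lambda>n. Z n (Z n v) - Z n (v - A v)) \<longlonglongrightarrow> 0"
  proof (rule Lim_null_comparison)
    show "\<forall>\<^sub>F n in sequentially. norm (Z n (Z n v) - Z n (v - A v)) \<le> norm (Z n v - (v - A v))"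
      using norm_Z_le by (intro always_eventually allI) (simp add: linear_diff[OF linear_Z, symmetric])
    show "(\<lambda>n. norm (Z n v - (v - A v))) \<longlonglongrightarrow> 0"
      using Z_tendsto[of v] by (simp add: LIM_zero tendsto_norm_zero)
  qed
  then have "(\<lambda>n. Z n (Z n v)) \<longlonglongrightarrow> (v - A v) - A (v - A v)"
    using Z_tendsto[of "v - A v"] by (rule Lim_transform[rotated])
  then have "(\<lambda>n. (1 / 2) *\<^sub>R (v - T (T v) + Z n (Z n v)))
      \<longlonglongrightarrow> (1 / 2) *\<^sub>R (v - T (T v) + ((v - A v) - A (v - A v)))"
    by (intro tendsto_intros)
  moreover have "(\<lambda>n. (1 / 2) *\<^sub>R (v - T (T v) + Z n (Z n v))) \<longlonglongrightarrow> v - A v"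
    using LIMSEQ_Suc[OF Z_tendsto[of v]] by (simp add: Z_Suc)
  ultimately have "(1 / 2) *\<^sub>R (v - T (T v) + ((v - A v) - A (v - A v))) = v - A v"
    by (rule LIMSEQ_unique)
  from arg_cong[OF this, of "\<lambda>w. 2 *\<^sub>R w"] show ?thesis
    by (simp add: A.diff scaleR_2)
qed

text \<open>Evaluating the form at \<open>u + t P u\<close> gives a nonnegative quadratic polynomial
  in \<open>t\<close> without constant term, so its linear coefficient, twice the squared norm of
  \<open>P u\<close>, must vanish.\<close>

lemma positive_form_null:
  assumes "linear P" "\<And>v w. inner (P v) w = inner v (P w)" "\<And>v. 0 \<le> inner (P v) v"
    and "inner (P u) u = 0"
  shows "P u = 0"
proof (rule ccontr)
  assume "P u \<noteq> 0"
  interpret P: linear P by fact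
  let ?a = "inner (P u) (P u)" and ?b = "inner (P (P u)) (P u)"
  have a: "0 < ?a" using \<open>P u \<noteq> 0\<close> by simp
  have b: "0 \<le> ?b" by (rule assms)
  have *: "0 \<le> 2 * t * ?a + t\<^sup>2 * ?b" for t
  proof -
    have "0 \<le> inner (P (u + t *\<^sub>R P u)) (u + t *\<^sub>R P u)" by (rule assms)
    also have "\<dots> = inner (P u) u + t * ?a + t * inner (P (P u)) u + t * t * ?b"
      by (simp only: P.add P.scaleR inner_add_left inner_add_right inner_scaleR_left
          inner_scaleR_right) (simp add: algebra_simps)
    finally show ?thesis
      using assms(4) assms(2)[of "P u" u] by (simp add: power2_eq_square)
  qed
  \<comment> \<open>The polynomial takes the value
    \<open>- ?a\<^sup>2 (?b + 2) / (?b + 1)\<^sup>2\<close> here; the added 1 covers the case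
    \<open>?b = 0\<close>.\<close>
  define t where "t = - ?a / (?b + 1)"
  have t: "t * (?b + 1) = - ?a" using b by (simp add: t_def)
  have "0 \<le> (2 * t * ?a + t\<^sup>2 * ?b) * (?b + 1)\<^sup>2" using * by simp
  also have "\<dots> = 2 * (t * (?b + 1)) * ?a * (?b + 1) + (t * (?b + 1))\<^sup>2 * ?b"
    by (simp only: power2_eq_square ring_distribs mult_ac)
  also have "\<dots> = - (?a\<^sup>2 * (?b + 2))" unfolding t by (simp add: power2_eq_square algebra_simps)
  also have "\<dots> < 0" using a b by simp
  finally show False by simp
qed

text \<open>For \<open>d = A v - T v\<close> the commuting product
  \<open>(A + T) (A - T) = A\<^sup>2 - T\<^sup>2 = 0\<close> gives \<open>A d + T d = 0\<close>. If
  both forms are positive, each annihilates \<open>d\<close>, and by symmetry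
  \<open>inner d d = inner v (A d - T d) = 0\<close>.\<close>

lemma A_eq_iff: "(\<forall>v. A v = T v) \<longleftrightarrow> (\<forall>v. 0 \<le> inner (T v) v)"
proof
  assume "\<forall>v. A v = T v"
  then show "\<forall>v. 0 \<le> inner (T v) v" using A_nonneg by metis
next
  assume pos: "\<forall>v. 0 \<le> inner (T v) v"
  interpret A: linear A by (rule linear_A)
  show "\<forall>v. A v = T v"
  proof
    fix v
    define d where "d = A v - T v"
    have "A d + T d = 0"
      unfolding d_def by (simp add: A.diff T.diff A_square A_commute)
    then have "inner (A d) d + inner (T d) d = 0"
      by (metis inner_add_left inner_zero_left)
    then have "inner (A d) d = 0" "inner (T d) d = 0"
      using A_nonneg[of d] pos by (smt (verit))+
    then have "A d = 0" "T d = 0"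
      using positive_form_null[OF linear_A sym_A A_nonneg] positive_form_null[OF linear sym] pos
      by blast+
    then have "inner d d = 0"
      by (metis d_def inner_diff_left inner_zero_right sym sym_A diff_self)
    then show "A v = T v" by (simp add: d_def)
  qed
qed

end

section \<open>Matrices with uniformly finite rows and columns\<close>

text \<open>Compact supports covered by finitely many bisections provide exactly such counts, and a
  Schur type estimate turns them into boundedness on l2.\<close>

definition fin_band :: "nat \<Rightarrow> real \<Rightarrow> ('a \<Rightarrow> 'a \<Rightarrow> complex) \<Rightarrow> bool" where
  "fin_band m M K \<longleftrightarrow>
     (\<forall>g. finite {h. K g h \<noteq> 0} \<and> card {h. K g h \<noteq> 0} \<le> m) \<and>
     (\<forall>h. finite {g. K g h \<noteq> 0} \<and> card {g. K g h \<noteq> 0} \<le> m) \<and>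
     (\<forall>g h. cmod (K g h) \<le> M)"

definition mat_fun :: "('a \<Rightarrow> 'a \<Rightarrow> complex) \<Rightarrow> ('a \<Rightarrow> complex) \<Rightarrow> 'a \<Rightarrow> complex" where
  "mat_fun K \<xi> g = (\<Sum>h | K g h \<noteq> 0. K g h * \<xi> h)"

definition mat_op :: "('a \<Rightarrow> 'a \<Rightarrow> complex) \<Rightarrow> 'a l2 \<Rightarrow> 'a l2" where
  "mat_op K x = Abs_l2 (mat_fun K (coord x))"

lemma fin_bandD:
  assumes "fin_band m M K"
  shows "finite {h. K g h \<noteq> 0}" "card {h. K g h \<noteq> 0} \<le> m"
    "finite {g. K g h \<noteq> 0}" "card {g. K g h \<noteq> 0} \<le> m" "cmod (K g h) \<le> M" "0 \<le> M"
proof -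
  show "0 \<le> M" using assms norm_ge_zero order_trans unfolding fin_band_def by blast
qed (use assms in \<open>auto simp: fin_band_def\<close>)

lemma mat_fun_superset:
  assumes "finite S" "{h. K g h \<noteq> 0} \<subseteq> S"
  shows "mat_fun K \<xi> g = (\<Sum>h\<in>S. K g h * \<xi> h)"
  unfolding mat_fun_def using assms by (intro sum.mono_neutral_left) auto

text \<open>Double counting: after exchanging the sums, each index \<open>h\<close> is counted once
  for every nonzero entry of its column.\<close>

lemma fin_band_sum_le:
  fixes x :: "'a l2"
  assumes K: "fin_band m M K" and "finite F" "finite U"
  shows "(\<Sum>g\<in>F. \<Sum>h\<in>{h \<in> U. K g h \<noteq> 0}. (cmod (coord x h))\<^sup>2) \<le> real m * (norm x)\<^sup>2"
proof -
  have "(\<Sum>g\<in>F. \<Sum>h\<in>{h \<in> U. K g h \<noteq> 0}. (cmod (coord x h))\<^sup>2)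
      = (\<Sum>h\<in>U. \<Sum>g\<in>{g \<in> F. K g h \<noteq> 0}. (cmod (coord x h))\<^sup>2)"
    using assms by (intro sum.swap_restrict) auto
  also have "\<dots> = (\<Sum>h\<in>U. real (card {g \<in> F. K g h \<noteq> 0}) * (cmod (coord x h))\<^sup>2)"
    by simp
  also have "\<dots> \<le> (\<Sum>h\<in>U. real m * (cmod (coord x h))\<^sup>2)"
  proof (intro sum_mono mult_right_mono)
    fix h
    have "card {g \<in> F. K g h \<noteq> 0} \<le> card {g. K g h \<noteq> 0}"
      using fin_bandD[OF K] by (intro card_mono) auto
    then show "real (card {g \<in> F. K g h \<noteq> 0}) \<le> real m"
      using fin_bandD(4)[OF K, of h] by linarith
  qed simp
  also have "\<dots> = real m * (\<Sum>h\<in>U. (cmod (coord x h))\<^sup>2)" by (simp add: sum_distrib_left)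
  also have "\<dots> \<le> real m * (norm x)\<^sup>2"
    by (intro mult_left_mono finite_sum_le_norm_l2) (use assms in auto)
  finally show ?thesis .
qed

text \<open>Cauchy-Schwarz in each row costs one factor \<open>m\<close>; counting the columns costs
  the other.\<close>

lemma mat_fun_bound:
  assumes K: "fin_band m M K" and F: "finite F"
  shows "(\<Sum>g\<in>F. (cmod (mat_fun K (coord x) g))\<^sup>2) \<le> (real m * M * norm x)\<^sup>2"
proof -
  note D = fin_bandD[OF K]
  define U where "U = (\<Union>g\<in>F. {h. K g h \<noteq> 0})"
  have U: "finite U" using F D by (auto simp: U_def)
  have *: "(cmod (mat_fun K (coord x) g))\<^sup>2
      \<le> real m * M\<^sup>2 * (\<Sum>h\<in>{h \<in> U. K g h \<noteq> 0}. (cmod (coord x h))\<^sup>2)" if "g \<in> F" for g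
  proof -
    let ?S = "{h. K g h \<noteq> 0}"
    have "cmod (mat_fun K (coord x) g) \<le> (\<Sum>h\<in>?S. cmod (K g h * coord x h))"
      unfolding mat_fun_def by (rule norm_sum)
    also have "\<dots> \<le> (\<Sum>h\<in>?S. M * cmod (coord x h))"
      by (intro sum_mono) (auto simp: norm_mult intro!: mult_right_mono D)
    finally have "(cmod (mat_fun K (coord x) g))\<^sup>2 \<le> (\<Sum>h\<in>?S. M * cmod (coord x h))\<^sup>2"
      by (intro power_mono) auto
    also have "\<dots> \<le> (\<Sum>h\<in>?S. (M * cmod (coord x h))\<^sup>2) * real (card ?S)"
      by (rule sum_squared_le_sum_of_squares)
    also have "\<dots> \<le> (\<Sum>h\<in>?S. (M * cmod (coord x h))\<^sup>2) * real m"
      using D(2) by (intro mult_left_mono sum_nonneg) auto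
    also have "\<dots> = real m * M\<^sup>2 * (\<Sum>h\<in>?S. (cmod (coord x h))\<^sup>2)"
      by (simp add: power_mult_distrib sum_distrib_left sum_distrib_right mult_ac)
    also have "?S = {h \<in> U. K g h \<noteq> 0}" using that by (auto simp: U_def)
    finally show ?thesis .
  qed
  have "(\<Sum>g\<in>F. (cmod (mat_fun K (coord x) g))\<^sup>2)
      \<le> (\<Sum>g\<in>F. real m * M\<^sup>2 * (\<Sum>h\<in>{h \<in> U. K g h \<noteq> 0}. (cmod (coord x h))\<^sup>2))"
    by (intro sum_mono *)
  also have "\<dots> = real m * M\<^sup>2 * (\<Sum>g\<in>F. \<Sum>h\<in>{h \<in> U. K g h \<noteq> 0}. (cmod (coord x h))\<^sup>2)"
    by (simp add: sum_distrib_left)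
  also have "\<dots> \<le> real m * M\<^sup>2 * (real m * (norm x)\<^sup>2)"
    by (intro mult_left_mono fin_band_sum_le[OF K F U]) simp
  also have "\<dots> = (real m * M * norm x)\<^sup>2"
    by (simp add: power2_eq_square mult_ac)
  finally show ?thesis .
qed

lemma coord_mat_op:
  assumes "fin_band m M K"
  shows "coord (mat_op K x) = mat_fun K (coord x)"
  unfolding mat_op_def
  using mat_fun_bound[OF assms] square_summable_iff by (intro coord_Abs_l2) blast

lemma norm_mat_op:
  assumes "fin_band m M K"
  shows "norm (mat_op K x) \<le> real m * M * norm x"
proof (rule norm_l2_leI)
  show "0 \<le> real m * M * norm x" using fin_bandD(6)[OF assms] by simp
qed (simp add: coord_mat_op[OF assms] mat_fun_bound[OF assms])

lemma linear_mat_op: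
  assumes "fin_band m M K"
  shows "linear (mat_op K)"
  by (rule linearI; rule l2_eqI)
    (auto simp: coord_mat_op[OF assms] mat_fun_def sum.distrib algebra_simps scaleR_sum_right)

lemma infsum_finite_support:
  fixes f :: "'a \<Rightarrow> 'b :: {comm_monoid_add, t2_space}"
  assumes "finite S" "\<And>x. x \<in> A \<Longrightarrow> x \<notin> S \<Longrightarrow> f x = 0" "S \<subseteq> A"
  shows "infsum f A = sum f S"
proof -
  have "infsum f A = infsum f S" by (rule infsum_cong_neutral) (use assms in auto)
  then show ?thesis using assms by simp
qed

text \<open>Both sides are iterated sums of the same double family \<open>\<phi>\<close>. They may
  be exchanged because \<open>\<phi>\<close> is absolutely summable: it is dominated by the squared
  coordinates, and each coordinate meets at most \<open>m\<close> nonzero entries.\<close>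

lemma inner_mat_op:
  assumes K: "fin_band m M K"
  shows "inner (mat_op K x) y = inner x (mat_op (\<lambda>g h. cnj (K h g)) y)"
proof -
  note D = fin_bandD[OF K]
  let ?L = "\<lambda>g h. cnj (K h g)"
  have L: "fin_band m M ?L" using K by (simp add: fin_band_def)
  define \<phi> where "\<phi> = (\<lambda>g h. inner (K g h * coord x h) (coord y g))"
  have \<phi>_bound: "norm (\<phi> g h) \<le> M * ((cmod (coord x h))\<^sup>2 + (cmod (coord y g))\<^sup>2)" for g h
  proof -
    have "norm (\<phi> g h) \<le> cmod (K g h * coord x h) * cmod (coord y g)"
      unfolding \<phi>_def using Cauchy_Schwarz_ineq2 by auto
    also have "\<dots> \<le> M * (cmod (coord x h) * cmod (coord y g))"
      by (simp add: norm_mult mult.assoc mult_right_mono D)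
    also have "\<dots> \<le> M * ((cmod (coord x h))\<^sup>2 + (cmod (coord y g))\<^sup>2)"
    proof (rule mult_left_mono[OF _ D(6)])
      show "cmod (coord x h) * cmod (coord y g) \<le> (cmod (coord x h))\<^sup>2 + (cmod (coord y g))\<^sup>2"
        using sum_squares_bound[of "cmod (coord x h)" "cmod (coord y g)"]
          mult_nonneg_nonneg[OF norm_ge_zero[of "coord x h"] norm_ge_zero[of "coord y g"]]
        by linarith
    qed
    finally show ?thesis .
  qed
  have \<phi>_0: "\<phi> g h = 0" if "K g h = 0" for g h using that by (simp add: \<phi>_def)
  have summable: "(\<lambda>(g, h). \<phi> g h) summable_on UNIV \<times> UNIV"
  proof (rule abs_summable_summable, rule nonneg_bdd_above_summable_on)
    show "bdd_above (sum (\<lambda>p. norm (case p of (g, h) \<Rightarrow> \<phi> g h)) ` {F. F \<subseteq> UNIV \<times> UNIV \<and> finite F})"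
    proof (rule bdd_aboveI2)
      fix P :: "('a \<times> 'a) set" assume "P \<in> {F. F \<subseteq> UNIV \<times> UNIV \<and> finite F}"
      then have P: "finite P" by simp
      let ?A = "fst ` P" and ?B = "snd ` P"
      have fin: "finite ?A" "finite ?B" using P by auto
      have "(\<Sum>p\<in>P. norm (case p of (g, h) \<Rightarrow> \<phi> g h)) \<le> (\<Sum>p\<in>?A \<times> ?B. norm (case p of (g, h) \<Rightarrow> \<phi> g h))"
        using fin by (intro sum_mono2) (auto simp: subset_fst_snd case_prod_unfold)
      also have "\<dots> = (\<Sum>g\<in>?A. \<Sum>h\<in>?B. norm (\<phi> g h))"
        by (simp add: sum.cartesian_product case_prod_unfold)
      also have "\<dots> = (\<Sum>g\<in>?A. \<Sum>h\<in>{h\<in>?B. K g h \<noteq> 0}. norm (\<phi> g h))"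
        using fin \<phi>_0 by (intro sum.cong refl sum.mono_neutral_right) auto
      also have "\<dots> \<le> (\<Sum>g\<in>?A. \<Sum>h\<in>{h\<in>?B. K g h \<noteq> 0}. M * ((cmod (coord x h))\<^sup>2 + (cmod (coord y g))\<^sup>2))"
        by (intro sum_mono \<phi>_bound)
      also have "\<dots> = M * ((\<Sum>g\<in>?A. \<Sum>h\<in>{h\<in>?B. K g h \<noteq> 0}. (cmod (coord x h))\<^sup>2)
          + (\<Sum>g\<in>?A. \<Sum>h\<in>{h\<in>?B. K g h \<noteq> 0}. (cmod (coord y g))\<^sup>2))"
        by (simp only: sum_distrib_left distrib_left sum.distrib)
      also have "(\<Sum>g\<in>?A. \<Sum>h\<in>{h\<in>?B. K g h \<noteq> 0}. (cmod (coord y g))\<^sup>2)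
          = (\<Sum>h\<in>?B. \<Sum>g\<in>{g\<in>?A. K g h \<noteq> 0}. (cmod (coord y g))\<^sup>2)"
        using fin by (intro sum.swap_restrict) auto
      also have "M * ((\<Sum>g\<in>?A. \<Sum>h\<in>{h\<in>?B. K g h \<noteq> 0}. (cmod (coord x h))\<^sup>2) + \<dots>)
          \<le> M * (real m * (norm x)\<^sup>2 + real m * (norm y)\<^sup>2)"
        using fin_band_sum_le[OF K fin, of x] fin_band_sum_le[OF L fin(2,1), of y]
        by (intro mult_left_mono add_mono D) auto
      finally show "(\<Sum>p\<in>P. norm (case p of (g, h) \<Rightarrow> \<phi> g h))
          \<le> M * (real m * (norm x)\<^sup>2 + real m * (norm y)\<^sup>2)" .
    qed
  qed auto
  have "inner (mat_op K x) y = (\<Sum>\<^sub>\<infinity>g. \<Sum>\<^sub>\<infinity>h. \<phi> g h)"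
    unfolding inner_l2_def
  proof (rule infsum_cong)
    fix g
    have "(\<Sum>\<^sub>\<infinity>h. \<phi> g h) = (\<Sum>h | K g h \<noteq> 0. \<phi> g h)"
      using D \<phi>_0 by (intro infsum_finite_support) auto
    then show "inner (coord (mat_op K x) g) (coord y g) = (\<Sum>\<^sub>\<infinity>h. \<phi> g h)"
      by (simp add: coord_mat_op[OF K] mat_fun_def inner_sum_left \<phi>_def)
  qed
  also have "\<dots> = (\<Sum>\<^sub>\<infinity>h. \<Sum>\<^sub>\<infinity>g. \<phi> g h)"
    using summable by (rule infsum_swap_banach)
  also have "\<dots> = inner x (mat_op ?L y)"
    unfolding inner_l2_def
  proof (rule infsum_cong)
    fix h
    have "(\<Sum>\<^sub>\<infinity>g. \<phi> g h) = (\<Sum>g | K g h \<noteq> 0. \<phi> g h)"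
      using D \<phi>_0 by (intro infsum_finite_support) auto
    also have "\<dots> = inner (coord x h) (\<Sum>g | K g h \<noteq> 0. cnj (K g h) * coord y g)"
      unfolding inner_sum_right \<phi>_def
      by (intro sum.cong) (auto simp: inner_complex_def algebra_simps)
    finally show "(\<Sum>\<^sub>\<infinity>g. \<phi> g h) = inner (coord x h) (coord (mat_op ?L y) h)"
      by (simp add: coord_mat_op[OF L] mat_fun_def)
  qed
  finally show ?thesis .
qed

lemma mat_fun_compose:
  assumes K: "fin_band m M K" and L: "fin_band n N L"
  shows "mat_fun K (mat_fun L \<xi>) g = mat_fun (\<lambda>g h. \<Sum>k | K g k \<noteq> 0. K g k * L k h) \<xi> g"
proof -
  let ?S = "{k. K g k \<noteq> 0}"
  define U where "U = (\<Union>k\<in>?S. {h. L k h \<noteq> 0})"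
  have U: "finite U" using fin_bandD[OF K] fin_bandD[OF L] by (auto simp: U_def)
  have "{h. (\<Sum>k\<in>?S. K g k * L k h) \<noteq> 0} \<subseteq> U"
  proof
    fix h assume "h \<in> {h. (\<Sum>k\<in>?S. K g k * L k h) \<noteq> 0}"
    then obtain k where "k \<in> ?S" "K g k * L k h \<noteq> 0"
      using sum.neutral[of ?S "\<lambda>k. K g k * L k h"] by blast
    then show "h \<in> U" by (auto simp: U_def)
  qed
  then have "mat_fun (\<lambda>g h. \<Sum>k | K g k \<noteq> 0. K g k * L k h) \<xi> g
      = (\<Sum>h\<in>U. (\<Sum>k\<in>?S. K g k * L k h) * \<xi> h)"
    using U by (intro mat_fun_superset)
  also have "\<dots> = (\<Sum>k\<in>?S. \<Sum>h\<in>U. K g k * L k h * \<xi> h)"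
    by (simp add: sum_distrib_right sum.swap[of _ U])
  also have "\<dots> = (\<Sum>k\<in>?S. K g k * mat_fun L \<xi> k)"
  proof (rule sum.cong[OF refl])
    fix k assume "k \<in> ?S"
    then have "mat_fun L \<xi> k = (\<Sum>h\<in>U. L k h * \<xi> h)"
      using U by (intro mat_fun_superset) (auto simp: U_def)
    then show "(\<Sum>h\<in>U. K g k * L k h * \<xi> h) = K g k * mat_fun L \<xi> k"
      by (simp add: sum_distrib_left mult.assoc)
  qed
  finally show ?thesis by (simp add: mat_fun_def[of K])
qed

section \<open>The regular representations as operators\<close>

context groupoid
begin

abbreviation rng ("r") where "r \<equiv> rangemap G"
abbreviation src ("s") where "s \<equiv> sourcemap G"
abbreviation mul (infixl "\<cdot>" 70) where "g \<cdot> h \<equiv> gmult G g h"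
abbreviation iv where "iv \<equiv> ginv G"

lemma arrow_mult [simp]:
  assumes "g \<in> arrows G" "h \<in> arrows G" "s g = r h"
  shows "g \<cdot> h \<in> arrows G" "r (g \<cdot> h) = r g" "s (g \<cdot> h) = s h"
  using assms mult_closed range_mult source_mult by (auto simp: composable_def)

lemma arrow_assoc:
  assumes "g \<in> arrows G" "h \<in> arrows G" "k \<in> arrows G" "s g = r h" "s h = r k"
  shows "(g \<cdot> h) \<cdot> k = g \<cdot> (h \<cdot> k)"
  using assms mult_assoc by (auto simp: composable_def)

lemmas arrow_inv [simp] = inv_closed range_inv source_inv

lemma unit_arrow [simp]:
  assumes "u \<in> units G"
  shows "u \<in> arrows G" "r u = u" "s u = u"
  using assms by (auto simp: units_def)

lemma units_rs [simp]:
  assumes "g \<in> arrows G"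
  shows "r g \<in> units G" "s g \<in> units G" "r (r g) = r g" "s (r g) = r g" "r (s g) = s g"
    "s (s g) = s g" "r g \<in> arrows G" "s g \<in> arrows G"
  using range_unit[OF assms] source_unit[OF assms] unfolding units_def by blast+

lemma unit_mult [simp]:
  "g \<in> arrows G \<Longrightarrow> r g = u \<Longrightarrow> u \<cdot> g = g" "g \<in> arrows G \<Longrightarrow> s g = u \<Longrightarrow> g \<cdot> u = g"
  by (metis unit_left) (metis unit_right)

lemma inv_cancel:
  assumes "g \<in> arrows G" "h \<in> arrows G"
  shows "s g = r h \<Longrightarrow> iv g \<cdot> (g \<cdot> h) = h" "r g = r h \<Longrightarrow> g \<cdot> (iv g \<cdot> h) = h"
    "s h = r g \<Longrightarrow> (h \<cdot> g) \<cdot> iv g = h" "s h = s g \<Longrightarrow> (h \<cdot> iv g) \<cdot> g = h"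
proof -
  assume e: "s g = r h"
  have "iv g \<cdot> (g \<cdot> h) = (iv g \<cdot> g) \<cdot> h" using assms e by (subst arrow_assoc) auto
  also have "\<dots> = h" using assms e by (simp add: inv_left)
  finally show "iv g \<cdot> (g \<cdot> h) = h" .
next
  assume e: "r g = r h"
  have "g \<cdot> (iv g \<cdot> h) = (g \<cdot> iv g) \<cdot> h" using assms e by (subst arrow_assoc) auto
  also have "\<dots> = h" using assms e by (simp add: inv_right)
  finally show "g \<cdot> (iv g \<cdot> h) = h" .
next
  assume e: "s h = r g"
  have "(h \<cdot> g) \<cdot> iv g = h \<cdot> (g \<cdot> iv g)" using assms e by (subst arrow_assoc) auto
  also have "\<dots> = h" using assms e by (simp add: inv_right)
  finally show "(h \<cdot> g) \<cdot> iv g = h" .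
next
  assume e: "s h = s g"
  have "(h \<cdot> iv g) \<cdot> g = h \<cdot> (iv g \<cdot> g)" using assms e by (subst arrow_assoc) auto
  also have "\<dots> = h" using assms e by (simp add: inv_left)
  finally show "(h \<cdot> iv g) \<cdot> g = h" .
qed

lemma inv_inv [simp]: "g \<in> arrows G \<Longrightarrow> iv (iv g) = g"
  using inv_cancel(1)[of "iv g" g] by (simp add: inv_left)

lemma inv_mult:
  assumes "g \<in> arrows G" "h \<in> arrows G" "s g = r h"
  shows "iv (g \<cdot> h) = iv h \<cdot> iv g"
proof -
  have "(g \<cdot> h) \<cdot> (iv h \<cdot> iv g) = r g"
    using assms by (simp add: arrow_assoc inv_cancel inv_right)
  then have "iv (g \<cdot> h) \<cdot> ((g \<cdot> h) \<cdot> (iv h \<cdot> iv g)) = iv (g \<cdot> h) \<cdot> r g" by simp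
  then show ?thesis using assms inv_cancel(1)[of "g \<cdot> h" "iv h \<cdot> iv g"] by simp
qed

lemma inv_unit [simp]: "u \<in> units G \<Longrightarrow> iv u = u"
  using inv_left[of u] unit_mult(2)[of "iv u" u] by simp

lemma fibre_iff [simp]:
  "g \<in> source_fibre G x \<longleftrightarrow> g \<in> arrows G \<and> s g = x"
  "g \<in> range_fibre G x \<longleftrightarrow> g \<in> arrows G \<and> r g = x"
  by (auto simp: source_fibre_def range_fibre_def)

text \<open>One pair \<open>m\<close>, \<open>M\<close> serves all fibres, so that the matrices at
  all units satisfy \<open>fin_band\<close> with common constants.\<close>

definition fibre_finite :: "('a \<Rightarrow> complex) \<Rightarrow> bool" where
  "fibre_finite f \<longleftrightarrow> (\<exists>m M. \<forall>z.
     finite {h \<in> range_fibre G z. f h \<noteq> 0} \<and> card {h \<in> range_fibre G z. f h \<noteq> 0} \<le> m \<and>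
     finite {h \<in> source_fibre G z. f h \<noteq> 0} \<and> card {h \<in> source_fibre G z. f h \<noteq> 0} \<le> m \<and>
     cmod (f z) \<le> M)"

text \<open>This is the matrix of the regular representation in the standard basis: substituting
  \<open>k = g \<cdot> iv h\<close> turns \<open>f k * \<xi> (iv k \<cdot> g)\<close> into
  \<open>f (g \<cdot> iv h) * \<xi> h\<close>.\<close>

definition kern :: "'a \<Rightarrow> ('a \<Rightarrow> complex) \<Rightarrow> 'a \<Rightarrow> 'a \<Rightarrow> complex" where
  "kern x f g h = (if g \<in> source_fibre G x \<and> h \<in> source_fibre G x then f (g \<cdot> iv h) else 0)"

text \<open>The operator acts on the whole type \<open>'a l2\<close>, not just on the fibre space.
  It is zero on vectors living off the fibre, because \<open>kern\<close> vanishes there.\<close>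

definition Op :: "'a \<Rightarrow> ('a \<Rightarrow> complex) \<Rightarrow> 'a l2 \<Rightarrow> 'a l2" where
  "Op x f = mat_op (kern x f)"

text \<open>Division is injective in either argument: \<open>h\<close> goes to
  \<open>g \<cdot> iv h\<close> in the range fibre of \<open>r g\<close>, and \<open>g\<close> goes
  to \<open>g \<cdot> iv h\<close> in the source fibre of \<open>r h\<close>. Row and column counts
  thus reduce to fibre counts, uniformly in \<open>x\<close>.\<close>

lemma fin_band_kern:
  assumes "fibre_finite f"
  obtains m M where "\<And>x. fin_band m M (kern x f)"
proof -
  obtain m M where *: "\<And>z. finite {h \<in> range_fibre G z. f h \<noteq> 0}"
     "\<And>z. card {h \<in> range_fibre G z. f h \<noteq> 0} \<le> m"
     "\<And>z. finite {h \<in> source_fibre G z. f h \<noteq> 0}"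
     "\<And>z. card {h \<in> source_fibre G z. f h \<noteq> 0} \<le> m"
     "\<And>z. cmod (f z) \<le> M"
    using assms unfolding fibre_finite_def by blast
  have M: "0 \<le> M" using *(5) norm_ge_zero order_trans by blast
  have "fin_band m M (kern x f)" for x
    unfolding fin_band_def
  proof (intro conjI allI)
    fix g
    have inj: "inj_on (\<lambda>h. g \<cdot> iv h) {h. kern x f g h \<noteq> 0}"
    proof (rule inj_onI)
      fix h k assume hk: "h \<in> {h. kern x f g h \<noteq> 0}" "k \<in> {h. kern x f g h \<noteq> 0}" "g \<cdot> iv h = g \<cdot> iv k"
      then have ar: "g \<in> arrows G" "h \<in> arrows G" "k \<in> arrows G" "s h = s g" "s k = s g"
        by (auto simp: kern_def split: if_splits)
      then have "iv h = iv g \<cdot> (g \<cdot> iv h)" "iv k = iv g \<cdot> (g \<cdot> iv k)" by (simp_all add: inv_cancel)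
      then have "iv h = iv k" using hk(3) by simp
      then show "h = k" using ar by (metis inv_inv)
    qed
    have im: "(\<lambda>h. g \<cdot> iv h) ` {h. kern x f g h \<noteq> 0} \<subseteq> {h \<in> range_fibre G (r g). f h \<noteq> 0}"
      by (auto simp: kern_def split: if_splits)
    show "finite {h. kern x f g h \<noteq> 0}" using inj_on_finite[OF inj im] * by blast
    show "card {h. kern x f g h \<noteq> 0} \<le> m" using card_inj_on_le[OF inj im] * by (meson order_trans)
    fix h
    show "cmod (kern x f g h) \<le> M" using * M by (simp add: kern_def)
  next
    fix h
    have inj: "inj_on (\<lambda>g. g \<cdot> iv h) {g. kern x f g h \<noteq> 0}"
    proof (rule inj_onI)
      fix g k assume gk: "g \<in> {g. kern x f g h \<noteq> 0}" "k \<in> {g. kern x f g h \<noteq> 0}" "g \<cdot> iv h = k \<cdot> iv h"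
      then have ar: "g \<in> arrows G" "h \<in> arrows G" "k \<in> arrows G" "s g = s h" "s k = s h"
        by (auto simp: kern_def split: if_splits)
      then have "g = g \<cdot> iv h \<cdot> h" "k = k \<cdot> iv h \<cdot> h" by (simp_all add: inv_cancel)
      then show "g = k" using gk(3) by simp
    qed
    have im: "(\<lambda>g. g \<cdot> iv h) ` {g. kern x f g h \<noteq> 0} \<subseteq> {k \<in> source_fibre G (r h). f k \<noteq> 0}"
      by (auto simp: kern_def split: if_splits)
    show "finite {g. kern x f g h \<noteq> 0}" using inj_on_finite[OF inj im] * by blast
    show "card {g. kern x f g h \<noteq> 0} \<le> m" using card_inj_on_le[OF inj im] * by (meson order_trans)
  qed
  then show ?thesis by (rule that)
qed

lemma rho_eq_mat_fun:
  assumes "fibre_finite f"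
  shows "rho G x f \<xi> = mat_fun (kern x f) \<xi>"
proof
  fix g
  obtain m M where K: "\<And>x. fin_band m M (kern x f)" using assms fin_band_kern by blast
  show "rho G x f \<xi> g = mat_fun (kern x f) \<xi> g"
  proof (cases "g \<in> source_fibre G x")
    case True
    then have g: "g \<in> arrows G" "s g = x" by auto
    have "bij_betw (\<lambda>h. g \<cdot> iv h) (source_fibre G x) (range_fibre G (r g))"
      using g by (intro bij_betwI[where g = "\<lambda>h. iv h \<cdot> g"])
        (auto simp: inv_mult arrow_assoc inv_left inv_cancel)
    then have "convolution G f \<xi> g
        = (\<Sum>\<^sub>\<infinity>h\<in>source_fibre G x. f (g \<cdot> iv h) * \<xi> (iv (g \<cdot> iv h) \<cdot> g))"
      unfolding convolution_def by (rule infsum_reindex_bij_betw[symmetric])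
    also have "\<dots> = (\<Sum>\<^sub>\<infinity>h\<in>source_fibre G x. kern x f g h * \<xi> h)"
      using g by (intro infsum_cong) (auto simp: kern_def inv_mult arrow_assoc inv_left)
    also have "\<dots> = (\<Sum>h | kern x f g h \<noteq> 0. kern x f g h * \<xi> h)"
      using fin_bandD[OF K] by (intro infsum_finite_support) (auto simp: kern_def split: if_splits)
    finally show ?thesis using True by (simp add: rho_def mat_fun_def)
  next
    case False
    then have "kern x f g h = 0" for h by (auto simp: kern_def)
    then show ?thesis using False by (auto simp: rho_def mat_fun_def)
  qed
qed

lemma coord_Op:
  assumes "fibre_finite f"
  shows "coord (Op x f v) = rho G x f (coord v)"
  using fin_band_kern[OF assms] by (metis Op_def coord_mat_op rho_eq_mat_fun[OF assms])

lemma coord_Op_sum: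
  assumes "fibre_finite f"
  shows "coord (Op x f v) g = (\<Sum>h | kern x f g h \<noteq> 0. kern x f g h * coord v h)"
  using assms by (simp add: coord_Op rho_eq_mat_fun mat_fun_def)

lemma linear_Op: "fibre_finite f \<Longrightarrow> linear (Op x f)"
  unfolding Op_def using fin_band_kern linear_mat_op by metis

lemma Op_bounded:
  assumes "fibre_finite f"
  obtains C where "0 \<le> C" "\<And>x v. norm (Op x f v) \<le> C * norm v"
proof -
  obtain m M where K: "\<And>x. fin_band m M (kern x f)" using assms fin_band_kern by blast
  show ?thesis
    using norm_mat_op[OF K] fin_bandD(6)[OF K] by (intro that[of "real m * M"]) (auto simp: Op_def)
qed

section \<open>Involution and convolution in terms of operators\<close>

definition star :: "('a \<Rightarrow> complex) \<Rightarrow> 'a \<Rightarrow> complex" where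
  "star f g = (if g \<in> arrows G then cnj (f (iv g)) else 0)"

text \<open>The value 0 off the arrows is imposed because functions in \<open>Cc G\<close> vanish
  there, whereas \<open>convolution\<close> has no controlled value at points that are not
  arrows.\<close>

definition prd :: "('a \<Rightarrow> complex) \<Rightarrow> ('a \<Rightarrow> complex) \<Rightarrow> 'a \<Rightarrow> complex" where
  "prd f1 f2 g = (if g \<in> arrows G then convolution G f1 f2 g else 0)"

lemma kern_star: "kern x (star f) = (\<lambda>g h. cnj (kern x f h g))"
  by (intro ext) (auto simp: kern_def star_def inv_mult)

lemma inner_Op:
  assumes "fibre_finite f"
  shows "inner (Op x f v) w = inner v (Op x (star f) w)"
  unfolding Op_def kern_star using fin_band_kern[OF assms] inner_mat_op by metis

lemma kern_prd:
  assumes "fibre_finite f1"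
  shows "kern x (prd f1 f2) = (\<lambda>g h. \<Sum>k | kern x f1 g k \<noteq> 0. kern x f1 g k * kern x f2 k h)"
proof (intro ext)
  fix g h
  show "kern x (prd f1 f2) g h = (\<Sum>k | kern x f1 g k \<noteq> 0. kern x f1 g k * kern x f2 k h)"
  proof (cases "g \<in> source_fibre G x \<and> h \<in> source_fibre G x")
    case True
    then have gh: "g \<in> arrows G" "s g = x" "h \<in> arrows G" "s h = x" by auto
    have "kern x (prd f1 f2) g h = convolution G f1 f2 (g \<cdot> iv h)"
      using gh by (simp add: kern_def prd_def)
    \<comment> \<open>The convolution at \<open>g \<cdot> iv h\<close> is read as \<open>f1\<close>
      acting on the right translate of \<open>f2\<close> and evaluated at \<open>g\<close>, which
      brings in the matrix formula for \<open>rho\<close>.\<close>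
    also have "\<dots> = convolution G f1 (\<lambda>p. f2 (p \<cdot> iv h)) g"
      unfolding convolution_def using gh
      by (intro infsum_cong_neutral) (auto simp: arrow_assoc)
    also have "\<dots> = rho G x f1 (\<lambda>p. f2 (p \<cdot> iv h)) g" using gh by (simp add: rho_def)
    also have "\<dots> = (\<Sum>k | kern x f1 g k \<noteq> 0. kern x f1 g k * f2 (k \<cdot> iv h))"
      by (simp add: rho_eq_mat_fun[OF assms] mat_fun_def)
    also have "\<dots> = (\<Sum>k | kern x f1 g k \<noteq> 0. kern x f1 g k * kern x f2 k h)"
      using gh by (intro sum.cong) (auto simp: kern_def)
    finally show ?thesis .
  next
    case False
    then show ?thesis by (auto simp: kern_def)
  qed
qed

lemma Op_prd:
  assumes "fibre_finite f1" "fibre_finite f2" "fibre_finite (prd f1 f2)"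
  shows "Op x (prd f1 f2) v = Op x f1 (Op x f2 v)"
proof -
  obtain m M where K: "\<And>x. fin_band m M (kern x f1)" using assms fin_band_kern by blast
  obtain n N where L: "\<And>x. fin_band n N (kern x f2)" using assms fin_band_kern by blast
  show ?thesis
    by (rule l2_eqI)
      (simp add: coord_Op assms rho_eq_mat_fun kern_prd mat_fun_compose[OF K L])
qed

lemma fibre_finite_add:
  assumes "fibre_finite f1" "fibre_finite f2"
  shows "fibre_finite (\<lambda>g. f1 g + f2 g)"
proof -
  obtain m M where 1: "\<And>z. finite {h \<in> range_fibre G z. f1 h \<noteq> 0}"
     "\<And>z. card {h \<in> range_fibre G z. f1 h \<noteq> 0} \<le> m"
     "\<And>z. finite {h \<in> source_fibre G z. f1 h \<noteq> 0}"
     "\<And>z. card {h \<in> source_fibre G z. f1 h \<noteq> 0} \<le> m"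
     "\<And>z. cmod (f1 z) \<le> M"
    using assms(1) unfolding fibre_finite_def by blast
  obtain n N where 2: "\<And>z. finite {h \<in> range_fibre G z. f2 h \<noteq> 0}"
     "\<And>z. card {h \<in> range_fibre G z. f2 h \<noteq> 0} \<le> n"
     "\<And>z. finite {h \<in> source_fibre G z. f2 h \<noteq> 0}"
     "\<And>z. card {h \<in> source_fibre G z. f2 h \<noteq> 0} \<le> n"
     "\<And>z. cmod (f2 z) \<le> N"
    using assms(2) unfolding fibre_finite_def by blast
  have *: "finite {h \<in> A. f1 h + f2 h \<noteq> 0} \<and> card {h \<in> A. f1 h + f2 h \<noteq> 0} \<le> m + n"
    if "finite {h \<in> A. f1 h \<noteq> 0}" "card {h \<in> A. f1 h \<noteq> 0} \<le> m"
      "finite {h \<in> A. f2 h \<noteq> 0}" "card {h \<in> A. f2 h \<noteq> 0} \<le> n" for A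
  proof -
    have sub: "{h \<in> A. f1 h + f2 h \<noteq> 0} \<subseteq> {h \<in> A. f1 h \<noteq> 0} \<union> {h \<in> A. f2 h \<noteq> 0}" by auto
    then have "card {h \<in> A. f1 h + f2 h \<noteq> 0} \<le> card ({h \<in> A. f1 h \<noteq> 0} \<union> {h \<in> A. f2 h \<noteq> 0})"
      using that by (intro card_mono) auto
    also have "\<dots> \<le> m + n" using card_Un_le that by (meson add_mono order_trans)
    finally show ?thesis using finite_subset[OF sub] that by auto
  qed
  have "cmod (f1 z + f2 z) \<le> M + N" for z
    using norm_triangle_ineq[of "f1 z" "f2 z"] 1(5)[of z] 2(5)[of z] by linarith
  then show ?thesis
    unfolding fibre_finite_def
    by (intro exI[of _ "m + n"] exI[of _ "M + N"] allI)
      (use *[OF 1(1,2) 2(1,2)] *[OF 1(3,4) 2(3,4)] in blast)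
qed

lemma fibre_finite_scale:
  assumes "fibre_finite f"
  shows "fibre_finite (\<lambda>g. c * f g)"
proof (cases "c = 0")
  case True
  then show ?thesis unfolding fibre_finite_def by (auto intro!: exI[of _ 0])
next
  case False
  obtain m M where "\<forall>z.
     finite {h \<in> range_fibre G z. f h \<noteq> 0} \<and> card {h \<in> range_fibre G z. f h \<noteq> 0} \<le> m \<and>
     finite {h \<in> source_fibre G z. f h \<noteq> 0} \<and> card {h \<in> source_fibre G z. f h \<noteq> 0} \<le> m \<and>
     cmod (f z) \<le> M"
    using assms unfolding fibre_finite_def by blast
  then show ?thesis
    unfolding fibre_finite_def using False
    by (intro exI[of _ m] exI[of _ "cmod c * M"]) (auto simp: norm_mult mult_left_mono)
qed

lemma fibre_finite_zero: "fibre_finite (\<lambda>_. 0)"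
  unfolding fibre_finite_def by (auto intro!: exI[of _ 0])

lemma Op_add:
  assumes "fibre_finite f1" "fibre_finite f2"
  shows "Op x (\<lambda>g. f1 g + f2 g) v = Op x f1 v + Op x f2 v"
proof (rule l2_eqI)
  fix g
  obtain m M where K: "\<And>x. fin_band m M (kern x f1)" using assms fin_band_kern by blast
  obtain n N where L: "\<And>x. fin_band n N (kern x f2)" using assms fin_band_kern by blast
  let ?S = "{h. kern x f1 g h \<noteq> 0} \<union> {h. kern x f2 g h \<noteq> 0}"
  have S: "finite ?S" using fin_bandD[OF K] fin_bandD[OF L] by auto
  have eq: "kern x (\<lambda>g. f1 g + f2 g) g h = kern x f1 g h + kern x f2 g h" for h
    by (simp add: kern_def)
  show "coord (Op x (\<lambda>g. f1 g + f2 g) v) g = coord (Op x f1 v + Op x f2 v) g"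
    using S by (simp add: coord_Op assms fibre_finite_add rho_eq_mat_fun)
      (subst (1 2 3) mat_fun_superset[OF S]; auto simp: eq algebra_simps sum.distrib)
qed

lemma Op_scale:
  assumes "fibre_finite f"
  shows "Op x (\<lambda>g. complex_of_real c * f g) v = c *\<^sub>R Op x f v"
proof (cases "c = 0")
  case True
  then show ?thesis
    by (intro l2_eqI) (simp add: coord_Op fibre_finite_zero rho_eq_mat_fun mat_fun_def kern_def)
next
  case False
  then have eq: "{h. kern x (\<lambda>g. complex_of_real c * f g) g h \<noteq> 0} = {h. kern x f g h \<noteq> 0}" for g
    by (auto simp: kern_def)
  show ?thesis
    by (rule l2_eqI)
      (simp add: coord_Op assms fibre_finite_scale rho_eq_mat_fun mat_fun_def eq,
       simp add: kern_def sum_distrib_left scaleR_conv_of_real mult.assoc cong: if_cong)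
qed

lemma fibre_finite_diff:
  assumes "fibre_finite f1" "fibre_finite f2"
  shows "fibre_finite (f1 - f2)"
  using fibre_finite_add[OF assms(1) fibre_finite_scale[OF assms(2), of "-1"]]
  by (simp add: fun_diff_def)

lemma Op_diff:
  assumes "fibre_finite f1" "fibre_finite f2"
  shows "Op x (f1 - f2) v = Op x f1 v - Op x f2 v"
  using Op_add[OF assms(1) fibre_finite_scale[OF assms(2), of "-1"]] Op_scale[OF assms(2), of x "-1"]
  by (simp add: fun_diff_def)

section \<open>Operator bounds and the reduced norm\<close>

lemma op_norm_leI:
  assumes "fibre_finite f" "0 \<le> C" "\<And>v. norm (Op x f v) \<le> C * norm v"
  shows "op_norm (source_fibre G x) (rho G x f) \<le> ennreal C"
  unfolding op_norm_def
proof (rule SUP_least)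
  fix \<xi> assume "\<xi> \<in> {\<xi> \<in> ell2 (source_fibre G x). l2norm \<xi> \<le> 1}"
  then have \<xi>: "coord (Abs_l2 \<xi>) = \<xi>" "l2norm \<xi> \<le> 1" by (auto simp: ell2_def)
  have "l2norm (rho G x f \<xi>) \<le> C * l2norm \<xi>"
    using assms(3)[of "Abs_l2 \<xi>"] \<xi> by (simp add: norm_l2_eq_l2norm coord_Op[OF assms(1)])
  also have "\<dots> \<le> C" using \<xi> assms(2) by (simp add: mult_left_le)
  finally show "ennreal (l2norm (rho G x f \<xi>)) \<le> ennreal C" by (rule ennreal_leI)
qed

lemma op_norm_leD:
  assumes "fibre_finite f" "0 \<le> C" "op_norm (source_fibre G x) (rho G x f) \<le> ennreal C"
    and v: "coord v \<in> ell2 (source_fibre G x)"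
  shows "norm (Op x f v) \<le> C * norm v"
proof (cases "v = 0")
  case True
  then show ?thesis using linear_0[OF linear_Op[OF assms(1)]] by simp
next
  case False
  define u where "u = v /\<^sub>R norm v"
  have "coord u \<in> ell2 (source_fibre G x)"
    using v coord_summable[of u] unfolding u_def ell2_def by auto
  moreover have "l2norm (coord u) = 1" using False by (simp add: u_def flip: norm_l2_eq_l2norm)
  ultimately have "ennreal (l2norm (rho G x f (coord u))) \<le> op_norm (source_fibre G x) (rho G x f)"
    unfolding op_norm_def by (intro SUP_upper) auto
  also note assms(3)
  finally have "norm (Op x f u) \<le> C"
    using assms(2) by (simp add: norm_l2_eq_l2norm coord_Op[OF assms(1)])
  then show ?thesis
    using False by (simp add: u_def linear_scale[OF linear_Op[OF assms(1)]] field_simps)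
qed

lemma reduced_norm_leI:
  assumes "fibre_finite f" "0 \<le> C" "\<And>x v. x \<in> units G \<Longrightarrow> norm (Op x f v) \<le> C * norm v"
  shows "reduced_norm G f \<le> ennreal C"
  unfolding reduced_norm_def using assms by (intro SUP_least op_norm_leI) auto

lemma reduced_norm_leD:
  assumes "fibre_finite f" "0 \<le> C" "reduced_norm G f \<le> ennreal C" "x \<in> units G"
    and "coord v \<in> ell2 (source_fibre G x)"
  shows "norm (Op x f v) \<le> C * norm v"
proof (rule op_norm_leD)
  have "op_norm (source_fibre G x) (rho G x f) \<le> reduced_norm G f"
    unfolding reduced_norm_def using assms by (intro SUP_upper)
  then show "op_norm (source_fibre G x) (rho G x f) \<le> ennreal C" using assms by simp
qed fact+

end

section \<open>Local homeomorphisms\<close>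

lemma local_homeo_open_image:
  assumes f: "local_homeo X Z f" and W: "openin X W"
  shows "openin Z (f ` W)"
proof (subst openin_subopen, safe)
  fix p assume p: "p \<in> W"
  then obtain V where V: "openin X V" "p \<in> V" "openin Z (f ` V)"
    "homeomorphic_map (subtopology X V) (subtopology Z (f ` V)) f"
    using f openin_subset[OF W] unfolding local_homeo_def by blast
  have "openin (subtopology X V) (V \<inter> W)" using W by (simp add: openin_subtopology_Int2)
  then have "openin (subtopology Z (f ` V)) (f ` (V \<inter> W))"
    using homeomorphic_imp_open_map[OF V(4)] unfolding open_map_def by blast
  then have "openin Z (f ` (V \<inter> W))" using V(3) by (rule openin_trans_full)
  then show "\<exists>T. openin Z T \<and> f p \<in> T \<and> T \<subseteq> f ` W" using p V(2) by blast
qed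

lemma local_homeo_continuous:
  assumes f: "local_homeo X Z f"
  shows "continuous_map X Z f"
  unfolding continuous_map
proof (intro conjI allI impI)
  have "f ` topspace X \<subseteq> topspace Z"
    using local_homeo_open_image[OF f openin_topspace] by (rule openin_subset)
  then show "f ` topspace X \<subseteq> topspace Z" .
  fix W assume W: "openin Z W"
  show "openin X {p \<in> topspace X. f p \<in> W}"
  proof (subst openin_subopen, safe)
    fix p assume p: "p \<in> topspace X" "f p \<in> W"
    then obtain V where V: "openin X V" "p \<in> V"
      "homeomorphic_map (subtopology X V) (subtopology Z (f ` V)) f"
      using f unfolding local_homeo_def by blast
    have "continuous_map (subtopology X V) Z f"
      using homeomorphic_imp_continuous_map[OF V(3)] continuous_map_into_fulltopology by blast
    then have "openin (subtopology X V) {p \<in> topspace (subtopology X V). f p \<in> W}"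
      using W by (rule openin_continuous_map_preimage)
    then have "openin X {p \<in> topspace (subtopology X V). f p \<in> W}"
      using V(1) by (rule openin_trans_full)
    then show "\<exists>T. openin X T \<and> p \<in> T \<and> T \<subseteq> {p \<in> topspace X. f p \<in> W}"
      using p V(2) by (intro exI[of _ "{p \<in> topspace (subtopology X V). f p \<in> W}"]) auto
  qed
qed

lemma local_homeo_injective:
  assumes "local_homeo X Z f" "p \<in> topspace X"
  obtains V where "openin X V" "p \<in> V" "inj_on f V"
proof -
  obtain V where V: "openin X V" "p \<in> V"
      "homeomorphic_map (subtopology X V) (subtopology Z (f ` V)) f"
    using assms unfolding local_homeo_def by blast
  have "topspace (subtopology X V) = V" using openin_subset[OF V(1)] by auto
  then show ?thesis using homeomorphic_imp_injective_map[OF V(3)] that V by simp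
qed

section \<open>Open bisections\<close>

context etale_groupoid
begin

abbreviation top where "top \<equiv> gtop G"

lemma topspace_top [simp]: "topspace top = arrows G" by (simp add: arrows_def)

lemma open_arrows: "openin top U \<Longrightarrow> g \<in> U \<Longrightarrow> g \<in> arrows G"
  using openin_subset by fastforce

lemma continuous_rs: "continuous_map top top r" "continuous_map top top s"
  using local_homeo_continuous[OF range_local_homeo] local_homeo_continuous[OF source_local_homeo]
    continuous_map_into_fulltopology by blast+

lemma open_preimage_rs:
  assumes "openin top W"
  shows "openin top {g \<in> arrows G. r g \<in> W}" "openin top {g \<in> arrows G. s g \<in> W}"
  using openin_continuous_map_preimage[OF continuous_rs(1) assms]
    openin_continuous_map_preimage[OF continuous_rs(2) assms] by simp_all

text \<open>Near a unit \<open>r\<close> is injective, and \<open>g\<close> and \<open>r g\<close>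
  have the same range; if both lie in the domain of injectivity, then
  \<open>g = r g\<close>.\<close>

lemma open_units: "openin top (units G)"
proof (subst openin_subopen, safe)
  fix u assume u: "u \<in> units G"
  then obtain V where V: "openin top V" "u \<in> V" "inj_on r V"
    using local_homeo_injective[OF range_local_homeo, of u] by auto
  let ?V = "V \<inter> {g \<in> arrows G. r g \<in> V}"
  have "openin top ?V" using V open_preimage_rs by blast
  moreover have "?V \<subseteq> units G"
  proof
    fix g assume g: "g \<in> ?V"
    then have "r (r g) = r g" by auto
    then have "r g = g" using inj_onD[OF V(3), of "r g" g] g by auto
    then show "g \<in> units G" using range_unit[of g] g by auto
  qed
  ultimately show "\<exists>T. openin top T \<and> u \<in> T \<and> T \<subseteq> units G" using V u by (intro exI[of _ ?V]) auto
qed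

lemma open_image_rs:
  assumes "openin top W"
  shows "openin top (r ` W)" "openin top (s ` W)"
  using local_homeo_open_image[OF range_local_homeo assms]
    local_homeo_open_image[OF source_local_homeo assms] open_units openin_trans_full by blast+

lemma open_bisectionD:
  assumes "open_bisection G U"
  shows "openin top U" "inj_on r U" "inj_on s U" "U \<subseteq> arrows G"
  using assms openin_subset[of top U] by (auto simp: open_bisection_def)

lemma open_bisection_exists:
  assumes "openin top W" "g \<in> W"
  obtains U where "open_bisection G U" "g \<in> U" "U \<subseteq> W"
proof -
  have g: "g \<in> topspace top" using assms open_arrows by auto
  obtain V1 where V1: "openin top V1" "g \<in> V1" "inj_on r V1"
    using local_homeo_injective[OF range_local_homeo g] .
  obtain V2 where V2: "openin top V2" "g \<in> V2" "inj_on s V2"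
    using local_homeo_injective[OF source_local_homeo g] .
  have "openin top (W \<inter> V1 \<inter> V2)" using assms V1 V2 by blast
  moreover have "inj_on r (W \<inter> V1 \<inter> V2)" "inj_on s (W \<inter> V1 \<inter> V2)"
    using V1(3) V2(3) by (auto elim: inj_on_subset)
  ultimately have "open_bisection G (W \<inter> V1 \<inter> V2)" by (simp add: open_bisection_def)
  then show ?thesis using assms(2) V1(2) V2(2) by (intro that[of "W \<inter> V1 \<inter> V2"]) auto
qed

lemma unit_nbhd_bisection: "open_bisection G (units G)"
  using open_units by (auto simp: open_bisection_def inj_on_def)

text \<open>The two local sections, inverse to \<open>r\<close> and \<open>s\<close> on a bisection.
  They replace limits inside \<open>G\<close> by limits in the Hausdorff unit space.\<close>

definition rsec where "rsec U = the_inv_into U r"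
definition ssec where "ssec U = the_inv_into U s"

lemma sec_eq [simp]:
  assumes "open_bisection G U" "g \<in> U"
  shows "rsec U (r g) = g" "ssec U (s g) = g"
  using assms by (auto simp: rsec_def ssec_def open_bisection_def the_inv_into_f_f)

lemma continuous_map_the_inv_into:
  assumes U: "openin top U" and inj: "inj_on f U"
    and im: "\<And>W. openin top W \<Longrightarrow> openin top (f ` W)"
  shows "continuous_map (subtopology top (f ` U)) top (the_inv_into U f)"
  unfolding continuous_map
proof (intro conjI allI impI)
  have sub: "f ` U \<subseteq> arrows G" using openin_subset[OF im[OF U]] by simp
  show "the_inv_into U f ` topspace (subtopology top (f ` U)) \<subseteq> topspace top"
    using inj openin_subset[OF U] by (auto simp: the_inv_into_f_f)
  fix W assume W: "openin top W"
  have "{z \<in> topspace (subtopology top (f ` U)). the_inv_into U f z \<in> W} = f ` (U \<inter> W)"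
    using inj sub by (auto simp: image_iff the_inv_into_f_f)
  moreover have "openin top (f ` (U \<inter> W))" using im U W by blast
  ultimately show "openin (subtopology top (f ` U))
      {z \<in> topspace (subtopology top (f ` U)). the_inv_into U f z \<in> W}"
    using im[OF U] by (auto simp: openin_open_subtopology)
qed

lemma sec_continuous:
  assumes U: "open_bisection G U"
  shows "continuous_map (subtopology top (r ` U)) top (rsec U)"
    "continuous_map (subtopology top (s ` U)) top (ssec U)"
  unfolding rsec_def ssec_def using open_bisectionD[OF U] open_image_rs
  by (auto intro!: continuous_map_the_inv_into)

lemma mult_nbhd:
  assumes "g \<in> arrows G" "h \<in> arrows G" "s g = r h" "openin top W" "g \<cdot> h \<in> W"
  obtains U V where "openin top U" "openin top V" "g \<in> U" "h \<in> V"
    "\<And>u v. u \<in> U \<Longrightarrow> v \<in> V \<Longrightarrow> s u = r v \<Longrightarrow> u \<cdot> v \<in> W"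
proof -
  let ?C = "subtopology (prod_topology top top) (composable G)"
  have C: "topspace ?C = composable G" by (auto simp: composable_def)
  have "openin ?C {p \<in> topspace ?C. (case p of (g, h) \<Rightarrow> g \<cdot> h) \<in> W}"
    using continuous_mult assms(4) by (rule openin_continuous_map_preimage)
  then obtain T where T: "openin (prod_topology top top) T"
    "{p \<in> composable G. (case p of (g, h) \<Rightarrow> g \<cdot> h) \<in> W} = T \<inter> composable G"
    unfolding C openin_subtopology by blast
  have "(g, h) \<in> {p \<in> composable G. (case p of (g, h) \<Rightarrow> g \<cdot> h) \<in> W}"
    using assms by (simp add: composable_def)
  then have gh: "(g, h) \<in> T" unfolding T(2) by blast
  have "\<forall>g h. (g, h) \<in> T \<longrightarrow> (\<exists>U V. openin top U \<and> openin top V \<and> g \<in> U \<and> h \<in> V \<and> U \<times> V \<subseteq> T)"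
    using T(1) by (simp only: openin_prod_topology_alt)
  from this[rule_format, OF gh]
  obtain U V where UV: "openin top U" "openin top V" "g \<in> U" "h \<in> V" "U \<times> V \<subseteq> T"
    by blast
  have "u \<cdot> v \<in> W" if "u \<in> U" "v \<in> V" "s u = r v" for u v
  proof -
    have "(u, v) \<in> T \<inter> composable G" using UV(5) that open_arrows[OF UV(1)] open_arrows[OF UV(2)]
      by (auto simp: composable_def)
    then show ?thesis unfolding T(2)[symmetric] by simp
  qed
  then show ?thesis using UV that by blast
qed

lemma open_inv:
  assumes "openin top W"
  shows "openin top {g \<in> arrows G. iv g \<in> W}" "openin top (iv ` W)"
proof -
  show *: "openin top {g \<in> arrows G. iv g \<in> W}"
    using openin_continuous_map_preimage[OF continuous_inv assms] by simp
  have "iv ` W = {g \<in> arrows G. iv g \<in> W}"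
  proof safe
    fix g assume "g \<in> W"
    then show "iv g \<in> arrows G" "iv (iv g) \<in> W" using open_arrows[OF assms] by auto
  next
    fix g assume "g \<in> arrows G" "iv g \<in> W"
    then show "g \<in> iv ` W" by (intro image_eqI[of _ _ "iv g"]) auto
  qed
  then show "openin top (iv ` W)" using * by simp
qed

lemma open_bisection_inv:
  assumes "open_bisection G U"
  shows "open_bisection G (iv ` U)"
  using open_bisectionD[OF assms] open_inv(2)[of U]
  unfolding open_bisection_def inj_on_def by (auto simp: subset_iff)

definition set_prod where "set_prod U V = {u \<cdot> v | u v. u \<in> U \<and> v \<in> V \<and> s u = r v}"

text \<open>An arrow \<open>h\<close> close to \<open>u0 \<cdot> v0\<close> has the range of some
  \<open>u\<close> in \<open>U\<close> close to \<open>u0\<close>, hence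
  \<open>h = u \<cdot> (iv u \<cdot> h)\<close>. Continuity of the operations keeps
  \<open>iv u \<cdot> h\<close> in \<open>V\<close>.\<close>

lemma open_set_prod:
  assumes U: "open_bisection G U" and V: "openin top V"
  shows "openin top (set_prod U V)"
proof (subst openin_subopen, safe)
  note D = open_bisectionD[OF U]
  fix g assume "g \<in> set_prod U V"
  then obtain u0 v0 where uv: "u0 \<in> U" "v0 \<in> V" "s u0 = r v0" "g = u0 \<cdot> v0"
    by (auto simp: set_prod_def)
  have ar: "u0 \<in> arrows G" "v0 \<in> arrows G" "g \<in> arrows G"
    using uv open_arrows[OF D(1)] open_arrows[OF V] by auto
  have "iv u0 \<cdot> g \<in> V" using uv ar by (simp add: inv_cancel)
  moreover have "s (iv u0) = r g" using ar uv by simp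
  ultimately obtain U1 N where N: "openin top U1" "openin top N" "iv u0 \<in> U1" "g \<in> N"
    "\<And>u v. u \<in> U1 \<Longrightarrow> v \<in> N \<Longrightarrow> s u = r v \<Longrightarrow> u \<cdot> v \<in> V"
    using mult_nbhd[of "iv u0" g V] ar V by auto
  define U3 where "U3 = U \<inter> {u \<in> arrows G. iv u \<in> U1}"
  have U3: "openin top U3" using D open_inv N by (auto simp: U3_def)
  define N' where "N' = N \<inter> {h \<in> arrows G. r h \<in> r ` U3}"
  have "openin top N'" using N open_preimage_rs open_image_rs U3 by (auto simp: N'_def)
  moreover have "g \<in> N'" using N uv ar by (auto simp: N'_def U3_def image_iff intro!: bexI[of _ u0])
  moreover have "N' \<subseteq> set_prod U V"
  proof
    fix h assume h: "h \<in> N'"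
    then obtain u where u: "u \<in> U3" "r h = r u" by (auto simp: N'_def)
    have ar: "u \<in> arrows G" "h \<in> arrows G" using u h by (auto simp: U3_def N'_def)
    have "iv u \<cdot> h \<in> V" using N(5)[of "iv u" h] u h ar by (auto simp: U3_def N'_def)
    moreover have "h = u \<cdot> (iv u \<cdot> h)" using ar u by (simp add: inv_cancel)
    moreover have "s u = r (iv u \<cdot> h)" using ar u by simp
    ultimately show "h \<in> set_prod U V" using u unfolding set_prod_def U3_def by blast
  qed
  ultimately show "\<exists>T. openin top T \<and> g \<in> T \<and> T \<subseteq> set_prod U V" by blast
qed

lemma open_bisection_set_prod:
  assumes U: "open_bisection G U" and V: "open_bisection G V"
  shows "open_bisection G (set_prod U V)"
proof -
  note DU = open_bisectionD[OF U] and DV = open_bisectionD[OF V]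
  have "inj_on r (set_prod U V)"
  proof (rule inj_onI)
    fix g h assume "g \<in> set_prod U V" "h \<in> set_prod U V" "r g = r h"
    then obtain u v u' v' where *: "g = u \<cdot> v" "h = u' \<cdot> v'" "u \<in> U" "v \<in> V" "u' \<in> U" "v' \<in> V"
      "s u = r v" "s u' = r v'" by (auto simp: set_prod_def)
    then have "r u = r u'" using \<open>r g = r h\<close> DU(4) DV(4) by (simp add: subset_iff)
    then have "u = u'" using DU(2) * by (meson inj_onD)
    then have "v = v'" using DV(2) * by (metis inj_onD)
    then show "g = h" using * \<open>u = u'\<close> by simp
  qed
  moreover have "inj_on s (set_prod U V)"
  proof (rule inj_onI)
    fix g h assume "g \<in> set_prod U V" "h \<in> set_prod U V" "s g = s h"
    then obtain u v u' v' where *: "g = u \<cdot> v" "h = u' \<cdot> v'" "u \<in> U" "v \<in> V" "u' \<in> U" "v' \<in> V"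
      "s u = r v" "s u' = r v'" by (auto simp: set_prod_def)
    then have "s v = s v'" using \<open>s g = s h\<close> DU(4) DV(4) by (simp add: subset_iff)
    then have "v = v'" using DV(3) * by (meson inj_onD)
    then have "u = u'" using DU(3) * by (metis inj_onD)
    then show "g = h" using * \<open>v = v'\<close> by simp
  qed
  ultimately show ?thesis
    using open_set_prod[OF U DV(1)] by (simp add: open_bisection_def)
qed

text \<open>The source map injects a bisection continuously into the Hausdorff unit space. This
  makes bisections admissible domains in the definition of \<open>Cc G\<close>.\<close>

lemma Hausdorff_bisection:
  assumes U: "open_bisection G U"
  shows "Hausdorff_space (subtopology top U)"
proof (rule Hausdorff_space_injective_preimage[OF units_Hausdorff])
  show "continuous_map (subtopology top U) (subtopology top (units G)) s"
    using continuous_rs(2) open_bisectionD(4)[OF U]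
    by (intro continuous_map_into_subtopology continuous_map_from_subtopology) auto
  show "inj_on s (topspace (subtopology top U))"
    using open_bisectionD(3)[OF U] by (auto simp: inj_on_def)
qed

section \<open>The span of the functions supported on open bisections\<close>

text \<open>A compact set outside which \<open>f\<close> vanishes takes the place of the closure of
  the support: its images under inversion and local sections are again usable witnesses.\<close>

definition bis_fun :: "'a set \<Rightarrow> ('a \<Rightarrow> complex) \<Rightarrow> bool" where
  "bis_fun U f \<longleftrightarrow> open_bisection G U \<and> continuous_map (subtopology top U) euclidean f \<and>
     (\<exists>K. compactin top K \<and> K \<subseteq> U \<and> (\<forall>g. g \<notin> K \<longrightarrow> f g = 0))"

lemma bis_fun_Cc_on:
  assumes "bis_fun U f"
  shows "f \<in> Cc_on G U"
proof -
  obtain K where U: "open_bisection G U" "continuous_map (subtopology top U) euclidean f"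
    and K: "compactin top K" "K \<subseteq> U" "\<And>g. g \<notin> K \<Longrightarrow> f g = 0"
    using assms unfolding bis_fun_def by blast
  let ?U = "subtopology top U"
  have KU: "compactin ?U K" using K by (simp add: compactin_subtopology)
  then have "closedin ?U K" using Hausdorff_bisection[OF U(1)] compactin_imp_closedin by blast
  moreover have "{g \<in> U. f g \<noteq> 0} \<subseteq> K" using K(3) by blast
  ultimately have "?U closure_of {g \<in> U. f g \<noteq> 0} \<subseteq> K" by (intro closure_of_minimal)
  then have "compactin ?U (?U closure_of {g \<in> U. f g \<noteq> 0})"
    using KU closed_compactin closedin_closure_of by blast
  then show ?thesis using U(2) K unfolding Cc_on_def by blast
qed

lemma Cc_on_Cc:
  assumes "openin top V" "Hausdorff_space (subtopology top V)" "f \<in> Cc_on G V"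
  shows "f \<in> Cc G"
  unfolding Cc_def
  by (rule CollectI, rule exI[of _ 1], rule exI[of _ "\<lambda>_. 1"], rule exI[of _ "\<lambda>_. f"])
    (use assms in auto)

lemma Cc_scale:
  assumes "f \<in> Cc G"
  shows "(\<lambda>g. c * f g) \<in> Cc G"
proof -
  obtain n c' F where
    *: "\<forall>k<n. \<exists>V. openin top V \<and> Hausdorff_space (subtopology top V) \<and> F k \<in> Cc_on G V"
       "f = (\<lambda>g. \<Sum>k<(n::nat). c' k * F k g)"
    using assms unfolding Cc_def by blast
  show ?thesis
    unfolding Cc_def
    by (rule CollectI, rule exI[of _ n], rule exI[of _ "\<lambda>k. c * c' k"], rule exI[of _ F])
      (use * in \<open>simp add: sum_distrib_left mult.assoc\<close>)
qed

lemma Cc_add: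
  assumes "f1 \<in> Cc G" "f2 \<in> Cc G"
  shows "(\<lambda>g. f1 g + f2 g) \<in> Cc G"
proof -
  obtain n c F where
    1: "\<forall>k<n. \<exists>V. openin top V \<and> Hausdorff_space (subtopology top V) \<and> F k \<in> Cc_on G V"
       "f1 = (\<lambda>g. \<Sum>k<(n::nat). c k * F k g)"
    using assms(1) unfolding Cc_def by blast
  obtain m d H where
    2: "\<forall>k<m. \<exists>V. openin top V \<and> Hausdorff_space (subtopology top V) \<and> H k \<in> Cc_on G V"
       "f2 = (\<lambda>g. \<Sum>k<(m::nat). d k * H k g)"
    using assms(2) unfolding Cc_def by blast
  define c' where "c' k = (if k < n then c k else d (k - n))" for k
  define F' where "F' k = (if k < n then F k else H (k - n))" for k
  have split: "(\<Sum>k<n + j. \<phi> k) = (\<Sum>k<n. \<phi> k) + (\<Sum>k<j. \<phi> (n + k))" for \<phi> :: "nat \<Rightarrow> complex" and j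
    by (induction j) (auto simp: add.assoc)
  have "\<exists>V. openin top V \<and> Hausdorff_space (subtopology top V) \<and> F' k \<in> Cc_on G V" if "k < n + m" for k
    using 1(1) 2(1) that by (cases "k < n") (auto simp: F'_def)
  moreover have "(\<lambda>g. f1 g + f2 g) = (\<lambda>g. \<Sum>k<n + m. c' k * F' k g)"
    unfolding 1(2) 2(2) split by (auto simp: c'_def F'_def)
  ultimately show ?thesis unfolding Cc_def by blast
qed

text \<open>The compact support is covered by finitely many bisections, each of which meets every
  range or source fibre at most once. The number of bisections bounds the counts.\<close>

lemma Cc_on_fibre_finite:
  assumes f: "f \<in> Cc_on G V" and V: "openin top V"
  shows "fibre_finite f"
proof -
  let ?V = "subtopology top V"
  define K where "K = ?V closure_of {g \<in> V. f g \<noteq> 0}"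
  have cont: "continuous_map ?V euclidean f" and K: "compactin ?V K" and 0: "\<And>g. g \<notin> V \<Longrightarrow> f g = 0"
    using f by (auto simp: Cc_on_def K_def)
  have top: "topspace ?V = V" using openin_subset[OF V] by auto
  then have "{g \<in> V. f g \<noteq> 0} \<subseteq> K" unfolding K_def by (intro closure_of_subset) auto
  then have 0: "f g = 0" if "g \<notin> K" for g using 0 that by blast
  have "compactin euclidean (f ` K)" using K cont by (rule image_compactin)
  then have "bounded (f ` K)" by (simp add: compact_imp_bounded)
  then obtain M where M: "\<And>g. g \<in> K \<Longrightarrow> cmod (f g) \<le> M" unfolding bounded_iff by blast
  have Kt: "compactin top K" using K by (simp add: compactin_subtopology)
  have "\<exists>\<F>. finite \<F> \<and> \<F> \<subseteq> {U. open_bisection G U} \<and> K \<subseteq> \<Union>\<F>"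
  proof (rule compactinD[OF Kt])
    show "openin top U" if "U \<in> {U. open_bisection G U}" for U
      using that open_bisectionD by blast
    show "K \<subseteq> \<Union>{U. open_bisection G U}"
    proof
      fix g assume "g \<in> K"
      then have "g \<in> topspace top" using compactin_subset_topspace[OF Kt] by blast
      then show "g \<in> \<Union>{U. open_bisection G U}"
        using open_bisection_exists[OF openin_topspace, of g] by blast
    qed
  qed
  then obtain \<F> where \<F>: "finite \<F>" "\<And>U. U \<in> \<F> \<Longrightarrow> open_bisection G U" "K \<subseteq> \<Union>\<F>" by blast
  have *: "finite {h \<in> A. f h \<noteq> 0} \<and> card {h \<in> A. f h \<noteq> 0} \<le> card \<F>"
    if A: "\<And>U g h. U \<in> \<F> \<Longrightarrow> g \<in> U \<Longrightarrow> h \<in> U \<Longrightarrow> g \<in> A \<Longrightarrow> h \<in> A \<Longrightarrow> g = h" for A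
  proof -
    define j where "j h = (SOME U. U \<in> \<F> \<and> h \<in> U)" for h
    have j: "j h \<in> \<F> \<and> h \<in> j h" if "f h \<noteq> 0" for h
    proof -
      have "h \<in> K" using 0 that by blast
      then have "\<exists>U. U \<in> \<F> \<and> h \<in> U" using \<F>(3) by blast
      then show ?thesis unfolding j_def by (rule someI_ex)
    qed
    have inj: "inj_on j {h \<in> A. f h \<noteq> 0}"
    proof (rule inj_onI)
      fix g h assume gh: "g \<in> {h \<in> A. f h \<noteq> 0}" "h \<in> {h \<in> A. f h \<noteq> 0}" "j g = j h"
      then have "j g \<in> \<F>" "g \<in> j g" "h \<in> j g" using j[of g] j[of h] by auto
      then show "g = h" using A[of "j g" g h] gh by blast
    qed
    have im: "j ` {h \<in> A. f h \<noteq> 0} \<subseteq> \<F>" using j by blast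
    show ?thesis using inj_on_finite[OF inj im \<F>(1)] card_inj_on_le[OF inj im \<F>(1)] by blast
  qed
  have r: "finite {h \<in> range_fibre G z. f h \<noteq> 0} \<and> card {h \<in> range_fibre G z. f h \<noteq> 0} \<le> card \<F>" for z
    by (rule *) (use \<F>(2) open_bisectionD(2) in \<open>auto dest: inj_onD\<close>)
  have s: "finite {h \<in> source_fibre G z. f h \<noteq> 0} \<and> card {h \<in> source_fibre G z. f h \<noteq> 0} \<le> card \<F>" for z
    by (rule *) (use \<F>(2) open_bisectionD(3) in \<open>auto dest: inj_onD\<close>)
  have "cmod (f g) \<le> max M 0" for g
    using M[of g] 0[of g] by (cases "g \<in> K") auto
  then show ?thesis unfolding fibre_finite_def using r s by blast
qed

lemma Cc_fibre_finite:
  assumes "f \<in> Cc G"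
  shows "fibre_finite f"
proof -
  obtain n c F where
    *: "\<forall>k<n. \<exists>V. openin top V \<and> Hausdorff_space (subtopology top V) \<and> F k \<in> Cc_on G V"
       "f = (\<lambda>g. \<Sum>k<(n::nat). c k * F k g)"
    using assms unfolding Cc_def by blast
  have "fibre_finite (\<lambda>g. \<Sum>k<j. c k * F k g)" if "j \<le> n" for j
    using that
  proof (induction j)
    case 0
    then show ?case using fibre_finite_zero by simp
  next
    case (Suc j)
    then have "fibre_finite (F j)" using *(1) Cc_on_fibre_finite by (meson Suc_le_eq)
    then show ?case using fibre_finite_add[OF Suc.IH fibre_finite_scale[of "F j" "c j"]] Suc.prems
      by simp
  qed
  then show ?thesis using * by simp
qed

text \<open>On single bisections at most one summand of a convolution survives. Linear extension
  then yields an involutive algebra inside \<open>Cc G\<close>, which suffices for constructing the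
  obstruction.\<close>

inductive_set Cb :: "('a \<Rightarrow> complex) set" where
  Cb_bis: "bis_fun U f \<Longrightarrow> f \<in> Cb"
| Cb_add: "f \<in> Cb \<Longrightarrow> h \<in> Cb \<Longrightarrow> (\<lambda>g. f g + h g) \<in> Cb"
| Cb_scale: "f \<in> Cb \<Longrightarrow> (\<lambda>g. c * f g) \<in> Cb"

lemma Cb_Cc: "f \<in> Cb \<Longrightarrow> f \<in> Cc G"
proof (induction rule: Cb.induct)
  case (Cb_bis U f)
  then have "open_bisection G U" by (simp add: bis_fun_def)
  then show ?case
    using Cc_on_Cc[OF open_bisectionD(1) Hausdorff_bisection bis_fun_Cc_on] Cb_bis by blast
qed (auto intro: Cc_add Cc_scale)

lemmas Cb_fibre_finite = Cc_fibre_finite[OF Cb_Cc]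

lemma Cb_zero: "(\<lambda>_. 0) \<in> Cb"
proof (rule Cb_bis)
  show "bis_fun {} (\<lambda>_. 0)" by (auto simp: bis_fun_def open_bisection_def)
qed

lemma Cb_diff:
  assumes "f1 \<in> Cb" "f2 \<in> Cb" shows "f1 - f2 \<in> Cb"
  using Cb_add[OF assms(1) Cb_scale[OF assms(2), of "-1"]] by (simp add: fun_diff_def)

lemma Cb_sum: "finite I \<Longrightarrow> (\<And>i. i \<in> I \<Longrightarrow> f i \<in> Cb) \<Longrightarrow> (\<lambda>g. \<Sum>i\<in>I. f i g) \<in> Cb"
  by (induction I rule: finite_induct) (auto intro: Cb_add Cb_zero)

lemma bis_fun_star:
  assumes "bis_fun U f"
  shows "bis_fun (iv ` U) (star f)"
proof -
  obtain K where U: "open_bisection G U" "continuous_map (subtopology top U) euclidean f"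
    and K: "compactin top K" "K \<subseteq> U" "\<And>g. g \<notin> K \<Longrightarrow> f g = 0"
    using assms unfolding bis_fun_def by blast
  note D = open_bisectionD[OF U(1)]
  have "continuous_map (subtopology top (iv ` U)) (subtopology top U) iv"
    using D(4) continuous_inv
    by (intro continuous_map_into_subtopology continuous_map_from_subtopology) auto
  then have "continuous_map (subtopology top (iv ` U)) euclidean (f \<circ> iv)"
    using U(2) by (rule continuous_map_compose)
  then have "continuous_map (subtopology top (iv ` U)) euclidean (cnj \<circ> (f \<circ> iv))"
    by (rule continuous_map_compose) (auto intro: continuous_intros)
  then have "continuous_map (subtopology top (iv ` U)) euclidean (star f)"
    by (rule continuous_map_eq) (use D(4) in \<open>auto simp: star_def\<close>)
  moreover have "compactin top (iv ` K)" using K(1) continuous_inv by (rule image_compactin)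
  moreover have "star f g = 0" if "g \<notin> iv ` K" for g
  proof (cases "g \<in> arrows G")
    case True
    then have "iv g \<notin> K" using that image_eqI[of g iv "iv g" K] by auto
    then show ?thesis using K(3) by (simp add: star_def)
  qed (simp add: star_def)
  ultimately show ?thesis
    using open_bisection_inv[OF U(1)] K(2) unfolding bis_fun_def by blast
qed

lemma Cb_star: "f \<in> Cb \<Longrightarrow> star f \<in> Cb"
proof (induction rule: Cb.induct)
  case (Cb_bis U f)
  then show ?case using bis_fun_star Cb.Cb_bis by blast
next
  case (Cb_add f h)
  have "star (\<lambda>g. f g + h g) = (\<lambda>g. star f g + star h g)" by (auto simp: star_def)
  then show ?case using Cb_add Cb.Cb_add by metis
next
  case (Cb_scale f c)
  have "star (\<lambda>g. c * f g) = (\<lambda>g. cnj c * star f g)" by (auto simp: star_def)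
  then show ?case using Cb_scale Cb.Cb_scale by metis
qed

lemma compactin_units_Int:
  assumes "compactin top K" "compactin top L" "K \<subseteq> units G" "L \<subseteq> units G"
  shows "compactin top (K \<inter> L)"
  using compactin_Int[OF units_Hausdorff, of K L] assms by (simp add: compactin_subtopology)

lemma prd_eq_single:
  assumes "g \<in> arrows G" "u \<in> arrows G" "r u = r g"
    and "\<And>k. k \<in> arrows G \<Longrightarrow> r k = r g \<Longrightarrow> k \<noteq> u \<Longrightarrow> f k = 0"
  shows "prd f h g = f u * h (iv u \<cdot> g)"
proof -
  have "convolution G f h g = (\<Sum>k\<in>{u}. f k * h (iv k \<cdot> g))"
    unfolding convolution_def using assms by (intro infsum_finite_support) auto
  then show ?thesis using assms by (simp add: prd_def)
qed

text \<open>On \<open>set_prod U V\<close> the product is \<open>f u * h v\<close>, where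
  \<open>u\<close> and \<open>v\<close> are recovered continuously from the range and the source of
  the argument.\<close>

lemma bis_fun_prd:
  assumes f: "bis_fun U f" and h: "bis_fun V h"
  shows "bis_fun (set_prod U V) (prd f h)"
proof -
  obtain K where U: "open_bisection G U" "continuous_map (subtopology top U) euclidean f"
    and K: "compactin top K" "K \<subseteq> U" "\<And>g. g \<notin> K \<Longrightarrow> f g = 0"
    using f unfolding bis_fun_def by blast
  obtain L where V: "open_bisection G V" "continuous_map (subtopology top V) euclidean h"
    and L: "compactin top L" "L \<subseteq> V" "\<And>g. g \<notin> L \<Longrightarrow> h g = 0"
    using h unfolding bis_fun_def by blast
  note DU = open_bisectionD[OF U(1)] and DV = open_bisectionD[OF V(1)]
  let ?W = "set_prod U V"
  have W: "open_bisection G ?W" using U V by (intro open_bisection_set_prod)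
  note DW = open_bisectionD[OF W]
  have val: "prd f h (u \<cdot> v) = f u * h v" if "u \<in> U" "v \<in> V" "s u = r v" for u v
  proof -
    have ar: "u \<in> arrows G" "v \<in> arrows G" using that DU DV by auto
    have "f k = 0" if "k \<in> arrows G" "r k = r (u \<cdot> v)" "k \<noteq> u" for k
    proof -
      have "k \<notin> U" using that inj_onD[OF DU(2), of k u] ar \<open>u \<in> U\<close> \<open>s u = r v\<close> by auto
      then show ?thesis using K by blast
    qed
    then show ?thesis
      using prd_eq_single[of "u \<cdot> v" u f h] ar that by (simp add: inv_cancel)
  qed
  have zero: "prd f h g = 0" if g: "\<And>u v. u \<in> K \<Longrightarrow> v \<in> L \<Longrightarrow> s u = r v \<Longrightarrow> g \<noteq> u \<cdot> v" for g
  proof (cases "g \<in> arrows G")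
    case True
    have "f k * h (iv k \<cdot> g) = 0" if k: "k \<in> range_fibre G (r g)" for k
    proof (rule ccontr)
      assume "f k * h (iv k \<cdot> g) \<noteq> 0"
      then have "k \<in> K" "iv k \<cdot> g \<in> L" using K(3) L(3) by auto
      then show False using g[of k "iv k \<cdot> g"] k True by (simp add: inv_cancel)
    qed
    then have "convolution G f h g = 0" unfolding convolution_def by (intro infsum_0)
    then show ?thesis by (simp add: prd_def)
  qed (simp add: prd_def)
  have W_elim: "\<exists>u v. u \<in> U \<and> v \<in> V \<and> s u = r v \<and> g = u \<cdot> v \<and> r g = r u \<and> s g = s v"
    if g: "g \<in> ?W" for g
  proof -
    obtain u v where uv: "u \<in> U" "v \<in> V" "s u = r v" "g = u \<cdot> v"
      using g unfolding set_prod_def by blast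
    then have "u \<in> arrows G" "v \<in> arrows G" using DU(4) DV(4) by blast+
    then show ?thesis using uv by (intro exI[of _ u] exI[of _ v]) simp
  qed
  have W_sec: "r g \<in> r ` U" "s g \<in> s ` V" "rsec U (r g) \<in> U" "ssec V (s g) \<in> V"
    "prd f h g = f (rsec U (r g)) * h (ssec V (s g))" if g: "g \<in> ?W" for g
    using W_elim[OF g] U(1) V(1) val by auto
  have rU: "continuous_map (subtopology top ?W) (subtopology top U) (rsec U \<circ> r)"
  proof (rule continuous_map_into_subtopology)
    have "continuous_map (subtopology top ?W) (subtopology top (r ` U)) r"
      using W_sec(1) continuous_rs(1)
      by (intro continuous_map_into_subtopology continuous_map_from_subtopology) auto
    then show "continuous_map (subtopology top ?W) top (rsec U \<circ> r)"
      using sec_continuous(1)[OF U(1)] by (rule continuous_map_compose)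
    show "rsec U \<circ> r \<in> topspace (subtopology top ?W) \<rightarrow> U"
      using W_sec(3) by auto
  qed
  have sV: "continuous_map (subtopology top ?W) (subtopology top V) (ssec V \<circ> s)"
  proof (rule continuous_map_into_subtopology)
    have "continuous_map (subtopology top ?W) (subtopology top (s ` V)) s"
      using W_sec(2) continuous_rs(2)
      by (intro continuous_map_into_subtopology continuous_map_from_subtopology) auto
    then show "continuous_map (subtopology top ?W) top (ssec V \<circ> s)"
      using sec_continuous(2)[OF V(1)] by (rule continuous_map_compose)
    show "ssec V \<circ> s \<in> topspace (subtopology top ?W) \<rightarrow> V"
      using W_sec(4) by auto
  qed
  have "continuous_map (subtopology top ?W) euclidean
      (\<lambda>g. (f \<circ> (rsec U \<circ> r)) g * (h \<circ> (ssec V \<circ> s)) g)"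
    using continuous_map_compose[OF rU U(2)] continuous_map_compose[OF sV V(2)]
    unfolding continuous_map_atin o_def by (auto intro: tendsto_mult)
  then have cont: "continuous_map (subtopology top ?W) euclidean (prd f h)"
    by (rule continuous_map_eq) (simp add: W_sec(5))
  \<comment> \<open>Intersecting compact sets is safe only among the Hausdorff units. So the middle
    units \<open>s\<close> K \<inter> r \<open>L\<close> are formed first, lifted to
    \<open>V\<close> by \<open>rsec V\<close>, and their sources are lifted to the product
    bisection.\<close>
  define M where "M = ssec ?W ` s ` rsec V ` (s ` K \<inter> r ` L)"
  have sub: "s ` K \<inter> r ` L \<subseteq> r ` V" using L(2) by blast
  have V': "rsec V ` (s ` K \<inter> r ` L) \<subseteq> L"
    using L(2) V(1) by (auto simp: subset_iff)
  have sW: "s ` rsec V ` (s ` K \<inter> r ` L) \<subseteq> s ` ?W"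
  proof
    fix z assume "z \<in> s ` rsec V ` (s ` K \<inter> r ` L)"
    then obtain u v where uv: "u \<in> K" "v \<in> L" "s u = r v" "z = s (rsec V (r v))" by auto
    then have "z = s v" using V(1) L(2) by auto
    also have "\<dots> = s (u \<cdot> v)" using uv K(2) L(2) DU(4) DV(4) by (simp add: subset_iff)
    finally show "z \<in> s ` ?W" using uv K(2) L(2) unfolding set_prod_def by blast
  qed
  have "compactin top (s ` K)" "compactin top (r ` L)"
    using image_compactin K(1) L(1) continuous_rs by blast+
  then have "compactin top (s ` K \<inter> r ` L)"
    using K(2) L(2) DU(4) DV(4) by (intro compactin_units_Int) auto
  then have "compactin (subtopology top (r ` V)) (s ` K \<inter> r ` L)"
    using sub by (simp add: compactin_subtopology)
  then have "compactin top (rsec V ` (s ` K \<inter> r ` L))"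
    using sec_continuous(1)[OF V(1)] by (rule image_compactin)
  then have "compactin top (s ` rsec V ` (s ` K \<inter> r ` L))"
    using continuous_rs(2) by (rule image_compactin)
  then have "compactin (subtopology top (s ` ?W)) (s ` rsec V ` (s ` K \<inter> r ` L))"
    using sW by (simp add: compactin_subtopology)
  then have M: "compactin top M"
    unfolding M_def using sec_continuous(2)[OF W] by (rule image_compactin)
  have "M \<subseteq> ?W"
  proof
    fix g assume "g \<in> M"
    then obtain z where "z \<in> s ` ?W" "g = ssec ?W z" unfolding M_def using sW by blast
    then show "g \<in> ?W" using W by auto
  qed
  moreover have "prd f h g = 0" if "g \<notin> M" for g
  proof (rule zero, rule notI)
    fix u v assume uv: "u \<in> K" "v \<in> L" "s u = r v" "g = u \<cdot> v"
    then have g: "g \<in> ?W" using K(2) L(2) unfolding set_prod_def by blast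
    have "r v \<in> s ` K \<inter> r ` L" using uv by (metis IntI imageI)
    then have "rsec V (r v) \<in> rsec V ` (s ` K \<inter> r ` L)" by blast
    moreover have "rsec V (r v) = v" using sec_eq(1)[OF V(1)] L(2) uv(2) by blast
    ultimately have "v \<in> rsec V ` (s ` K \<inter> r ` L)" by simp
    then have "s v \<in> s ` rsec V ` (s ` K \<inter> r ` L)" by blast
    moreover have "s v = s g" using uv K(2) L(2) DU(4) DV(4) by (simp add: subset_iff)
    ultimately have "ssec ?W (s g) \<in> M" unfolding M_def by (metis imageI)
    then show False using that sec_eq(2)[OF W g] by simp
  qed
  ultimately show ?thesis unfolding bis_fun_def using W cont M by blast
qed

lemma prd_finite_sum:
  assumes "g \<in> arrows G" "finite S" "{k \<in> range_fibre G (r g). f k \<noteq> 0} \<subseteq> S"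
    "S \<subseteq> range_fibre G (r g)"
  shows "prd f h g = (\<Sum>k\<in>S. f k * h (iv k \<cdot> g))"
  using assms(1) unfolding prd_def convolution_def
  by (simp, intro infsum_finite_support) (use assms in auto)

lemma prd_add_left:
  assumes "fibre_finite f1" "fibre_finite f2"
  shows "prd (\<lambda>g. f1 g + f2 g) h = (\<lambda>g. prd f1 h g + prd f2 h g)"
proof
  fix g
  show "prd (\<lambda>g. f1 g + f2 g) h g = prd f1 h g + prd f2 h g"
  proof (cases "g \<in> arrows G")
    case True
    let ?S = "{k \<in> range_fibre G (r g). f1 k \<noteq> 0} \<union> {k \<in> range_fibre G (r g). f2 k \<noteq> 0}"
    have "finite ?S" using assms unfolding fibre_finite_def by blast
    then have *: "prd f h g = (\<Sum>k\<in>?S. f k * h (iv k \<cdot> g))"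
      if "{k \<in> range_fibre G (r g). f k \<noteq> 0} \<subseteq> ?S" for f
      using that by (intro prd_finite_sum True) blast+
    have "prd f1 h g = (\<Sum>k\<in>?S. f1 k * h (iv k \<cdot> g))" by (rule *) blast
    moreover have "prd f2 h g = (\<Sum>k\<in>?S. f2 k * h (iv k \<cdot> g))" by (rule *) blast
    moreover have "prd (\<lambda>g. f1 g + f2 g) h g = (\<Sum>k\<in>?S. (f1 k + f2 k) * h (iv k \<cdot> g))"
      by (rule *) auto
    ultimately show ?thesis by (simp only: sum.distrib distrib_right)
  qed (simp add: prd_def)
qed

lemma prd_add_right:
  assumes "fibre_finite f"
  shows "prd f (\<lambda>g. h1 g + h2 g) = (\<lambda>g. prd f h1 g + prd f h2 g)"
proof
  fix g
  show "prd f (\<lambda>g. h1 g + h2 g) g = prd f h1 g + prd f h2 g"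
  proof (cases "g \<in> arrows G")
    case True
    let ?S = "{k \<in> range_fibre G (r g). f k \<noteq> 0}"
    have "finite ?S" using assms unfolding fibre_finite_def by blast
    then have "prd f h g = (\<Sum>k\<in>?S. f k * h (iv k \<cdot> g))" for h
      by (intro prd_finite_sum True) auto
    then show ?thesis by (simp add: sum.distrib algebra_simps)
  qed (simp add: prd_def)
qed

lemma prd_scale_left: "prd (\<lambda>g. c * f g) h = (\<lambda>g. c * prd f h g)"
  by (auto simp: prd_def convolution_def mult.assoc infsum_cmult_right')

lemma prd_scale_right: "prd f (\<lambda>g. c * h g) = (\<lambda>g. c * prd f h g)"
proof
  fix g
  have "f k * (c * y) = c * (f k * y)" for k y by simp
  then show "prd f (\<lambda>g. c * h g) g = c * prd f h g"
    by (simp only: prd_def convolution_def infsum_cmult_right') simp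
qed

lemma Cb_prd:
  assumes "f \<in> Cb" "h \<in> Cb"
  shows "prd f h \<in> Cb"
  using assms(1)
proof (induction rule: Cb.induct)
  case (Cb_bis U f)
  note f = Cb_bis
  from assms(2) show ?case
  proof (induction rule: Cb.induct)
    case (Cb_bis V h)
    then show ?case using bis_fun_prd[OF f] Cb.Cb_bis by blast
  next
    case (Cb_add h1 h2)
    then show ?case
      using prd_add_right[OF Cb_fibre_finite[OF Cb.Cb_bis[OF f]], of h1 h2] by (simp add: Cb.Cb_add)
  next
    case (Cb_scale h c)
    then show ?case by (simp add: prd_scale_right Cb.Cb_scale)
  qed
next
  case (Cb_add f1 f2)
  then show ?case
    using prd_add_left[OF Cb_fibre_finite[of f1] Cb_fibre_finite[of f2]] by (simp add: Cb.Cb_add)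
next
  case (Cb_scale f c)
  then show ?case by (simp add: prd_scale_left Cb.Cb_scale)
qed

lemma Op_prd_Cb: "f \<in> Cb \<Longrightarrow> h \<in> Cb \<Longrightarrow> Op x (prd f h) v = Op x f (Op x h v)"
  by (intro Op_prd Cb_fibre_finite Cb_prd)

end

section \<open>The extended representations\<close>

lemma coord_tendsto:
  assumes "(X \<longlongrightarrow> w) F"
  shows "((\<lambda>n. coord (X n) g) \<longlongrightarrow> coord w g) F"
proof (rule LIM_zero_cancel, rule Lim_null_comparison)
  show "\<forall>\<^sub>F n in F. norm (coord (X n) g - coord w g) \<le> norm (X n - w)"
    using norm_coord_le by (metis (mono_tags, lifting) always_eventually coord_minus)
  show "((\<lambda>n. norm (X n - w)) \<longlongrightarrow> 0) F"
    using assms by (simp add: LIM_zero tendsto_norm_zero)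
qed

lemma finite_support_l2:
  fixes f :: "'a \<Rightarrow> complex"
  assumes S: "finite S" "\<And>p. p \<notin> S \<Longrightarrow> f p = 0"
  shows "coord (Abs_l2 f) = f" "(norm (Abs_l2 f))\<^sup>2 = (\<Sum>p\<in>S. (cmod (f p))\<^sup>2)"
proof -
  have "(\<lambda>p. (cmod (f p))\<^sup>2) summable_on S" using S by simp
  then have "(\<lambda>p. (cmod (f p))\<^sup>2) summable_on UNIV"
    by (rule summable_on_cong_neutral[THEN iffD1, rotated -1]) (use S in auto)
  then show *: "coord (Abs_l2 f) = f" by simp
  show "(norm (Abs_l2 f))\<^sup>2 = (\<Sum>p\<in>S. (cmod (f p))\<^sup>2)"
    unfolding norm_l2_square * using S by (intro infsum_finite_support) auto
qed

context etale_groupoid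
begin

lemma Op_support:
  assumes "fibre_finite f"
  shows "coord (Op x f v) \<in> ell2 (source_fibre G x)"
  using coord_summable[of "Op x f v"] by (simp add: ell2_def coord_Op[OF assms] rho_def)

lemma Cc_Cauchy_fibre_finite: "F \<in> Cc_Cauchy G \<Longrightarrow> fibre_finite (F n)"
  unfolding Cc_Cauchy_def using Cc_fibre_finite by blast

lemma Cauchy_Op_bound:
  assumes F: "F \<in> Cc_Cauchy G" and "0 < \<epsilon>"
  obtains N where "\<And>m n x v. N \<le> m \<Longrightarrow> N \<le> n \<Longrightarrow> x \<in> units G \<Longrightarrow>
     coord v \<in> ell2 (source_fibre G x) \<Longrightarrow> norm (Op x (F m) v - Op x (F n) v) \<le> \<epsilon> * norm v"
proof -
  obtain N where N: "\<forall>m\<ge>N. \<forall>n\<ge>N. reduced_norm G (F m - F n) < ennreal \<epsilon>"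
    using assms unfolding Cc_Cauchy_def by blast
  have "norm (Op x (F m) v - Op x (F n) v) \<le> \<epsilon> * norm v"
    if "N \<le> m" "N \<le> n" "x \<in> units G" "coord v \<in> ell2 (source_fibre G x)" for m n x v
  proof -
    have "norm (Op x (F m - F n) v) \<le> \<epsilon> * norm v"
      using that N \<open>0 < \<epsilon>\<close> Cc_Cauchy_fibre_finite[OF F]
      by (intro reduced_norm_leD fibre_finite_diff) (auto intro: less_imp_le)
    then show ?thesis using Cc_Cauchy_fibre_finite[OF F] by (simp add: Op_diff)
  qed
  then show ?thesis using that by blast
qed

lemma small_multiple:
  assumes "0 < (e::real)"
  obtains \<epsilon> where "0 < \<epsilon>" "\<epsilon> * norm v < e"
  using assms by (intro that[of "e / (norm v + 1)"]) (auto simp: divide_simps add_nonneg_pos)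

lemma Cauchy_Op:
  assumes F: "F \<in> Cc_Cauchy G" and x: "x \<in> units G" and v: "coord v \<in> ell2 (source_fibre G x)"
  shows "Cauchy (\<lambda>n. Op x (F n) v)"
proof (rule metric_CauchyI)
  fix e :: real assume e: "0 < e"
  obtain \<epsilon> where \<epsilon>: "0 < \<epsilon>" and less: "\<epsilon> * norm v < e" using small_multiple[OF e] .
  obtain N where N: "\<And>m n. N \<le> m \<Longrightarrow> N \<le> n \<Longrightarrow> norm (Op x (F m) v - Op x (F n) v) \<le> \<epsilon> * norm v"
    using Cauchy_Op_bound[OF F \<epsilon>] x v by metis
  have "\<forall>m\<ge>N. \<forall>n\<ge>N. dist (Op x (F m) v) (Op x (F n) v) < e"
    by (auto simp: dist_norm intro!: le_less_trans[OF N less])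
  then show "\<exists>M. \<forall>m\<ge>M. \<forall>n\<ge>M. dist (Op x (F m) v) (Op x (F n) v) < e" by blast
qed

lemma Cc_equiv_Op:
  assumes "(F, F') \<in> Cc_equiv G" and x: "x \<in> units G" and v: "coord v \<in> ell2 (source_fibre G x)"
  shows "(\<lambda>n. Op x (F' n) v - Op x (F n) v) \<longlonglongrightarrow> 0"
proof (rule metric_LIMSEQ_I)
  fix e :: real assume e: "0 < e"
  have F: "F \<in> Cc_Cauchy G" "F' \<in> Cc_Cauchy G" "(\<lambda>n. reduced_norm G (F n - F' n)) \<longlonglongrightarrow> 0"
    using assms by (auto simp: Cc_equiv_def)
  note ff = Cc_Cauchy_fibre_finite[OF F(1)] Cc_Cauchy_fibre_finite[OF F(2)]
  obtain \<epsilon> where \<epsilon>: "0 < \<epsilon>" and less: "\<epsilon> * norm v < e" using small_multiple[OF e] .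
  have "\<forall>\<^sub>F n in sequentially. reduced_norm G (F n - F' n) < ennreal \<epsilon>"
    using F(3) \<epsilon> by (intro order_tendstoD(2)) auto
  then obtain N where N: "\<And>n. N \<le> n \<Longrightarrow> reduced_norm G (F n - F' n) < ennreal \<epsilon>"
    unfolding eventually_sequentially by blast
  have "dist (Op x (F' n) v - Op x (F n) v) 0 < e" if "N \<le> n" for n
  proof -
    have "norm (Op x (F n - F' n) v) \<le> \<epsilon> * norm v"
      using N[OF that] \<epsilon> x v ff by (intro reduced_norm_leD fibre_finite_diff) auto
    then show ?thesis using less ff by (simp add: Op_diff norm_minus_commute)
  qed
  then show "\<exists>N. \<forall>n\<ge>N. dist (Op x (F' n) v - Op x (F n) v) 0 < e" by blast
qed

lemma Cc_equiv_refl: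
  assumes "F \<in> Cc_Cauchy G"
  shows "(F, F) \<in> Cc_equiv G"
proof -
  note ff = Cc_Cauchy_fibre_finite[OF assms]
  have "reduced_norm G (F n - F n) \<le> ennreal 0" for n
    by (rule reduced_norm_leI[OF fibre_finite_diff[OF ff ff]]) (simp_all only: Op_diff[OF ff ff], simp_all)
  then have "reduced_norm G (F n - F n) = 0" for n by simp
  then show ?thesis using assms by (simp add: Cc_equiv_def)
qed

text \<open>Equivalent sequences have the same pointwise limit, so \<open>w\<close> meets the
  description for every representative; the representative \<open>F\<close> alone already determines
  it.\<close>

lemma rho_ext_eq:
  assumes F: "F \<in> Cc_Cauchy G" and x: "x \<in> units G" and v: "coord v \<in> ell2 (source_fibre G x)"
    and lim: "(\<lambda>n. Op x (F n) v) \<longlonglongrightarrow> w"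
  shows "rho_ext G x (Cc_equiv G `` {F}) (coord v) = coord w"
  unfolding rho_ext_def
proof (rule the_equality)
  have "coord w g = 0" if "g \<notin> source_fibre G x" for g
  proof -
    have "coord (Op x (F n) v) g = 0" for n
      using Op_support[OF Cc_Cauchy_fibre_finite[OF F], of x n v] that unfolding ell2_def by blast
    then have "(\<lambda>n. 0 :: complex) \<longlonglongrightarrow> coord w g" using coord_tendsto[OF lim, of g] by simp
    then show ?thesis using LIMSEQ_unique tendsto_const by blast
  qed
  then have w: "coord w \<in> ell2 (source_fibre G x)" by (simp add: ell2_def coord_summable)
  have "(\<lambda>n. l2norm (rho G x (F' n) (coord v) - coord w)) \<longlonglongrightarrow> 0" if "F' \<in> Cc_equiv G `` {F}" for F'
  proof -
    have FF': "(F, F') \<in> Cc_equiv G" using that by blast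
    then have F': "F' \<in> Cc_Cauchy G" by (simp add: Cc_equiv_def)
    have "(\<lambda>n. (Op x (F' n) v - Op x (F n) v) + Op x (F n) v) \<longlonglongrightarrow> 0 + w"
      by (intro tendsto_add lim Cc_equiv_Op FF' x v)
    then have "(\<lambda>n. norm (Op x (F' n) v - w)) \<longlonglongrightarrow> 0"
      by (simp add: LIM_zero tendsto_norm_zero)
    moreover have "coord (Op x (F' n) v - w) = rho G x (F' n) (coord v) - coord w" for n
      using Cc_Cauchy_fibre_finite[OF F'] by (auto simp: coord_Op)
    ultimately show ?thesis by (simp add: norm_l2_eq_l2norm)
  qed
  then show "coord w \<in> ell2 (source_fibre G x) \<and> (\<forall>F'\<in>Cc_equiv G `` {F}.
      (\<lambda>n. l2norm (rho G x (F' n) (coord v) - coord w)) \<longlonglongrightarrow> 0)"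
    using w by blast
next
  fix \<eta> assume \<eta>: "\<eta> \<in> ell2 (source_fibre G x) \<and> (\<forall>F'\<in>Cc_equiv G `` {F}.
      (\<lambda>n. l2norm (rho G x (F' n) (coord v) - \<eta>)) \<longlonglongrightarrow> 0)"
  then have c: "coord (Abs_l2 \<eta>) = \<eta>" by (auto simp: ell2_def)
  have "(\<lambda>n. l2norm (rho G x (F n) (coord v) - \<eta>)) \<longlonglongrightarrow> 0"
    using \<eta> Cc_equiv_refl[OF F] by blast
  moreover have "coord (Op x (F n) v - Abs_l2 \<eta>) = rho G x (F n) (coord v) - \<eta>" for n
    using Cc_Cauchy_fibre_finite[OF F] by (auto simp: coord_Op c)
  ultimately have "(\<lambda>n. norm (Op x (F n) v - Abs_l2 \<eta>)) \<longlonglongrightarrow> 0"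
    by (simp add: norm_l2_eq_l2norm)
  then have "(\<lambda>n. Op x (F n) v) \<longlonglongrightarrow> Abs_l2 \<eta>"
    using tendsto_norm_zero_iff LIM_zero_cancel by blast
  with lim have "w = Abs_l2 \<eta>" by (rule LIMSEQ_unique)
  then show "\<eta> = coord w" using c by simp
qed

lemma mem_kernel_regular_rep:
  assumes F: "F \<in> Cc_Cauchy G" and x: "x \<in> units G"
  shows "Cc_equiv G `` {F} \<in> rep_kernel (reduced_Cstar G) (regular_rep G x) \<longleftrightarrow>
    (\<forall>v. coord v \<in> ell2 (source_fibre G x) \<longrightarrow> (\<lambda>n. Op x (F n) v) \<longlonglongrightarrow> 0)"
proof -
  let ?a = "Cc_equiv G `` {F}"
  have a: "?a \<in> reduced_Cstar G" unfolding reduced_Cstar_def using F by (rule quotientI)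
  have eq: "rho_ext G x ?a (coord v) = 0 \<longleftrightarrow> (\<lambda>n. Op x (F n) v) \<longlonglongrightarrow> 0"
    if v: "coord v \<in> ell2 (source_fibre G x)" for v
  proof -
    obtain w where w: "(\<lambda>n. Op x (F n) v) \<longlonglongrightarrow> w"
      using Cauchy_Op[OF F x v] Cauchy_convergent convergent_def by blast
    then have *: "rho_ext G x ?a (coord v) = coord w" by (rule rho_ext_eq[OF F x v])
    have "coord w = 0 \<longleftrightarrow> w = 0"
      by (metis coord_inject coord_zero ext zero_fun_apply)
    then show ?thesis using w * LIMSEQ_unique by metis
  qed
  have ell2: "coord (Abs_l2 \<xi>) = \<xi>" if "\<xi> \<in> ell2 (source_fibre G x)" for \<xi>
    using that by (auto simp: ell2_def)
  show ?thesis
    unfolding rep_kernel_def regular_rep_def using a eq ell2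
    by (auto simp del: coord_Abs_l2) (metis ell2)
qed

lemma mem_kernel_direct_sum:
  assumes F: "F \<in> Cc_Cauchy G" and Y: "Y \<subseteq> units G"
  shows "Cc_equiv G `` {F} \<in> rep_kernel (reduced_Cstar G) (direct_sum_rep Y (regular_rep G)) \<longleftrightarrow>
    (\<forall>y\<in>Y. Cc_equiv G `` {F} \<in> rep_kernel (reduced_Cstar G) (regular_rep G y))"
    (is "?a \<in> ?L \<longleftrightarrow> ?R")
proof
  assume L: "?a \<in> ?L"
  show ?R
  proof
    fix y assume y: "y \<in> Y"
    have "rho_ext G y ?a \<xi> = 0" if \<xi>: "\<xi> \<in> ell2 (source_fibre G y)" for \<xi>
    proof -
      define \<Xi> where "\<Xi> i = (if i = y then \<xi> else 0)" for i
      have 0: "(0 :: 'a \<Rightarrow> complex) \<in> ell2 S" for S by (simp add: ell2_def)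
      have "(\<lambda>i. (l2norm (\<Xi> i))\<^sup>2) summable_on Y"
      proof (rule summable_on_cong_neutral[THEN iffD1, rotated -1])
        show "(\<lambda>i. (l2norm (\<Xi> i))\<^sup>2) summable_on {y}" by simp
      qed (use y in \<open>auto simp: \<Xi>_def l2norm_def\<close>)
      then have "\<Xi> \<in> fst (direct_sum_rep Y (regular_rep G))"
        using \<xi> y 0 by (auto simp: direct_sum_rep_def regular_rep_def \<Xi>_def)
      then have "snd (direct_sum_rep Y (regular_rep G)) ?a \<Xi> = 0"
        using L by (simp add: rep_kernel_def)
      then have "snd (direct_sum_rep Y (regular_rep G)) ?a \<Xi> y = 0" by simp
      then show ?thesis using y by (simp add: direct_sum_rep_def regular_rep_def \<Xi>_def)
    qed
    then show "?a \<in> rep_kernel (reduced_Cstar G) (regular_rep G y)"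
      using L by (simp add: rep_kernel_def regular_rep_def)
  qed
next
  assume R: ?R
  have "?a \<in> reduced_Cstar G" unfolding reduced_Cstar_def using F by (rule quotientI)
  then show "?a \<in> ?L"
    using R by (auto simp: rep_kernel_def direct_sum_rep_def regular_rep_def fun_eq_iff)
qed

text \<open>Membership in either kernel can be tested on one representing sequence. From here on
  only limits of the operators \<open>Op z (F n)\<close> matter.\<close>

lemma weakly_contained_iff:
  assumes x: "x \<in> units G" and Y: "Y \<subseteq> units G"
  shows "weakly_contained (reduced_Cstar G) (regular_rep G x) (direct_sum_rep Y (regular_rep G)) \<longleftrightarrow>
    (\<forall>F\<in>Cc_Cauchy G.
      (\<forall>y\<in>Y. \<forall>v. coord v \<in> ell2 (source_fibre G y) \<longrightarrow> (\<lambda>n. Op y (F n) v) \<longlonglongrightarrow> 0) \<longrightarrow>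
      (\<forall>v. coord v \<in> ell2 (source_fibre G x) \<longrightarrow> (\<lambda>n. Op x (F n) v) \<longlonglongrightarrow> 0))"
    (is "_ \<longleftrightarrow> (\<forall>F\<in>Cc_Cauchy G. ?P F)")
proof -
  have P: "?P F \<longleftrightarrow>
      (Cc_equiv G `` {F} \<in> rep_kernel (reduced_Cstar G) (direct_sum_rep Y (regular_rep G)) \<longrightarrow>
       Cc_equiv G `` {F} \<in> rep_kernel (reduced_Cstar G) (regular_rep G x))"
    if "F \<in> Cc_Cauchy G" for F
  proof -
    have "Cc_equiv G `` {F} \<in> rep_kernel (reduced_Cstar G) (regular_rep G y) \<longleftrightarrow>
      (\<forall>v. coord v \<in> ell2 (source_fibre G y) \<longrightarrow> (\<lambda>n. Op y (F n) v) \<longlonglongrightarrow> 0)" if "y \<in> Y" for y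
      using mem_kernel_regular_rep[OF \<open>F \<in> Cc_Cauchy G\<close>, of y] Y that by blast
    then show ?thesis
      unfolding mem_kernel_direct_sum[OF that Y] mem_kernel_regular_rep[OF that x] by simp
  qed
  have "weakly_contained (reduced_Cstar G) (regular_rep G x) (direct_sum_rep Y (regular_rep G)) \<longleftrightarrow>
      (\<forall>F\<in>Cc_Cauchy G.
       Cc_equiv G `` {F} \<in> rep_kernel (reduced_Cstar G) (direct_sum_rep Y (regular_rep G)) \<longrightarrow>
       Cc_equiv G `` {F} \<in> rep_kernel (reduced_Cstar G) (regular_rep G x))"
    unfolding weakly_contained_def
  proof (safe)
    fix a assume *: "\<forall>F\<in>Cc_Cauchy G.
       Cc_equiv G `` {F} \<in> rep_kernel (reduced_Cstar G) (direct_sum_rep Y (regular_rep G)) \<longrightarrow>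
       Cc_equiv G `` {F} \<in> rep_kernel (reduced_Cstar G) (regular_rep G x)"
      and a: "a \<in> rep_kernel (reduced_Cstar G) (direct_sum_rep Y (regular_rep G))"
    then have "a \<in> Cc_Cauchy G // Cc_equiv G" by (simp add: rep_kernel_def reduced_Cstar_def)
    then obtain F where "F \<in> Cc_Cauchy G" "a = Cc_equiv G `` {F}" by (rule quotientE)
    then show "a \<in> rep_kernel (reduced_Cstar G) (regular_rep G x)" using * a by blast
  qed blast
  then show ?thesis using P by simp
qed

section \<open>Approaching a unit from an invariant set\<close>

definition nontrivial_bisections :: "'a \<Rightarrow> 'a set set" where
  "nontrivial_bisections x =
     {U. open_bisection G U \<and> (\<exists>g\<in>U. g \<in> source_fibre G x \<and> g \<in> range_fibre G x \<and> g \<noteq> x)}"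

text \<open>The base of the filter is kept as a family of its own: for \<open>x\<close> in the
  closure of \<open>Y\<close>, the empty set belongs to it exactly when a cover exists, and it also
  indexes the net constructed later.\<close>

definition approach_sets :: "'a set \<Rightarrow> 'a \<Rightarrow> 'a set set" where
  "approach_sets Y x = {Y \<inter> N - \<Union>\<U> | N \<U>. openin top N \<and> x \<in> N \<and>
     finite \<U> \<and> \<U> \<subseteq> nontrivial_bisections x}"

definition approach :: "'a set \<Rightarrow> 'a \<Rightarrow> 'a filter" where
  "approach Y x = (INF A\<in>approach_sets Y x. principal A)"

lemma approach_setsI:
  "openin top N \<Longrightarrow> x \<in> N \<Longrightarrow> finite \<U> \<Longrightarrow> \<U> \<subseteq> nontrivial_bisections x \<Longrightarrow>
    Y \<inter> N - \<Union>\<U> \<in> approach_sets Y x"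
  unfolding approach_sets_def by blast

lemma approach_sets_Int:
  assumes "A \<in> approach_sets Y x" "B \<in> approach_sets Y x"
  shows "A \<inter> B \<in> approach_sets Y x"
proof -
  obtain N \<U> where A: "A = Y \<inter> N - \<Union>\<U>" "openin top N" "x \<in> N" "finite \<U>"
    "\<U> \<subseteq> nontrivial_bisections x" using assms(1) unfolding approach_sets_def by blast
  obtain M \<V> where B: "B = Y \<inter> M - \<Union>\<V>" "openin top M" "x \<in> M" "finite \<V>"
    "\<V> \<subseteq> nontrivial_bisections x" using assms(2) unfolding approach_sets_def by blast
  have "Y \<inter> (N \<inter> M) - \<Union>(\<U> \<union> \<V>) \<in> approach_sets Y x"
    using A B by (intro approach_setsI) auto
  moreover have "A \<inter> B = Y \<inter> (N \<inter> M) - \<Union>(\<U> \<union> \<V>)" using A(1) B(1) by blast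
  ultimately show ?thesis by simp
qed

lemma eventually_approach:
  assumes x: "x \<in> arrows G"
  shows "eventually P (approach Y x) \<longleftrightarrow> (\<exists>A\<in>approach_sets Y x. \<forall>y\<in>A. P y)"
proof -
  have "Y \<inter> arrows G - \<Union>{} \<in> approach_sets Y x"
    using x openin_topspace[of top] by (intro approach_setsI) auto
  then have ne: "approach_sets Y x \<noteq> {}" by blast
  have "eventually P (approach Y x) \<longleftrightarrow> (\<exists>A\<in>approach_sets Y x. eventually P (principal A))"
    unfolding approach_def using ne
  proof (rule eventually_INF_base)
    fix A B assume "A \<in> approach_sets Y x" "B \<in> approach_sets Y x"
    then show "\<exists>C\<in>approach_sets Y x. principal C \<le> inf (principal A) (principal B)"
      using approach_sets_Int by (intro bexI[of _ "A \<inter> B"]) auto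
  qed
  then show ?thesis by (simp add: eventually_principal)
qed

lemma approach_neq_bot:
  assumes x: "x \<in> arrows G" and "{} \<notin> approach_sets Y x"
  shows "approach Y x \<noteq> bot"
  unfolding trivial_limit_def[symmetric, abs_def]
  using assms by (auto simp: trivial_limit_def eventually_approach)

lemma eventually_approach_nbhd:
  assumes "openin top N" "x \<in> N"
  shows "\<forall>\<^sub>F y in approach Y x. y \<in> Y \<and> y \<in> N"
proof -
  have "Y \<inter> N - \<Union>{} \<in> approach_sets Y x" using assms by (intro approach_setsI) auto
  then show ?thesis using assms open_arrows by (subst eventually_approach) auto
qed

lemma eventually_approach_avoid:
  assumes x: "x \<in> arrows G" and U: "U \<in> nontrivial_bisections x"
  shows "\<forall>\<^sub>F y in approach Y x. y \<notin> U"
proof -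
  have "Y \<inter> arrows G - \<Union>{U} \<in> approach_sets Y x"
    using x U openin_topspace[of top] by (intro approach_setsI) auto
  then show ?thesis using x by (subst eventually_approach) auto
qed

section \<open>Lifting nearby units through bisections\<close>

definition bis_at :: "'a \<Rightarrow> 'a set" where
  "bis_at g = (SOME U. open_bisection G U \<and> g \<in> U)"

text \<open>At units which the chosen bisection does not reach the value is unspecified, so facts
  about lifts are stated eventually along \<open>approach Y x\<close>.\<close>

definition lift :: "'a \<Rightarrow> 'a \<Rightarrow> 'a" where "lift y g = ssec (bis_at g) y"

lemma bis_at:
  assumes "g \<in> arrows G"
  shows "open_bisection G (bis_at g)" "g \<in> bis_at g"
proof -
  have "\<exists>U. open_bisection G U \<and> g \<in> U"
    using open_bisection_exists[OF openin_topspace, of g] assms by auto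
  then have "open_bisection G (bis_at g) \<and> g \<in> bis_at g" unfolding bis_at_def by (rule someI_ex)
  then show "open_bisection G (bis_at g)" "g \<in> bis_at g" by auto
qed

lemma eventually_lift:
  assumes x: "x \<in> units G" and g: "g \<in> source_fibre G x" and W: "openin top W" "g \<in> W"
  shows "\<forall>\<^sub>F y in approach Y x. lift y g \<in> W \<and> lift y g \<in> source_fibre G y"
proof -
  have ar: "g \<in> arrows G" "s g = x" using g by auto
  note b = bis_at[OF ar(1)] and D = open_bisectionD[OF bis_at(1)[OF ar(1)]]
  let ?N = "s ` (bis_at g \<inter> W)"
  have "openin top ?N" using D W open_image_rs by blast
  moreover have "x \<in> ?N" using b W ar by blast
  ultimately have "\<forall>\<^sub>F y in approach Y x. y \<in> Y \<and> y \<in> ?N" by (rule eventually_approach_nbhd)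
  then show ?thesis
  proof (rule eventually_mono)
    fix y assume "y \<in> Y \<and> y \<in> ?N"
    then obtain w where w: "w \<in> bis_at g" "w \<in> W" "y = s w" by blast
    then have "lift y g = w" using b by (simp add: lift_def)
    then show "lift y g \<in> W \<and> lift y g \<in> source_fibre G y"
      using w D(4) by auto
  qed
qed

lemma Hausdorff_units_separate:
  assumes "y \<in> units G" "z \<in> units G" "y \<noteq> z"
  obtains N M where "openin top N" "openin top M" "y \<in> N" "z \<in> M" "N \<inter> M = {}"
proof -
  have "topspace (subtopology top (units G)) = units G"
    using openin_subset[OF open_units] by auto
  then obtain N M where "openin (subtopology top (units G)) N" "openin (subtopology top (units G)) M"
    "y \<in> N" "z \<in> M" "disjnt N M"
    using units_Hausdorff assms unfolding Hausdorff_space_def by metis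
  then show ?thesis using that openin_trans_full[OF _ open_units] by (metis disjnt_def)
qed

text \<open>The quotients of lifts stay away from every arrow except the expected limit. A wrong
  range or source is excluded by separating units; an arrow \<open>k\<close> with the right range
  and source is excluded because it would force the units \<open>y\<close> into a bisection that the
  filter avoids.\<close>

lemma lift_separate:
  assumes x: "x \<in> units G" and g: "g \<in> source_fibre G x" and h: "h \<in> source_fibre G x"
    and k: "k \<in> arrows G" "k \<noteq> h \<cdot> iv g"
  obtains W where "openin top W" "k \<in> W" "\<forall>\<^sub>F y in approach Y x. lift y h \<cdot> iv (lift y g) \<notin> W"
proof -
  have ar: "g \<in> arrows G" "s g = x" "h \<in> arrows G" "s h = x" using g h by auto
  consider "r k \<noteq> r h" | "s k \<noteq> r g" | "r k = r h" "s k = r g" by blast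
  then show ?thesis
  proof cases
    case 1
    obtain N M where N: "openin top N" "openin top M" "r k \<in> N" "r h \<in> M" "N \<inter> M = {}"
      using Hausdorff_units_separate[of "r k" "r h"] 1 ar k by auto
    have "\<forall>\<^sub>F y in approach Y x. lift y h \<in> {p \<in> arrows G. r p \<in> M} \<and> lift y h \<in> source_fibre G y"
      by (rule eventually_lift[OF x h]) (use open_preimage_rs N ar in auto)
    moreover have "\<forall>\<^sub>F y in approach Y x. lift y g \<in> arrows G \<and> lift y g \<in> source_fibre G y"
      by (rule eventually_lift[OF x g]) (use openin_topspace[of top] ar in auto)
    ultimately have "\<forall>\<^sub>F y in approach Y x. lift y h \<cdot> iv (lift y g) \<notin> {p \<in> arrows G. r p \<in> N}"
      by eventually_elim (use N(5) in auto)
    then show ?thesis using that[of "{p \<in> arrows G. r p \<in> N}"] open_preimage_rs N k by auto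
  next
    case 2
    obtain N M where N: "openin top N" "openin top M" "s k \<in> N" "r g \<in> M" "N \<inter> M = {}"
      using Hausdorff_units_separate[of "s k" "r g"] 2 ar k by auto
    have "\<forall>\<^sub>F y in approach Y x. lift y g \<in> {p \<in> arrows G. r p \<in> M} \<and> lift y g \<in> source_fibre G y"
      by (rule eventually_lift[OF x g]) (use open_preimage_rs N ar in auto)
    moreover have "\<forall>\<^sub>F y in approach Y x. lift y h \<in> arrows G \<and> lift y h \<in> source_fibre G y"
      by (rule eventually_lift[OF x h]) (use openin_topspace[of top] ar in auto)
    ultimately have "\<forall>\<^sub>F y in approach Y x. lift y h \<cdot> iv (lift y g) \<notin> {p \<in> arrows G. s p \<in> N}"
      by eventually_elim (use N(5) in auto)
    then show ?thesis using that[of "{p \<in> arrows G. s p \<in> N}"] open_preimage_rs N k by auto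
  next
    case 3
    \<comment> \<open>This isotropy element measures how far \<open>k\<close> is from
      \<open>h \<cdot> iv g\<close>. If the quotient of the lifts were near \<open>k\<close>, then
      \<open>y = iv (lift y h) \<cdot> lift y h\<close> would be near \<open>p\<close>.\<close>
    define p where "p = iv h \<cdot> (k \<cdot> g)"
    have kg: "k \<cdot> g \<in> arrows G" "r (k \<cdot> g) = r h" "s (k \<cdot> g) = x" using ar k 3 by auto
    have p: "p \<in> arrows G" "r p = x" "s p = x" using ar kg by (auto simp: p_def)
    have "p \<noteq> x"
    proof
      assume "p = x"
      have "k \<cdot> g = h \<cdot> p" using ar kg by (simp add: p_def inv_cancel)
      then have "k \<cdot> g = h" using \<open>p = x\<close> ar by simp
      then have "k = h \<cdot> iv g" using ar k 3 inv_cancel(3)[of g k] by simp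
      then show False using k by blast
    qed
    then have B: "bis_at p \<in> nontrivial_bisections x" "openin top (bis_at p)"
      using bis_at[OF p(1)] p open_bisectionD(1) by (auto simp: nontrivial_bisections_def)
    obtain U1 U2 where U: "openin top U1" "openin top U2" "iv h \<in> U1" "k \<cdot> g \<in> U2"
      "\<And>u v. u \<in> U1 \<Longrightarrow> v \<in> U2 \<Longrightarrow> s u = r v \<Longrightarrow> u \<cdot> v \<in> bis_at p"
      using mult_nbhd[of "iv h" "k \<cdot> g" "bis_at p"] ar kg B bis_at(2)[OF p(1)] by (auto simp: p_def)
    obtain V1 V2 where V: "openin top V1" "openin top V2" "k \<in> V1" "g \<in> V2"
      "\<And>u v. u \<in> V1 \<Longrightarrow> v \<in> V2 \<Longrightarrow> s u = r v \<Longrightarrow> u \<cdot> v \<in> U2"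
      using mult_nbhd[of k g U2] ar k 3 U by auto
    have "\<forall>\<^sub>F y in approach Y x. lift y h \<in> {q \<in> arrows G. iv q \<in> U1} \<and> lift y h \<in> source_fibre G y"
      by (rule eventually_lift[OF x h]) (use open_inv U ar in auto)
    moreover have "\<forall>\<^sub>F y in approach Y x. lift y g \<in> V2 \<and> lift y g \<in> source_fibre G y"
      by (rule eventually_lift[OF x g]) (use V in auto)
    moreover have "\<forall>\<^sub>F y in approach Y x. y \<notin> bis_at p"
      using x B by (intro eventually_approach_avoid) auto
    ultimately have "\<forall>\<^sub>F y in approach Y x. lift y h \<cdot> iv (lift y g) \<notin> V1"
    proof eventually_elim
      case (elim y)
      let ?g = "lift y g" and ?h = "lift y h"
      have a: "?g \<in> arrows G" "?h \<in> arrows G" "s ?g = y" "s ?h = y" using elim by auto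
      show ?case
      proof
        assume "?h \<cdot> iv ?g \<in> V1"
        then have "(?h \<cdot> iv ?g) \<cdot> ?g \<in> U2" using V(5)[of "?h \<cdot> iv ?g" ?g] elim a by simp
        then have "?h \<in> U2" using a by (simp add: inv_cancel)
        then have "iv ?h \<cdot> ?h \<in> bis_at p" using U(5)[of "iv ?h" ?h] elim a by simp
        then show False using a elim by (simp add: inv_left)
      qed
    qed
    then show ?thesis using that[of V1] V by blast
  qed
qed

lemma eventually_lift_quotient:
  assumes x: "x \<in> units G" and g: "g \<in> source_fibre G x" and h: "h \<in> source_fibre G x"
    and W: "openin top W" "h \<cdot> iv g \<in> W"
  shows "\<forall>\<^sub>F y in approach Y x. lift y h \<cdot> iv (lift y g) \<in> W"
proof -
  have ar: "g \<in> arrows G" "s g = x" "h \<in> arrows G" "s h = x" using g h by auto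
  obtain U V where U: "openin top U" "openin top V" "h \<in> U" "iv g \<in> V"
      "\<And>u v. u \<in> U \<Longrightarrow> v \<in> V \<Longrightarrow> s u = r v \<Longrightarrow> u \<cdot> v \<in> W"
    using mult_nbhd[of h "iv g" W] ar W by auto
  have "\<forall>\<^sub>F y in approach Y x. lift y h \<in> U \<and> lift y h \<in> source_fibre G y"
    by (rule eventually_lift[OF x h]) (use U in auto)
  moreover have "\<forall>\<^sub>F y in approach Y x. lift y g \<in> {q \<in> arrows G. iv q \<in> V} \<and> lift y g \<in> source_fibre G y"
    by (rule eventually_lift[OF x g]) (use open_inv U ar in auto)
  ultimately show ?thesis by eventually_elim (use U(5) in auto)
qed

text \<open>Separation is applied to the arrow \<open>r g\<close>: the quotient of
  \<open>lift y g\<close> by itself comes close to it, while the quotient of \<open>lift y h\<close>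
  by \<open>lift y g\<close> stays away.\<close>

lemma eventually_lift_neq:
  assumes x: "x \<in> units G" and g: "g \<in> source_fibre G x" and h: "h \<in> source_fibre G x"
    and "g \<noteq> h"
  shows "\<forall>\<^sub>F y in approach Y x. lift y g \<noteq> lift y h"
proof -
  have ar: "g \<in> arrows G" "s g = x" "h \<in> arrows G" "s h = x" using g h by auto
  have "r g \<noteq> h \<cdot> iv g"
  proof
    assume "r g = h \<cdot> iv g"
    then have "r g \<cdot> g = h" using ar inv_cancel(4)[of g h] by simp
    then show False using ar \<open>g \<noteq> h\<close> by simp
  qed
  then obtain W where W: "openin top W" "r g \<in> W"
    "\<forall>\<^sub>F y in approach Y x. lift y h \<cdot> iv (lift y g) \<notin> W"
    using lift_separate[OF x g h, of "r g" Y] ar by auto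
  have "\<forall>\<^sub>F y in approach Y x. lift y g \<cdot> iv (lift y g) \<in> W"
    using W ar by (intro eventually_lift_quotient[OF x g g]) (auto simp: inv_right)
  with W(3) show ?thesis by eventually_elim auto
qed

lemma Cc_on_tendsto:
  assumes x: "x \<in> units G" and g: "g \<in> source_fibre G x" and h: "h \<in> source_fibre G x"
    and f: "f \<in> Cc_on G V" and V: "openin top V"
  shows "((\<lambda>y. f (lift y h \<cdot> iv (lift y g))) \<longlongrightarrow> f (h \<cdot> iv g)) (approach Y x)"
proof (cases "h \<cdot> iv g \<in> V")
  case True
  let ?V = "subtopology top V"
  have tV: "topspace ?V = V" using openin_subset[OF V] by auto
  show ?thesis
  proof (rule topological_tendstoI)
    fix S assume S: "open S" "f (h \<cdot> iv g) \<in> S"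
    have "continuous_map ?V euclidean f" using f by (simp add: Cc_on_def)
    then have "openin ?V {p \<in> topspace ?V. f p \<in> S}"
      using S by (intro openin_continuous_map_preimage) auto
    then have "openin top {p \<in> V. f p \<in> S}" using V tV openin_trans_full by metis
    then have "\<forall>\<^sub>F y in approach Y x. lift y h \<cdot> iv (lift y g) \<in> {p \<in> V. f p \<in> S}"
      using True S by (intro eventually_lift_quotient[OF x g h]) auto
    then show "\<forall>\<^sub>F y in approach Y x. f (lift y h \<cdot> iv (lift y g)) \<in> S"
      by (rule eventually_mono) auto
  qed
next
  case False
  define K where "K = subtopology top V closure_of {g \<in> V. f g \<noteq> 0}"
  have K: "compactin top K" "K \<subseteq> V" and 0: "\<And>g. g \<notin> V \<Longrightarrow> f g = 0"
    using f by (auto simp: Cc_on_def K_def compactin_subtopology)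
  have "{g \<in> V. f g \<noteq> 0} \<subseteq> K"
    unfolding K_def using openin_subset[OF V] by (intro closure_of_subset) auto
  then have 0: "f g = 0" if "g \<notin> K" for g using 0 that by blast
  let ?C = "{W. openin top W \<and> (\<forall>\<^sub>F y in approach Y x. lift y h \<cdot> iv (lift y g) \<notin> W)}"
  have "\<exists>\<F>. finite \<F> \<and> \<F> \<subseteq> ?C \<and> K \<subseteq> \<Union>\<F>"
  proof (rule compactinD[OF K(1)])
    show "K \<subseteq> \<Union>?C"
    proof
      fix k assume "k \<in> K"
      then have "k \<in> arrows G" "k \<noteq> h \<cdot> iv g"
        using compactin_subset_topspace[OF K(1)] K(2) False by auto
      then obtain W where "openin top W" "k \<in> W"
        "\<forall>\<^sub>F y in approach Y x. lift y h \<cdot> iv (lift y g) \<notin> W"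
        by (rule lift_separate[OF x g h])
      then show "k \<in> \<Union>?C" by blast
    qed
  qed auto
  then obtain \<F> where \<F>: "finite \<F>" "\<F> \<subseteq> ?C" "K \<subseteq> \<Union>\<F>" by blast
  have "\<forall>\<^sub>F y in approach Y x. \<forall>W\<in>\<F>. lift y h \<cdot> iv (lift y g) \<notin> W"
    using \<F> by (intro eventually_ball_finite) auto
  then have "\<forall>\<^sub>F y in approach Y x. f (lift y h \<cdot> iv (lift y g)) = 0"
    by (rule eventually_mono) (use \<F>(3) 0 in blast)
  moreover have "f (h \<cdot> iv g) = 0" using False K(2) 0 by blast
  ultimately show ?thesis by (simp add: tendsto_eventually)
qed

lemma Cc_tendsto:
  assumes x: "x \<in> units G" and g: "g \<in> source_fibre G x" and h: "h \<in> source_fibre G x"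
    and f: "f \<in> Cc G"
  shows "((\<lambda>y. f (lift y h \<cdot> iv (lift y g))) \<longlongrightarrow> f (h \<cdot> iv g)) (approach Y x)"
proof -
  obtain n c F where
    *: "\<forall>k<n. \<exists>V. openin top V \<and> Hausdorff_space (subtopology top V) \<and> F k \<in> Cc_on G V"
       "f = (\<lambda>g. \<Sum>k<(n::nat). c k * F k g)"
    using f unfolding Cc_def by blast
  show ?thesis
    unfolding *(2)
    by (intro tendsto_sum tendsto_mult tendsto_const) (use *(1) Cc_on_tendsto[OF x g h] in blast)
qed

lemma coord_Op_finite_support:
  assumes f: "fibre_finite f" and S: "finite S" "\<And>p. p \<notin> S \<Longrightarrow> kern x f g p * coord v p = 0"
  shows "coord (Op x f v) g = (\<Sum>p\<in>S. kern x f g p * coord v p)"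
proof -
  let ?K = "{p. kern x f g p \<noteq> 0}"
  have K: "finite ?K" using fin_band_kern[OF f] fin_bandD(1) by metis
  have "coord (Op x f v) g = (\<Sum>p\<in>?K. kern x f g p * coord v p)"
    by (rule coord_Op_sum[OF f])
  also have "\<dots> = (\<Sum>p\<in>?K \<union> S. kern x f g p * coord v p)"
    using K S by (intro sum.mono_neutral_left) auto
  also have "\<dots> = (\<Sum>p\<in>S. kern x f g p * coord v p)"
    using K S by (intro sum.mono_neutral_right) auto
  finally show ?thesis .
qed

text \<open>The entries \<open>f (h \<cdot> iv g)\<close> of the matrix of \<open>f\<close> at \<open>x\<close> are limits of the entries of the
  matrices at the points approaching \<open>x\<close>.\<close>

lemma Op_bound_approach:
  assumes x: "x \<in> units G" and near: "approach Y x \<noteq> bot" and f: "f \<in> Cc G" and "0 \<le> C"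
    and bound: "\<And>y v. y \<in> Y \<Longrightarrow> coord v \<in> ell2 (source_fibre G y) \<Longrightarrow> norm (Op y f v) \<le> C * norm v"
  shows "norm (Op x f v) \<le> C * norm v"
proof (rule norm_l2_leI)
  show "0 \<le> C * norm v" using \<open>0 \<le> C\<close> by simp
  have ff: "fibre_finite f" by (rule Cc_fibre_finite[OF f])
  fix E :: "'a set" assume E: "finite E"
  \<comment> \<open>Only finitely many output coordinates \<open>B\<close> are tested, and
    \<open>A\<close> collects all columns met by their rows. The claim thus involves a finite matrix
    block.\<close>
  define B where "B = E \<inter> source_fibre G x"
  define A where "A = (\<Union>h\<in>B. {g. kern x f h g \<noteq> 0})"
  have "finite {g. kern x f h g \<noteq> 0}" for h using fin_band_kern[OF ff] fin_bandD(1) by metis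
  then have fin: "finite A" "finite B" using E by (auto simp: A_def B_def)
  have A: "A \<subseteq> source_fibre G x" by (auto simp: A_def kern_def split: if_splits)
  have B: "B \<subseteq> source_fibre G x" by (auto simp: B_def)
  have coordB: "coord (Op x f v) h = (\<Sum>g\<in>A. f (h \<cdot> iv g) * coord v g)" if h: "h \<in> B" for h
  proof -
    have "coord (Op x f v) h = (\<Sum>g\<in>A. kern x f h g * coord v g)"
      using fin h by (intro coord_Op_finite_support[OF ff]) (auto simp: A_def)
    also have "\<dots> = (\<Sum>g\<in>A. f (h \<cdot> iv g) * coord v g)"
      using A B h by (intro sum.cong refl) (auto simp: kern_def)
    finally show ?thesis .
  qed
  have "(\<Sum>h\<in>E. (cmod (coord (Op x f v) h))\<^sup>2) = (\<Sum>h\<in>B. (cmod (coord (Op x f v) h))\<^sup>2)"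
    using E by (intro sum.mono_neutral_right)
      (auto simp: B_def coord_Op[OF ff] rho_def)
  also have "\<dots> = (\<Sum>h\<in>B. (cmod (\<Sum>g\<in>A. f (h \<cdot> iv g) * coord v g))\<^sup>2)"
    by (simp add: coordB)
  also have "\<dots> \<le> (C * norm v)\<^sup>2"
  proof (rule tendsto_upperbound[OF _ _ near])
    show "((\<lambda>y. \<Sum>h\<in>B. (cmod (\<Sum>g\<in>A. f (lift y h \<cdot> iv (lift y g)) * coord v g))\<^sup>2) \<longlongrightarrow>
        (\<Sum>h\<in>B. (cmod (\<Sum>g\<in>A. f (h \<cdot> iv g) * coord v g))\<^sup>2)) (approach Y x)"
      using A B by (intro tendsto_intros Cc_tendsto[OF x _ _ f]) auto
    have "\<forall>\<^sub>F y in approach Y x. y \<in> Y"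
      using eventually_approach_nbhd[OF openin_topspace, of x Y] x by (auto elim: eventually_mono)
    moreover have "\<forall>\<^sub>F y in approach Y x. \<forall>g\<in>A \<union> B. lift y g \<in> source_fibre G y"
    proof (intro eventually_ball_finite ballI)
      fix g assume "g \<in> A \<union> B"
      then have g: "g \<in> source_fibre G x" using A B by blast
      show "\<forall>\<^sub>F y in approach Y x. lift y g \<in> source_fibre G y"
        using eventually_lift[OF x g openin_topspace, of Y] g by (auto elim: eventually_mono)
    qed (use fin in auto)
    moreover have "\<forall>\<^sub>F y in approach Y x. \<forall>g\<in>A \<union> B. \<forall>h\<in>A \<union> B. g \<noteq> h \<longrightarrow> lift y g \<noteq> lift y h"
    proof (intro eventually_ball_finite ballI)
      fix g h assume "g \<in> A \<union> B" "h \<in> A \<union> B"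
      then have "g \<in> source_fibre G x" "h \<in> source_fibre G x" using A B by blast+
      then show "\<forall>\<^sub>F y in approach Y x. g \<noteq> h \<longrightarrow> lift y g \<noteq> lift y h"
        using eventually_lift_neq[OF x] by (cases "g = h") auto
    qed (use fin in auto)
    ultimately show "\<forall>\<^sub>F y in approach Y x.
        (\<Sum>h\<in>B. (cmod (\<Sum>g\<in>A. f (lift y h \<cdot> iv (lift y g)) * coord v g))\<^sup>2) \<le> (C * norm v)\<^sup>2"
    proof eventually_elim
      case (elim y)
      have inj: "inj_on (lift y) A" "inj_on (lift y) B" using elim(3) by (auto simp: inj_on_def)
      \<comment> \<open>The part of \<open>v\<close> on \<open>A\<close> is carried to the fibre of
        \<open>y\<close> along the lifts. Injectivity on \<open>A\<close> ensures that its norm does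
        not exceed that of \<open>v\<close>.\<close>
      define \<xi> where "\<xi> p = (if p \<in> lift y ` A then coord v (the_inv_into A (lift y) p) else 0)" for p
      define w where "w = Abs_l2 \<xi>"
      have \<xi>: "\<xi> (lift y g) = coord v g" if "g \<in> A" for g
        using that inj by (simp add: \<xi>_def the_inv_into_f_f)
      have w: "coord w = \<xi>" "(norm w)\<^sup>2 = (\<Sum>p\<in>lift y ` A. (cmod (\<xi> p))\<^sup>2)"
        unfolding w_def using finite_support_l2[of "lift y ` A" \<xi>] fin by (auto simp: \<xi>_def)
      have "(norm w)\<^sup>2 = (\<Sum>g\<in>A. (cmod (coord v g))\<^sup>2)"
        unfolding w(2) by (simp add: sum.reindex[OF inj(1)] \<xi>)
      also have "\<dots> \<le> (norm v)\<^sup>2" using fin by (intro finite_sum_le_norm_l2)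
      finally have nw: "norm w \<le> norm v" by (rule power2_le_imp_le[OF _ norm_ge_zero])
      have supp: "coord w \<in> ell2 (source_fibre G y)"
        using coord_summable[of w] elim(2) unfolding ell2_def w(1) by (auto simp: \<xi>_def)
      have "(\<Sum>h\<in>B. (cmod (\<Sum>g\<in>A. f (lift y h \<cdot> iv (lift y g)) * coord v g))\<^sup>2)
          = (\<Sum>h\<in>B. (cmod (coord (Op y f w) (lift y h)))\<^sup>2)"
      proof (rule sum.cong[OF refl])
        fix h assume h: "h \<in> B"
        have "coord (Op y f w) (lift y h) = (\<Sum>p\<in>lift y ` A. kern y f (lift y h) p * coord w p)"
          using fin by (intro coord_Op_finite_support[OF ff]) (auto simp: w \<xi>_def)
        also have "\<dots> = (\<Sum>g\<in>A. f (lift y h \<cdot> iv (lift y g)) * coord v g)"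
          unfolding sum.reindex[OF inj(1)] using elim(2) h
          by (intro sum.cong refl) (simp add: w(1) \<xi> kern_def)
        finally show "(cmod (\<Sum>g\<in>A. f (lift y h \<cdot> iv (lift y g)) * coord v g))\<^sup>2
            = (cmod (coord (Op y f w) (lift y h)))\<^sup>2" by simp
      qed
      also have "\<dots> = (\<Sum>p\<in>lift y ` B. (cmod (coord (Op y f w) p))\<^sup>2)"
        by (simp add: sum.reindex[OF inj(2)])
      also have "\<dots> \<le> (norm (Op y f w))\<^sup>2" using fin by (intro finite_sum_le_norm_l2) auto
      also have "\<dots> \<le> (C * norm v)\<^sup>2"
      proof (rule power_mono)
        have "norm (Op y f w) \<le> C * norm w" using bound elim(1) supp by blast
        also have "\<dots> \<le> C * norm v" using nw \<open>0 \<le> C\<close> by (rule mult_left_mono)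
        finally show "norm (Op y f w) \<le> C * norm v" .
      qed simp
      finally show ?case .
    qed
  qed
  finally show "(\<Sum>h\<in>E. (cmod (coord (Op x f v) h))\<^sup>2) \<le> (C * norm v)\<^sup>2" .
qed

text \<open>A Cauchy sequence tending to 0 at each point of \<open>Y\<close> has late terms that are
  small over all of \<open>Y\<close> uniformly, and this smallness transfers to
  \<open>x\<close>.\<close>

lemma weakly_contained_if_approach:
  assumes x: "x \<in> units G" and Y: "Y \<subseteq> units G" and near: "approach Y x \<noteq> bot"
  shows "weakly_contained (reduced_Cstar G) (regular_rep G x) (direct_sum_rep Y (regular_rep G))"
  unfolding weakly_contained_iff[OF x Y]
proof (intro ballI impI allI)
  fix F v assume F: "F \<in> Cc_Cauchy G"
    and lim: "\<forall>y\<in>Y. \<forall>v. coord v \<in> ell2 (source_fibre G y) \<longrightarrow> (\<lambda>n. Op y (F n) v) \<longlonglongrightarrow> 0"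
  show "(\<lambda>n. Op x (F n) v) \<longlonglongrightarrow> 0"
  proof (rule metric_LIMSEQ_I)
    fix e :: real assume e: "0 < e"
    obtain \<epsilon> where \<epsilon>: "0 < \<epsilon>" and less: "\<epsilon> * norm v < e" using small_multiple[OF e] .
    obtain N where N: "\<And>m n x v. N \<le> m \<Longrightarrow> N \<le> n \<Longrightarrow> x \<in> units G \<Longrightarrow>
       coord v \<in> ell2 (source_fibre G x) \<Longrightarrow> norm (Op x (F m) v - Op x (F n) v) \<le> \<epsilon> * norm v"
      using Cauchy_Op_bound[OF F \<epsilon>] by blast
    have "norm (Op x (F n) v) \<le> \<epsilon> * norm v" if n: "N \<le> n" for n
    proof (rule Op_bound_approach[OF x near])
      show "F n \<in> Cc G" using F by (simp add: Cc_Cauchy_def)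
      fix y w assume y: "y \<in> Y" and w: "coord w \<in> ell2 (source_fibre G y)"
      \<comment> \<open>With \<open>n\<close> fixed, \<open>m\<close> tends to infinity in the
        Cauchy estimate, and the term with \<open>F m\<close> disappears.\<close>
      show "norm (Op y (F n) w) \<le> \<epsilon> * norm w"
      proof (rule tendsto_upperbound)
        show "(\<lambda>m. norm (Op y (F m) w - Op y (F n) w)) \<longlonglongrightarrow> norm (Op y (F n) w)"
          using tendsto_norm[OF tendsto_diff[OF lim[rule_format, OF y w] tendsto_const[of "Op y (F n) w"]]]
          by simp
        show "\<forall>\<^sub>F m in sequentially. norm (Op y (F m) w - Op y (F n) w) \<le> \<epsilon> * norm w"
          using N[OF _ n _ w] y Y by (intro eventually_sequentiallyI[of N]) blast
      qed simp
    qed (use \<epsilon> in simp)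
    then have "\<forall>n\<ge>N. dist (Op x (F n) v) 0 < e"
      using less by (auto intro: le_less_trans)
    then show "\<exists>N. \<forall>n\<ge>N. dist (Op x (F n) v) 0 < e" by blast
  qed
qed

section \<open>Obstruction to weak containment\<close>

fun abs_seq :: "('a \<Rightarrow> complex) \<Rightarrow> nat \<Rightarrow> 'a \<Rightarrow> complex" where
  "abs_seq f 0 = (\<lambda>_. 0)"
| "abs_seq f (Suc n) = (\<lambda>g. complex_of_real (1 / 2) * prd f f g + complex_of_real (maj n) * abs_seq f n g
      + complex_of_real (- (1 / 2)) * prd (abs_seq f n) (abs_seq f n) g)"

lemma abs_seq_Cb:
  assumes "f \<in> Cb"
  shows "abs_seq f n \<in> Cb"
proof (induction n)
  case 0
  show ?case using Cb_zero by simp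
next
  case (Suc n)
  show ?case unfolding abs_seq.simps by (intro Cb_add Cb_scale Cb_prd assms Suc)
qed

text \<open>Both recursions have the same shape, and convolution becomes composition at every unit.
  One sequence of functions thus approximates the absolute values at all units
  simultaneously.\<close>

lemma Op_abs_seq:
  assumes f: "f \<in> Cb"
  shows "Op z (abs_seq f n) v = abs_approx (Op z f) n v"
proof (induction n arbitrary: v)
  case 0
  show ?case using Op_scale[OF fibre_finite_zero, of z 0 v] by simp
next
  case (Suc n)
  note C = abs_seq_Cb[OF f, of n]
  note ff = Cb_fibre_finite[OF Cb_prd[OF f f]] Cb_fibre_finite[OF C] Cb_fibre_finite[OF Cb_prd[OF C C]]
  have "Op z (abs_seq f (Suc n)) v = (1 / 2) *\<^sub>R Op z (prd f f) v + maj n *\<^sub>R Op z (abs_seq f n) v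
      + (- (1 / 2)) *\<^sub>R Op z (prd (abs_seq f n) (abs_seq f n)) v"
    unfolding abs_seq.simps
    by (subst Op_add Op_scale; (intro fibre_finite_add fibre_finite_scale ff)?)+ simp
  then show ?case by (simp add: Op_prd_Cb[OF f f] Op_prd_Cb[OF C C] Suc)
qed

text \<open>The element \<open>|f| - f\<close> of the completion, with \<open>f\<close> a positive
  multiple of \<open>f0\<close>, vanishes over \<open>Y\<close>, where \<open>f\<close> is positive.
  If it vanished at \<open>x\<close> too, then \<open>f\<close> would equal \<open>|f|\<close>
  there, contradicting the negative value at \<open>d\<close>.\<close>

lemma not_weakly_contained:
  assumes x: "x \<in> units G" and Y: "Y \<subseteq> units G" and f0: "f0 \<in> Cb"
    and sym: "\<And>z v w. inner (Op z f0 v) w = inner v (Op z f0 w)"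
    and pos: "\<And>y v. y \<in> Y \<Longrightarrow> 0 \<le> inner (Op y f0 v) v"
    and d: "coord d \<in> ell2 (source_fibre G x)" "inner (Op x f0 d) d < 0"
  shows "\<not> weakly_contained (reduced_Cstar G) (regular_rep G x) (direct_sum_rep Y (regular_rep G))"
proof
  assume wc: "weakly_contained (reduced_Cstar G) (regular_rep G x) (direct_sum_rep Y (regular_rep G))"
  obtain C where C: "0 \<le> C" "\<And>z v. norm (Op z f0 v) \<le> C * norm v"
    using Op_bounded[OF Cb_fibre_finite[OF f0]] by blast
  \<comment> \<open>Rescaling makes the operators at all units contractions at once; the added 1
    avoids division by zero when \<open>C = 0\<close>.\<close>
  define c where "c = 1 / (C + 1)"
  have c: "0 < c" "c * C \<le> 1" using C by (auto simp: c_def)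
  define f where "f = (\<lambda>g. complex_of_real c * f0 g)"
  have f: "f \<in> Cb" unfolding f_def by (intro Cb_scale f0)
  have Opf: "Op z f v = c *\<^sub>R Op z f0 v" for z v
    unfolding f_def by (rule Op_scale[OF Cb_fibre_finite[OF f0]])
  have T: "symmetric_contraction (Op z f)" for z
  proof (rule symmetric_contraction.intro)
    show "linear (Op z f)" by (rule linear_Op[OF Cb_fibre_finite[OF f]])
    show "inner (Op z f v) w = inner v (Op z f w)" for v w by (simp add: Opf sym)
    have "norm (Op z f v) \<le> c * (C * norm v)" for v
      using C(2)[of z v] c by (simp add: Opf)
    also have "c * (C * norm v) \<le> norm v" for v :: "'a l2"
      using mult_right_mono[OF c(2), of "norm v"] by (simp add: mult.assoc)
    finally show "norm (Op z f v) \<le> norm v" for v .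
  qed
  define F where "F n = abs_seq f n - f" for n
  have FCb: "F n \<in> Cb" for n unfolding F_def by (intro Cb_diff abs_seq_Cb f)
  have OpF: "Op z (F n) v = abs_approx (Op z f) n v - Op z f v" for z n v
    unfolding F_def by (simp add: Op_diff Cb_fibre_finite abs_seq_Cb f Op_abs_seq)
  have diff: "norm (Op z (F m - F n) v) \<le> 2 * (1 - maj N) * norm v" if "N \<le> m" "N \<le> n" for z m n N v
  proof -
    have *: "norm (abs_approx (Op z f) j v - abs_approx (Op z f) i v) \<le> 2 * (1 - maj N) * norm v"
      if "N \<le> i" "i \<le> j" for i j
    proof -
      have "norm (abs_approx (Op z f) j v - abs_approx (Op z f) i v) \<le> 2 * (1 - maj i) * norm v"
        by (rule symmetric_contraction.norm_X_diff[OF T that(2)])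
      also have "\<dots> \<le> 2 * (1 - maj N) * norm v"
        using maj_mono[OF that(1)] by (intro mult_right_mono) auto
      finally show ?thesis .
    qed
    have "Op z (F m - F n) v = abs_approx (Op z f) m v - abs_approx (Op z f) n v"
      by (simp add: Op_diff[OF Cb_fibre_finite[OF FCb] Cb_fibre_finite[OF FCb]] OpF)
    then show ?thesis
      using *[of n m] *[of m n] that by (cases "n \<le> m") (auto simp: norm_minus_commute)
  qed
  have F: "F \<in> Cc_Cauchy G"
    unfolding Cc_Cauchy_def
  proof (intro CollectI conjI allI impI)
    show "F n \<in> Cc G" for n by (rule Cb_Cc[OF FCb])
    fix \<epsilon> :: real assume \<epsilon>: "0 < \<epsilon>"
    have "(\<lambda>n. 2 * (1 - maj n)) \<longlonglongrightarrow> 2 * (1 - 1)" by (intro tendsto_intros maj_tendsto)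
    then have "\<forall>\<^sub>F n in sequentially. 2 * (1 - maj n) < \<epsilon>"
      using \<epsilon> by (intro order_tendstoD(2)) auto
    then obtain N where N: "2 * (1 - maj N) < \<epsilon>" by (meson eventually_sequentially order_refl)
    have "reduced_norm G (F m - F n) < ennreal \<epsilon>" if "N \<le> m" "N \<le> n" for m n
    proof -
      have "reduced_norm G (F m - F n) \<le> ennreal (2 * (1 - maj N))"
        using diff[OF that] maj_bounds(2)[of N]
        by (intro reduced_norm_leI Cb_fibre_finite Cb_diff FCb) auto
      also have "\<dots> < ennreal \<epsilon>" using N \<epsilon> by (simp add: ennreal_less_iff maj_bounds)
      finally show ?thesis .
    qed
    then show "\<exists>N. \<forall>m\<ge>N. \<forall>n\<ge>N. reduced_norm G (F m - F n) < ennreal \<epsilon>" by blast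
  qed
  have lim: "(\<lambda>n. Op z (F n) v) \<longlonglongrightarrow> symmetric_contraction.A (Op z f) v - Op z f v" for z v
    unfolding OpF by (intro tendsto_diff tendsto_const symmetric_contraction.X_tendsto[OF T])
  have "(\<lambda>n. Op y (F n) v) \<longlonglongrightarrow> 0" if "y \<in> Y" for y v
  proof -
    have "\<forall>v. 0 \<le> inner (Op y f v) v" using pos[OF that] c by (simp add: Opf)
    then have "symmetric_contraction.A (Op y f) v = Op y f v"
      using symmetric_contraction.A_eq_iff[OF T] by blast
    then show ?thesis using lim[of y v] by simp
  qed
  then have "(\<lambda>n. Op x (F n) d) \<longlonglongrightarrow> 0"
    using wc F d unfolding weakly_contained_iff[OF x Y] by blast
  then have "symmetric_contraction.A (Op x f) d - Op x f d = 0"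
    using lim LIMSEQ_unique by blast
  then have "0 \<le> inner (Op x f d) d"
    using symmetric_contraction.A_nonneg[OF T, of x d] by simp
  then show False using d c by (simp add: Opf zero_le_mult_iff)
qed

section \<open>Bump functions on the unit space\<close>

lemma bump_function:
  assumes N: "openin top N" "x \<in> N" "N \<subseteq> units G"
  shows "\<exists>(\<kappa> :: 'a \<Rightarrow> real) K. compactin top K \<and> K \<subseteq> N \<and> \<kappa> x = 1 \<and>
    (\<forall>z. z \<notin> K \<longrightarrow> \<kappa> z = 0) \<and> continuous_map (subtopology top (units G)) euclidean \<kappa>"
proof -
  let ?Z = "subtopology top (units G)"
  have Z: "topspace ?Z = units G" using openin_subset[OF open_units] by auto
  have x: "x \<in> units G" using N by blast
  obtain U L where U: "openin ?Z U" "compactin ?Z L" "x \<in> U" "U \<subseteq> L"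
    using units_locally_compact x Z unfolding locally_compact_space_def by metis
  have "openin ?Z (U \<inter> N)"
    using U N by (intro openin_Int) (auto simp: openin_open_subtopology[OF open_units])
  moreover have "units G - (units G - (U \<inter> N)) = U \<inter> N" using N(3) by blast
  ultimately have closed: "closedin ?Z (units G - (U \<inter> N))" unfolding closedin_def Z by simp
  have mem: "x \<in> topspace ?Z - (units G - (U \<inter> N))" unfolding Z using x U(3) N(2) by blast
  have "completely_regular_space ?Z"
    using units_locally_compact units_Hausdorff
    by (intro locally_compact_regular_imp_completely_regular_space) auto
  from this[unfolded completely_regular_space_def, rule_format, OF conjI[OF closed mem]]
  obtain f :: "'a \<Rightarrow> real" where f: "continuous_map ?Z (top_of_set {0..1}) f" "f x = 0"
     "f ` (units G - (U \<inter> N)) \<subseteq> {1}" by blast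
  then have fc: "continuous_map ?Z euclidean f" using continuous_map_into_fulltopology by blast
  \<comment> \<open>The separating function \<open>f\<close> is 0 at \<open>x\<close> and 1 off
    \<open>U \<inter> N\<close>. Cutting \<open>1 - 2 f\<close> off at 0 confines the support to a
    closed part of the compact set \<open>L\<close> and keeps the value 1 at
    \<open>x\<close>.\<close>
  define K where "K = {z \<in> units G. f z \<le> 1 / 2}"
  define \<kappa> where "\<kappa> z = (if z \<in> units G then max 0 (1 - 2 * f z) else 0)" for z
  have "closedin ?Z {z \<in> topspace ?Z. f z \<in> {..1 / 2}}"
    by (rule closedin_continuous_map_preimage[OF fc]) auto
  then have Kc: "closedin ?Z K" unfolding Z K_def by simp
  have KN: "K \<subseteq> U \<inter> N"
  proof
    fix z assume z: "z \<in> K"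
    show "z \<in> U \<inter> N"
    proof (rule ccontr)
      assume "z \<notin> U \<inter> N"
      then have "f z = 1" using f(3) z unfolding K_def by blast
      then show False using z by (simp add: K_def)
    qed
  qed
  then have "compactin ?Z K" using closed_compactin[OF U(2) _ Kc] U(4) by blast
  then have "compactin top K" by (simp add: compactin_subtopology)
  moreover have "continuous_map ?Z euclidean (\<lambda>z. max 0 (1 - 2 * f z))"
    by (intro continuous_map_real_max continuous_map_diff continuous_map_real_mult fc) auto
  then have "continuous_map ?Z euclidean \<kappa>"
    by (rule continuous_map_eq) (simp add: Z \<kappa>_def)
  ultimately show ?thesis
    using KN f(2) x by (intro exI[of _ \<kappa>] exI[of _ K]) (auto simp: \<kappa>_def K_def)
qed

section \<open>Isotropy groups and units near their elements\<close>

lemma carrier_isotropy [simp]: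
  "g \<in> carrier (isotropy G x) \<longleftrightarrow> g \<in> arrows G \<and> s g = x \<and> r g = x"
  by (auto simp: isotropy_def)

lemma isotropy_simps [simp]: "mult (isotropy G x) = gmult G" "one (isotropy G x) = x"
  by (auto simp: isotropy_def)

lemma group_isotropy:
  assumes "x \<in> units G"
  shows "group (isotropy G x)"
proof (rule groupI)
  fix g assume g: "g \<in> carrier (isotropy G x)"
  then show "\<exists>h\<in>carrier (isotropy G x). h \<otimes>\<^bsub>isotropy G x\<^esub> g = \<one>\<^bsub>isotropy G x\<^esub>"
    by (intro bexI[of _ "iv g"]) (auto simp: inv_left)
qed (use assms in \<open>auto simp: arrow_assoc\<close>)

lemma inv_isotropy:
  assumes "x \<in> units G" "g \<in> carrier (isotropy G x)"
  shows "inv\<^bsub>isotropy G x\<^esub> g = iv g"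
  by (rule group.inv_equality[OF group_isotropy[OF assms(1)]]) (use assms(2) in \<open>auto simp: inv_left\<close>)

text \<open>A unit near \<open>x\<close> that lies in an open bisection through \<open>g\<close> behaves like an element of a
  subgroup of the isotropy group: it lies in every open set around any power of \<open>g\<close>.\<close>

lemma eventually_mem_generate:
  assumes x: "x \<in> units G" and U: "open_bisection G U" and g: "g \<in> U" "g \<in> carrier (isotropy G x)"
    and h: "h \<in> generate (isotropy G x) {g}" and V: "openin top V" "h \<in> V"
  shows "\<forall>\<^sub>F y in nhdsin top x. y \<in> units G \<longrightarrow> y \<in> U \<longrightarrow> y \<in> V"
proof -
  interpret I: group "isotropy G x" by (rule group_isotropy[OF x])
  have ev: "eventually P (nhdsin top x) \<longleftrightarrow> (\<exists>N. openin top N \<and> x \<in> N \<and> (\<forall>y\<in>N. P y))" for P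
    using x by (subst eventually_nhdsin) auto
  \<comment> \<open>The isotropy elements for which the claim holds form a subgroup, so it suffices
    to treat \<open>g\<close> itself.\<close>
  define \<Gamma> where "\<Gamma> = {h \<in> carrier (isotropy G x). \<forall>V. openin top V \<longrightarrow> h \<in> V \<longrightarrow>
     (\<forall>\<^sub>F y in nhdsin top x. y \<in> units G \<longrightarrow> y \<in> U \<longrightarrow> y \<in> V)}"
  have "subgroup \<Gamma> (isotropy G x)"
  proof (rule I.subgroupI)
    show "\<Gamma> \<subseteq> carrier (isotropy G x)" by (auto simp: \<Gamma>_def)
    have "\<forall>\<^sub>F y in nhdsin top x. y \<in> units G \<longrightarrow> y \<in> U \<longrightarrow> y \<in> V" if "openin top V" "x \<in> V" for V
      unfolding ev using that by blast
    then have "x \<in> \<Gamma>" using x by (simp add: \<Gamma>_def)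
    then show "\<Gamma> \<noteq> {}" by blast
  next
    fix a assume a: "a \<in> \<Gamma>"
    have ac: "a \<in> carrier (isotropy G x)" using a by (simp add: \<Gamma>_def)
    have "\<forall>\<^sub>F y in nhdsin top x. y \<in> units G \<longrightarrow> y \<in> U \<longrightarrow> y \<in> V" if V: "openin top V" "iv a \<in> V" for V
    proof -
      have "openin top {p \<in> arrows G. iv p \<in> V}" "a \<in> {p \<in> arrows G. iv p \<in> V}"
        using open_inv(1)[OF V(1)] V(2) ac by auto
      then have "\<forall>\<^sub>F y in nhdsin top x. y \<in> units G \<longrightarrow> y \<in> U \<longrightarrow> y \<in> {p \<in> arrows G. iv p \<in> V}"
        using a unfolding \<Gamma>_def by blast
      then show ?thesis by eventually_elim auto
    qed
    then show "inv\<^bsub>isotropy G x\<^esub> a \<in> \<Gamma>"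
      using ac by (simp add: inv_isotropy[OF x ac]) (simp add: \<Gamma>_def)
  next
    fix a b assume a: "a \<in> \<Gamma>" and b: "b \<in> \<Gamma>"
    have ac: "a \<in> carrier (isotropy G x)" "b \<in> carrier (isotropy G x)" using a b by (simp_all add: \<Gamma>_def)
    have "\<forall>\<^sub>F y in nhdsin top x. y \<in> units G \<longrightarrow> y \<in> U \<longrightarrow> y \<in> V" if V: "openin top V" "a \<cdot> b \<in> V" for V
    proof -
      obtain A B where AB: "openin top A" "openin top B" "a \<in> A" "b \<in> B"
        "\<And>u v. u \<in> A \<Longrightarrow> v \<in> B \<Longrightarrow> s u = r v \<Longrightarrow> u \<cdot> v \<in> V"
        using mult_nbhd[of a b V] ac V by auto
      have "\<forall>\<^sub>F y in nhdsin top x. y \<in> units G \<longrightarrow> y \<in> U \<longrightarrow> y \<in> A"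
        using a AB unfolding \<Gamma>_def by blast
      moreover have "\<forall>\<^sub>F y in nhdsin top x. y \<in> units G \<longrightarrow> y \<in> U \<longrightarrow> y \<in> B"
        using b AB unfolding \<Gamma>_def by blast
      ultimately show ?thesis
      proof eventually_elim
        case (elim y)
        show ?case
        proof (intro impI)
          assume y: "y \<in> units G" "y \<in> U"
          \<comment> \<open>A unit is its own square, so membership in \<open>A\<close> and in
            \<open>B\<close> yields membership in \<open>V\<close>.\<close>
          then have "y \<cdot> y \<in> V" using AB(5)[of y y] elim by simp
          then show "y \<in> V" using y by simp
        qed
      qed
    qed
    then show "a \<otimes>\<^bsub>isotropy G x\<^esub> b \<in> \<Gamma>" using ac by (simp add: \<Gamma>_def)
  qed
  moreover have "g \<in> \<Gamma>"
  proof -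
    have "\<forall>\<^sub>F y in nhdsin top x. y \<in> units G \<longrightarrow> y \<in> U \<longrightarrow> y \<in> V" if V: "openin top V" "g \<in> V" for V
    proof -
      \<comment> \<open>A unit \<open>y\<close> in \<open>U\<close> that is also the source of some
        \<open>w\<close> in \<open>U \<inter> V\<close> equals \<open>w\<close>, because
        \<open>s\<close> is injective on \<open>U\<close>.\<close>
      have "openin top (s ` (U \<inter> V))" using open_bisectionD(1)[OF U] V open_image_rs by blast
      moreover have "x \<in> s ` (U \<inter> V)" using g V by force
      moreover have "y \<in> V" if y: "y \<in> s ` (U \<inter> V)" "y \<in> units G" "y \<in> U" for y
      proof -
        obtain w where w: "w \<in> U" "w \<in> V" "y = s w" using y(1) by blast
        then have "s y = s w" using y(2) by simp
        then have "y = w" using inj_onD[OF open_bisectionD(3)[OF U]] y(3) w(1) by blast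
        then show ?thesis using w(2) by simp
      qed
      ultimately show ?thesis unfolding ev by blast
    qed
    then show ?thesis using g(2) by (simp add: \<Gamma>_def)
  qed
  ultimately have "generate (isotropy G x) {g} \<subseteq> \<Gamma>"
    by (intro I.generate_subgroup_incl) auto
  then show ?thesis using h V unfolding \<Gamma>_def by blast
qed

lemma coord_Op_single:
  assumes f: "fibre_finite f" and g: "g \<in> source_fibre G y" and u: "u \<in> arrows G" "r u = r g"
    and 0: "\<And>k. k \<in> arrows G \<Longrightarrow> r k = r g \<Longrightarrow> k \<noteq> u \<Longrightarrow> f k = 0"
  shows "coord (Op y f v) g = f u * coord v (iv u \<cdot> g)"
proof -
  have "convolution G f (coord v) g = (\<Sum>k\<in>{u}. f k * coord v (iv k \<cdot> g))"
    unfolding convolution_def using u 0 by (intro infsum_finite_support) auto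
  then show ?thesis using g by (simp add: coord_Op[OF f] rho_def)
qed

end

text \<open>The strict inequality leaves a gap \<open>1 - \<sigma>\<close>. Finite sets are kept,
  and infinite ones are replaced by subsets so large that the reciprocals of their cardinalities fit
  into the gap.\<close>

lemma choose_finite_subsets:
  fixes \<H> :: "'b set set"
  assumes fin: "finite \<H>" and less: "(\<Sum>H\<in>\<H>. if finite H then 1 / real (card H) else 0) < 1"
    and ne: "\<And>H. H \<in> \<H> \<Longrightarrow> H \<noteq> {}"
  shows "\<exists>E. (\<forall>H\<in>\<H>. finite (E H) \<and> E H \<noteq> {} \<and> E H \<subseteq> H) \<and>
    (\<Sum>H\<in>\<H>. 1 / real (card (E H))) < 1"
proof -
  let ?w = "\<lambda>H. if finite H then 1 / real (card H) else 0"
  define \<sigma> where "\<sigma> = (\<Sum>H\<in>\<H>. ?w H)"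
  have \<sigma>: "\<sigma> < 1" using less by (simp add: \<sigma>_def)
  \<comment> \<open>With this \<open>M\<close>, even an extra \<open>1 / M\<close> for every member
    of \<open>\<H>\<close> stays below the gap.\<close>
  obtain M :: nat where M: "real (card \<H>) / (1 - \<sigma>) < real M" using reals_Archimedean2 by blast
  have "0 \<le> real (card \<H>) / (1 - \<sigma>)" using \<sigma> by simp
  then have M0: "0 < M" using M by (cases M) auto
  have M': "real (card \<H>) * (1 / real M) < 1 - \<sigma>"
    using M \<sigma> M0 by (simp add: divide_simps mult.commute)
  define E where "E H = (if finite H then H else (SOME B. finite B \<and> card B = M \<and> B \<subseteq> H))" for H :: "'b set"
  have E: "finite (E H) \<and> card (E H) = M \<and> E H \<subseteq> H" if "infinite H" for H
  proof -
    have "\<exists>B. finite B \<and> card B = M \<and> B \<subseteq> H" using infinite_arbitrarily_large[OF that] .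
    then have "finite (SOME B. finite B \<and> card B = M \<and> B \<subseteq> H) \<and>
      card (SOME B. finite B \<and> card B = M \<and> B \<subseteq> H) = M \<and> (SOME B. finite B \<and> card B = M \<and> B \<subseteq> H) \<subseteq> H"
      by (rule someI_ex)
    then show ?thesis using that by (simp add: E_def)
  qed
  have Efin: "E H = H" if "finite H" for H using that by (simp add: E_def)
  have "(\<Sum>H\<in>\<H>. 1 / real (card (E H))) \<le> (\<Sum>H\<in>\<H>. ?w H + 1 / real M)"
    by (intro sum_mono) (auto simp: Efin E)
  also have "\<dots> = \<sigma> + real (card \<H>) * (1 / real M)" by (simp add: sum.distrib \<sigma>_def)
  also have "\<dots> < 1" using M' by linarith
  finally have "(\<Sum>H\<in>\<H>. 1 / real (card (E H))) < 1" .
  moreover have "finite (E H) \<and> E H \<subseteq> H" for H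
    using E Efin by (cases "finite H") simp_all
  moreover have "E H \<noteq> {}" if "H \<in> \<H>" for H
  proof (cases "finite H")
    case True
    then show ?thesis using Efin ne[OF that] by simp
  next
    case False
    then have "card (E H) = M" using E by blast
    then show ?thesis using M0 by auto
  qed
  ultimately show ?thesis by (intro exI[of _ E]) blast
qed

context etale_groupoid
begin

definition bump_at :: "('a \<Rightarrow> real) \<Rightarrow> 'a set \<Rightarrow> 'a \<Rightarrow> complex" where
  "bump_at \<kappa> V v = (if v \<in> V then complex_of_real (\<kappa> (s v)) else 0)"

lemma bis_fun_bump_at:
  assumes V: "open_bisection G V" and K: "compactin top K" "K \<subseteq> s ` V"
    and \<kappa>: "\<And>z. z \<notin> K \<Longrightarrow> \<kappa> z = 0" "continuous_map (subtopology top (units G)) euclidean \<kappa>"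
  shows "bis_fun V (bump_at \<kappa> V)"
proof -
  have "continuous_map (subtopology top V) (subtopology top (units G)) s"
    using continuous_rs(2)
    by (intro continuous_map_into_subtopology continuous_map_from_subtopology) auto
  then have "continuous_map (subtopology top V) euclidean (\<kappa> \<circ> s)"
    using \<kappa>(2) by (rule continuous_map_compose)
  then have "continuous_map (subtopology top V) euclidean (complex_of_real \<circ> (\<kappa> \<circ> s))"
    by (rule continuous_map_compose) (simp add: continuous_on_of_real)
  then have "continuous_map (subtopology top V) euclidean (bump_at \<kappa> V)"
    by (rule continuous_map_eq) (auto simp: bump_at_def)
  moreover have "compactin (subtopology top (s ` V)) K" using K by (simp add: compactin_subtopology)
  then have "compactin top (ssec V ` K)" using sec_continuous(2)[OF V] by (rule image_compactin)
  moreover have "ssec V ` K \<subseteq> V" using K(2) V by auto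
  moreover have "bump_at \<kappa> V v = 0" if "v \<notin> ssec V ` K" for v
  proof (cases "v \<in> V")
    case True
    then have "s v \<notin> K" using that sec_eq(2)[OF V True] by (metis imageI)
    then show ?thesis by (simp add: bump_at_def \<kappa>)
  qed (simp add: bump_at_def)
  ultimately show ?thesis using V unfolding bis_fun_def by blast
qed

text \<open>The averages \<open>q H\<close> of the bisections through the elements of \<open>E H\<close> act as the identity over
  the units lying in \<open>U k\<close> with \<open>\<langle>g k\<rangle> = H\<close>, hence \<open>\<Sum>H. q H\<^sup>* q H \<ge> 1\<close> near \<open>x\<close> over \<open>Y\<close>; at \<open>x\<close>
  itself the diagonal coefficient of this sum is \<open>\<Sum>H. 1 / |E H| < 1\<close>.\<close>

lemma not_weakly_contained_if_cover:
  assumes x: "x \<in> units G" and inv: "invariant_set G Y" and I: "finite I"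
    and g: "\<And>k. k \<in> I \<Longrightarrow> g k \<in> carrier (isotropy G x)"
    and U: "\<And>k. k \<in> I \<Longrightarrow> open_bisection G (U k)" "\<And>k. k \<in> I \<Longrightarrow> g k \<in> U k"
    and N0: "openin top N0" "x \<in> N0" "Y \<inter> N0 \<subseteq> (\<Union>k\<in>I. U k)"
    and small: "(\<Sum>H\<in>(\<lambda>k. generate (isotropy G x) {g k}) ` I.
       if finite H then 1 / real (card H) else 0) < 1"
  shows "\<not> weakly_contained (reduced_Cstar G) (regular_rep G x) (direct_sum_rep Y (regular_rep G))"
proof -
  \<comment> \<open>Several \<open>g k\<close> may generate the same subgroup. Indexing by subgroups
    counts each of them once, as in the hypothesis on the sum.\<close>
  define gen where "gen k = generate (isotropy G x) {g k}" for k
  define \<H> where "\<H> = gen ` I"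
  have \<H>: "finite \<H>" using I by (simp add: \<H>_def)
  interpret I: group "isotropy G x" by (rule group_isotropy[OF x])
  have gen_carrier: "gen k \<subseteq> carrier (isotropy G x)" if "k \<in> I" for k
    unfolding gen_def using g[OF that] by (intro I.generate_incl) auto
  have ne: "H \<noteq> {}" if "H \<in> \<H>" for H
    using that generate.one unfolding \<H>_def gen_def by blast
  have "(\<Sum>H\<in>\<H>. if finite H then 1 / real (card H) else 0) < 1"
    using small unfolding \<H>_def gen_def .
  then obtain E where E: "\<And>H. H \<in> \<H> \<Longrightarrow> finite (E H)" "\<And>H. H \<in> \<H> \<Longrightarrow> E H \<noteq> {}"
    "\<And>H. H \<in> \<H> \<Longrightarrow> E H \<subseteq> H" "(\<Sum>H\<in>\<H>. 1 / real (card (E H))) < 1"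
    using choose_finite_subsets[OF \<H> _ ne] by auto
  have EI: "h \<in> arrows G" "s h = x" "r h = x" if "H \<in> \<H>" "h \<in> E H" for H h
    using that E(3) gen_carrier unfolding \<H>_def by (auto simp: subset_iff)
  have Y: "Y \<subseteq> units G" using inv by (simp add: invariant_set_def)
  \<comment> \<open>The first ball condition keeps the support of the bump inside the sources of all
    the bisections used. The second makes a unit in \<open>U k\<close> lie in every bisection
    averaged for the group of \<open>g k\<close>.\<close>
  define good where "good y \<longleftrightarrow> y \<in> units G \<and> y \<in> N0 \<and>
     (\<forall>H\<in>\<H>. \<forall>h\<in>E H. y \<in> s ` bis_at h) \<and>
     (\<forall>k\<in>I. \<forall>h\<in>E (gen k). y \<in> U k \<longrightarrow> y \<in> bis_at h)" for y
  have ev: "eventually P (nhdsin top x) \<longleftrightarrow> (\<exists>N. openin top N \<and> x \<in> N \<and> (\<forall>y\<in>N. P y))" for P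
    using x by (subst eventually_nhdsin) auto
  have "\<forall>\<^sub>F y in nhdsin top x. \<forall>H\<in>\<H>. \<forall>h\<in>E H. y \<in> s ` bis_at h"
  proof (intro eventually_ball_finite ballI \<H> E(1))
    fix H h assume h: "H \<in> \<H>" "h \<in> E H"
    have "openin top (s ` bis_at h)" "x \<in> s ` bis_at h"
      using bis_at[of h] EI[OF h] open_bisectionD(1) open_image_rs(2) by (auto simp: image_iff)
    then show "\<forall>\<^sub>F y in nhdsin top x. y \<in> s ` bis_at h" unfolding ev by blast
  qed
  moreover have "\<forall>\<^sub>F y in nhdsin top x. \<forall>k\<in>I. \<forall>h\<in>E (gen k). y \<in> units G \<longrightarrow> y \<in> U k \<longrightarrow> y \<in> bis_at h"
  proof (intro eventually_ball_finite ballI I E(1))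
    fix k h assume k: "k \<in> I" and h: "h \<in> E (gen k)"
    have H: "gen k \<in> \<H>" using k by (simp add: \<H>_def)
    then have "h \<in> generate (isotropy G x) {g k}" using E(3) h unfolding gen_def by blast
    then show "\<forall>\<^sub>F y in nhdsin top x. y \<in> units G \<longrightarrow> y \<in> U k \<longrightarrow> y \<in> bis_at h"
      using eventually_mem_generate[OF x U(1)[OF k] U(2)[OF k] g[OF k]]
        bis_at[of h] EI[OF H h] open_bisectionD(1) by blast
  qed (simp add: \<H>_def)
  moreover have "\<forall>\<^sub>F y in nhdsin top x. y \<in> units G \<and> y \<in> N0"
    unfolding ev using open_units N0 x by (intro exI[of _ "units G \<inter> N0"]) auto
  ultimately have "\<forall>\<^sub>F y in nhdsin top x. good y"
    by eventually_elim (auto simp: good_def)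
  then obtain N where N: "openin top N" "x \<in> N" "\<And>y. y \<in> N \<Longrightarrow> good y" unfolding ev by blast
  have "N \<subseteq> units G" using N(3) by (auto simp: good_def)
  then obtain \<kappa> K where K: "compactin top K" "K \<subseteq> N" and \<kappa>: "\<kappa> x = (1::real)"
    "\<And>z. z \<notin> K \<Longrightarrow> \<kappa> z = 0" "continuous_map (subtopology top (units G)) euclidean \<kappa>"
    using bump_function[OF N(1,2)] by auto
  define b where "b = bump_at \<kappa> (units G)"
  define q where "q H = (\<lambda>p. \<Sum>h\<in>E H. complex_of_real (1 / real (card (E H))) * bump_at \<kappa> (bis_at h) p)" for H
  have Ks: "K \<subseteq> s ` units G"
  proof
    fix z assume "z \<in> K"
    then have "z \<in> units G" using K(2) \<open>N \<subseteq> units G\<close> by blast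
    then show "z \<in> s ` units G" by (intro image_eqI[of _ _ z]) auto
  qed
  have b: "b \<in> Cb"
    unfolding b_def by (rule Cb_bis[OF bis_fun_bump_at[OF unit_nbhd_bisection K(1) Ks \<kappa>(2,3)]])
  have q: "q H \<in> Cb" if H: "H \<in> \<H>" for H
    unfolding q_def
  proof (intro Cb_sum Cb_scale E(1) H)
    fix h assume h: "h \<in> E H"
    have Kh: "K \<subseteq> s ` bis_at h" using K(2) N(3) H h by (auto simp: good_def)
    show "bump_at \<kappa> (bis_at h) \<in> Cb"
      by (rule Cb_bis[OF bis_fun_bump_at[OF bis_at(1)[OF EI(1)[OF H h]] K(1) Kh \<kappa>(2,3)]])
  qed
  note fb = Cb_fibre_finite[OF b] and fq = Cb_fibre_finite[OF q]
  define f0 where "f0 = (\<lambda>p. \<Sum>H\<in>\<H>. prd (star (q H)) (q H) p) - prd (star b) b"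
  have sq: "(\<lambda>p. \<Sum>H\<in>\<J>. prd (star (q H)) (q H) p) \<in> Cb" if "\<J> \<subseteq> \<H>" for \<J>
    using that \<H> finite_subset by (intro Cb_sum Cb_prd Cb_star q) auto
  have f0: "f0 \<in> Cb" unfolding f0_def by (intro Cb_diff Cb_prd Cb_star b sq) auto
  have Op_star_prd: "inner (Op z (prd (star f) f) v) w = inner (Op z f v) (Op z f w)"
    if "f \<in> Cb" for z f v w
    using inner_Op[OF Cb_fibre_finite[OF that], of z w "Op z f v"] that
    by (simp add: Op_prd_Cb Cb_star inner_commute)
  have Op_sum: "inner (Op z (\<lambda>p. \<Sum>H\<in>\<J>. prd (star (q H)) (q H) p) v) w
      = (\<Sum>H\<in>\<J>. inner (Op z (q H) v) (Op z (q H) w))" if "\<J> \<subseteq> \<H>" for z v w \<J>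
  proof -
    have "finite \<J>" using that \<H> finite_subset by blast
    then show ?thesis using that
    proof (induction \<J>)
      case empty
      then show ?case using Op_scale[OF fibre_finite_zero, of z 0 v] by simp
    next
      case (insert H \<J>)
      have H: "H \<in> \<H>" "\<J> \<subseteq> \<H>" using insert by auto
      then have "Op z (\<lambda>p. prd (star (q H)) (q H) p + (\<Sum>H\<in>\<J>. prd (star (q H)) (q H) p)) v =
          Op z (prd (star (q H)) (q H)) v + Op z (\<lambda>p. \<Sum>H\<in>\<J>. prd (star (q H)) (q H) p) v"
        by (intro Op_add Cb_fibre_finite sq Cb_prd Cb_star q) auto
      then show ?case using insert H by (simp add: inner_add_left Op_star_prd q)
    qed
  qed
  \<comment> \<open>Symmetry, positivity over \<open>Y\<close> and negativity at \<open>x\<close>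
    are all read off this form, a sum of squared norms minus one squared norm on the
    diagonal.\<close>
  have form: "inner (Op z f0 v) w
      = (\<Sum>H\<in>\<H>. inner (Op z (q H) v) (Op z (q H) w)) - inner (Op z b v) (Op z b w)" for z v w
    unfolding f0_def
    by (subst Op_diff; (intro Cb_fibre_finite sq Cb_prd Cb_star b order_refl)?)
      (simp add: inner_diff_left Op_sum Op_star_prd b)
  show ?thesis
  proof (rule not_weakly_contained[OF x Y f0])
    show "inner (Op z f0 v) w = inner v (Op z f0 w)" for z v w
      unfolding inner_commute[of v "Op z f0 w"] form by (simp add: inner_commute)
  next
    fix y v assume y: "y \<in> Y"
    have coord_b: "coord (Op y b v) p = b (r p) * coord v (iv (r p) \<cdot> p)"
      if p: "p \<in> source_fibre G y" for p
    proof (rule coord_Op_single[OF fb p])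
      fix k assume "k \<in> arrows G" "r k = r p" "k \<noteq> r p"
      then have "k \<notin> units G" by auto
      then show "b k = 0" by (simp add: b_def bump_at_def)
    qed (use p in auto)
    have pointwise: "(cmod (coord (Op y b v) p))\<^sup>2 \<le> (\<Sum>H\<in>\<H>. (cmod (coord (Op y (q H) v) p))\<^sup>2)" for p
    proof (cases "p \<in> source_fibre G y \<and> r p \<in> K")
      case True
      then have p: "p \<in> source_fibre G y" "p \<in> arrows G" "s p = y" "r p \<in> K" "good (r p)"
        using K(2) N(3) by auto
      \<comment> \<open>The comparison at coordinate \<open>p\<close> takes place at the unit
        \<open>r p\<close>, not at \<open>y\<close>; invariance of \<open>Y\<close> is what allows
        the cover to be used there.\<close>
      have "r p \<in> Y" using inv y p unfolding invariant_set_def by blast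
      then obtain k where k: "k \<in> I" "r p \<in> U k" using N0(3) p(5) unfolding good_def by blast
      have H: "gen k \<in> \<H>" using k by (simp add: \<H>_def)
      have mem: "r p \<in> bis_at h" if "h \<in> E (gen k)" for h
        using p(5) k that unfolding good_def by blast
      have "coord (Op y b v) p = b (r p) * coord v (iv (r p) \<cdot> p)" by (rule coord_b[OF p(1)])
      \<comment> \<open>All the averaged bisections contain the unit \<open>r p\<close>, and
        \<open>r\<close> is injective on each, so no other arrow of range \<open>r p\<close>
        contributes. Hence \<open>q (gen k)\<close> acts at \<open>p\<close> exactly as
        \<open>b\<close> does.\<close>
      moreover have "coord (Op y (q (gen k)) v) p = q (gen k) (r p) * coord v (iv (r p) \<cdot> p)"
      proof (rule coord_Op_single[OF fq[OF H] p(1)])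
        fix k' assume k': "k' \<in> arrows G" "r k' = r p" "k' \<noteq> r p"
        have "k' \<notin> bis_at h" if h: "h \<in> E (gen k)" for h
        proof
          assume "k' \<in> bis_at h"
          moreover have "r k' = r (r p)" using k' p by simp
          ultimately show False
            using inj_onD[OF open_bisectionD(2)[OF bis_at(1)[OF EI(1)[OF H h]]]] mem[OF h] k'(3) by blast
        qed
        then show "q (gen k) k' = 0" by (simp add: q_def bump_at_def)
      qed (use p in auto)
      moreover have "q (gen k) (r p) = b (r p)"
      proof -
        have "q (gen k) (r p) = (\<Sum>h\<in>E (gen k). complex_of_real (1 / real (card (E (gen k)))) * complex_of_real (\<kappa> (r p)))"
          unfolding q_def bump_at_def using p mem by (intro sum.cong refl) simp
        also have "\<dots> = complex_of_real (\<kappa> (r p))"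
          using E(1,2)[OF H] by simp
        finally show ?thesis using p by (simp add: b_def bump_at_def)
      qed
      ultimately have "(cmod (coord (Op y b v) p))\<^sup>2 = (cmod (coord (Op y (q (gen k)) v) p))\<^sup>2" by simp
      also have "\<dots> \<le> (\<Sum>H\<in>\<H>. (cmod (coord (Op y (q H) v) p))\<^sup>2)"
        using H \<H> by (intro member_le_sum) auto
      finally show ?thesis .
    next
      case False
      have "coord (Op y b v) p = 0"
      proof (cases "p \<in> source_fibre G y")
        case True
        have "coord (Op y b v) p = b (r p) * coord v (iv (r p) \<cdot> p)" by (rule coord_b[OF True])
        moreover have "b (r p) = 0" using True False \<kappa>(2) by (auto simp: b_def bump_at_def)
        ultimately show ?thesis by simp
      next
        case False
        then show ?thesis by (auto simp: coord_Op[OF fb] rho_def)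
      qed
      then show ?thesis by (simp add: sum_nonneg)
    qed
    have "(norm (Op y b v))\<^sup>2 \<le> (\<Sum>H\<in>\<H>. (norm (Op y (q H) v))\<^sup>2)"
      unfolding norm_l2_square[of "Op y b v"]
    proof (rule infsum_le_finite_sums[OF coord_summable])
      fix F :: "'a set" assume F: "finite F"
      have "(\<Sum>p\<in>F. (cmod (coord (Op y b v) p))\<^sup>2) \<le> (\<Sum>p\<in>F. \<Sum>H\<in>\<H>. (cmod (coord (Op y (q H) v) p))\<^sup>2)"
        by (intro sum_mono pointwise)
      also have "\<dots> = (\<Sum>H\<in>\<H>. \<Sum>p\<in>F. (cmod (coord (Op y (q H) v) p))\<^sup>2)" by (rule sum.swap)
      also have "\<dots> \<le> (\<Sum>H\<in>\<H>. (norm (Op y (q H) v))\<^sup>2)"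
        by (intro sum_mono finite_sum_le_norm_l2 F)
      finally show "(\<Sum>p\<in>F. (cmod (coord (Op y b v) p))\<^sup>2) \<le> (\<Sum>H\<in>\<H>. (norm (Op y (q H) v))\<^sup>2)" .
    qed
    then show "0 \<le> inner (Op y f0 v) v" by (simp add: form dot_square_norm)
  next
    define d where "d = Abs_l2 (\<lambda>p. if p = x then 1 else 0 :: complex)"
    have d: "coord d = (\<lambda>p. if p = x then 1 else 0)"
      unfolding d_def by (rule finite_support_l2[of "{x}"]) auto
    show "coord d \<in> ell2 (source_fibre G x)"
      using coord_summable[of d] x by (simp add: ell2_def d)
    have val: "coord (Op x f d) p = (if p \<in> source_fibre G x then f p else 0)" if "fibre_finite f" for f p
      using coord_Op_finite_support[OF that, of "{x}" x p d] x by (auto simp: d kern_def)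
    have "(norm (Op x (q H) d))\<^sup>2 = 1 / real (card (E H))" if H: "H \<in> \<H>" for H
    proof -
      \<comment> \<open>Each \<open>bis_at h\<close> meets the source fibre of \<open>x\<close> only
        in \<open>h\<close>. Applied to the unit vector at \<open>x\<close>, \<open>q H\<close> thus
        gives the uniform average on \<open>E H\<close>, of squared norm
        \<open>1 / card (E H)\<close>.\<close>
      have qv: "q H p = (if p \<in> E H then complex_of_real (1 / real (card (E H))) else 0)"
        if p: "p \<in> source_fibre G x" for p
      proof -
        have "bump_at \<kappa> (bis_at h) p = (if p = h then 1 else 0)" if h: "h \<in> E H" for h
        proof -
          have "p = h" if "p \<in> bis_at h"
            using inj_onD[OF open_bisectionD(3)[OF bis_at(1)[OF EI(1)[OF H h]]], of p h]
              that bis_at(2)[OF EI(1)[OF H h]] p EI[OF H h] by simp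
          then show ?thesis using bis_at(2)[OF EI(1)[OF H h]] EI(2)[OF H h] \<kappa>(1)
            by (auto simp: bump_at_def)
        qed
        then have "q H p = (\<Sum>h\<in>E H. if p = h then complex_of_real (1 / real (card (E H))) else 0)"
          unfolding q_def by (intro sum.cong refl) simp
        then show ?thesis using E(1)[OF H] by simp
      qed
      have "(norm (Op x (q H) d))\<^sup>2 = (\<Sum>p\<in>E H. (cmod (coord (Op x (q H) d) p))\<^sup>2)"
        unfolding norm_l2_square using E(1)[OF H]
        by (intro infsum_finite_support) (auto simp: val[OF fq[OF H]] qv)
      also have "\<dots> = (\<Sum>p\<in>E H. (1 / real (card (E H)))\<^sup>2)"
        using EI[OF H] by (intro sum.cong refl) (simp add: val[OF fq[OF H]] qv norm_divide)
      also have "\<dots> = 1 / real (card (E H))"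
        using E(1,2)[OF H] by (simp add: power2_eq_square)
      finally show ?thesis .
    qed
    moreover have "(norm (Op x b d))\<^sup>2 = 1"
    proof -
      have c: "coord (Op x b d) p = (if p = x then 1 else 0)" for p
        unfolding val[OF fb] using x \<kappa>(1) by (auto simp: b_def bump_at_def)
      have "(norm (Op x b d))\<^sup>2 = (\<Sum>p\<in>{x}. (cmod (coord (Op x b d) p))\<^sup>2)"
        unfolding norm_l2_square by (intro infsum_finite_support) (auto simp: c)
      then show ?thesis by (simp add: c)
    qed
    ultimately show "inner (Op x f0 d) d < 0"
      using E(4) by (simp add: form dot_square_norm)
  qed
qed

section \<open>Covers, nets and the equivalence\<close>

text \<open>Units form an open set, so neighbourhoods in the unit space and in \<open>G\<close> are
  interchangeable. That \<open>x\<close> lies in the closure of \<open>Y\<close> rules out an empty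
  list of bisections, which matches \<open>n \<ge> 1\<close>.\<close>

lemma empty_approach_set_iff_cover:
  assumes x: "x \<in> units G" and cl: "x \<in> top closure_of Y"
  shows "{} \<in> approach_sets Y x \<longleftrightarrow>
    (\<exists>(n::nat) g U N. n \<ge> 1 \<and>
       (\<forall>k\<in>{1..n}. g k \<in> carrier (isotropy G x) - {x} \<and> open_bisection G (U k) \<and> g k \<in> U k) \<and>
       unit_neighbourhood G x N \<and> Y \<inter> N \<subseteq> (\<Union>k\<in>{1..n}. U k))"
    (is "_ \<longleftrightarrow> ?cover")
proof
  assume "{} \<in> approach_sets Y x"
  then obtain N \<U> where N: "Y \<inter> N - \<Union>\<U> = {}" "openin top N" "x \<in> N" "finite \<U>"
    "\<U> \<subseteq> nontrivial_bisections x" unfolding approach_sets_def by auto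
  obtain y where "y \<in> Y" "y \<in> N" using cl N(2,3) unfolding in_closure_of by blast
  then have "\<U> \<noteq> {}" using N(1) by blast
  then have card: "card \<U> \<ge> 1" using N(4) by (simp add: Suc_le_eq card_gt_0_iff)
  obtain U where "bij_betw U {1..card \<U>} \<U>" using ex_bij_betw_nat_finite_1[OF N(4)] by blast
  then have U: "U ` {1..card \<U>} = \<U>" by (simp add: bij_betw_def)
  have "\<forall>k\<in>{1..card \<U>}. \<exists>g. open_bisection G (U k) \<and> g \<in> U k \<and>
      g \<in> source_fibre G x \<and> g \<in> range_fibre G x \<and> g \<noteq> x"
    using U N(5) unfolding nontrivial_bisections_def by blast
  then obtain g where g: "\<forall>k\<in>{1..card \<U>}. open_bisection G (U k) \<and> g k \<in> U k \<and>
      g k \<in> source_fibre G x \<and> g k \<in> range_fibre G x \<and> g k \<noteq> x" by (rule bchoice[THEN exE])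
  have nb: "unit_neighbourhood G x (units G \<inter> N)"
    unfolding unit_neighbourhood_def using N x
    by (intro conjI exI[of _ "units G \<inter> N"]) (auto intro: openin_subtopology_Int2)
  have cov: "Y \<inter> (units G \<inter> N) \<subseteq> (\<Union>k\<in>{1..card \<U>}. U k)" using N(1) U by blast
  show ?cover
    using card g nb cov
    by (intro exI[of _ "card \<U>"] exI[of _ g] exI[of _ U] exI[of _ "units G \<inter> N"]) simp
next
  assume ?cover
  then obtain n :: nat and g U N where
    g: "\<forall>k\<in>{1..n}. g k \<in> carrier (isotropy G x) - {x} \<and> open_bisection G (U k) \<and> g k \<in> U k"
    and N: "unit_neighbourhood G x N" "Y \<inter> N \<subseteq> (\<Union>k\<in>{1..n}. U k)" by blast
  obtain W where W: "openin (subtopology top (units G)) W" "x \<in> W" "W \<subseteq> N"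
    using N(1) unfolding unit_neighbourhood_def by blast
  have "openin top W" using W(1) open_units by (rule openin_trans_full)
  moreover have "U ` {1..n} \<subseteq> nontrivial_bisections x"
    using g unfolding nontrivial_bisections_def by (auto intro!: bexI)
  ultimately have "Y \<inter> W - \<Union>(U ` {1..n}) \<in> approach_sets Y x"
    using W by (intro approach_setsI) auto
  moreover have "Y \<inter> W - \<Union>(U ` {1..n}) = {}" using N(2) W(3) by blast
  ultimately show "{} \<in> approach_sets Y x" by metis
qed

text \<open>The net runs through all pairs of a base set and a point in it. Shrinking a base set
  around \<open>x\<close> makes \<open>x\<close> an accumulation point; removing a bisection through
  \<open>g\<close> prevents any other isotropy element \<open>g\<close> from being one.\<close>

lemma net_if_approach:
  assumes x: "x \<in> units G" and ne: "{} \<notin> approach_sets Y x"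
  shows "\<exists>(I :: ('a set \<times> 'a) set) leq \<nu>. directed_set I leq \<and> \<nu> ` I \<subseteq> Y \<and>
    net_accumulation_points top I leq \<nu> \<inter> carrier (isotropy G x) = {x}"
proof -
  define I where "I = {(A, a). A \<in> approach_sets Y x \<and> a \<in> A}"
  define leq where "leq = (\<lambda>(p :: 'a set \<times> 'a) (q :: 'a set \<times> 'a). fst q \<subseteq> fst p)"
  have inI: "\<exists>a. (A, a) \<in> I" if "A \<in> approach_sets Y x" for A
  proof -
    have "A \<noteq> {}" using that ne by blast
    then show ?thesis using that by (auto simp: I_def)
  qed
  have base: "Y \<inter> N - \<Union>\<U> \<in> approach_sets Y x"
    if "openin top N" "x \<in> N" "finite \<U>" "\<U> \<subseteq> nontrivial_bisections x" for N \<U>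
    using that by (rule approach_setsI)
  have all: "Y \<inter> arrows G - \<Union>{} \<in> approach_sets Y x"
    using x openin_topspace[of top] by (intro base) auto
  have "directed_set I leq"
    unfolding directed_set_def
  proof (intro conjI ballI impI)
    show "I \<noteq> {}" using inI[OF all] by blast
  next
    fix p q assume "p \<in> I" "q \<in> I"
    then have "fst p \<inter> fst q \<in> approach_sets Y x" by (intro approach_sets_Int) (auto simp: I_def)
    then obtain a where "(fst p \<inter> fst q, a) \<in> I" using inI by blast
    then show "\<exists>k\<in>I. leq p k \<and> leq q k" by (rule bexI[rotated]) (auto simp: leq_def)
  qed (auto simp: leq_def)
  moreover have "snd ` I \<subseteq> Y" by (auto simp: I_def approach_sets_def)
  moreover have "x \<in> net_accumulation_points top I leq snd"
    unfolding net_accumulation_points_def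
  proof (intro CollectI conjI allI impI ballI)
    show "x \<in> topspace top" using x by simp
    fix W p assume W: "openin top W \<and> x \<in> W" and p: "p \<in> I"
    have "fst p \<inter> (Y \<inter> W - \<Union>{}) \<in> approach_sets Y x"
      using W p by (intro approach_sets_Int base) (auto simp: I_def)
    then obtain a where a: "(fst p \<inter> (Y \<inter> W - \<Union>{}), a) \<in> I" using inI by blast
    then have "a \<in> W" by (auto simp: I_def)
    then show "\<exists>q\<in>I. leq p q \<and> snd q \<in> W" using a by (intro bexI[OF _ a]) (auto simp: leq_def)
  qed
  moreover have "g = x"
    if acc: "g \<in> net_accumulation_points top I leq snd" and g: "g \<in> carrier (isotropy G x)" for g
  proof (rule ccontr)
    assume "g \<noteq> x"
    then have B: "bis_at g \<in> nontrivial_bisections x" "openin top (bis_at g)" "g \<in> bis_at g"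
      using bis_at[of g] g open_bisectionD(1) by (auto simp: nontrivial_bisections_def)
    then have "Y \<inter> arrows G - \<Union>{bis_at g} \<in> approach_sets Y x"
      using x openin_topspace[of top] by (intro base) auto
    then obtain a where a: "(Y \<inter> arrows G - \<Union>{bis_at g}, a) \<in> I" using inI by blast
    then obtain q where "q \<in> I" "leq (Y \<inter> arrows G - \<Union>{bis_at g}, a) q" "snd q \<in> bis_at g"
      using acc B unfolding net_accumulation_points_def by blast
    then show False by (auto simp: I_def leq_def)
  qed
  ultimately show ?thesis
    using x by (intro exI[of _ I] exI[of _ leq] exI[of _ snd] conjI) auto
qed

lemma directed_set_upper_bound:
  assumes dir: "directed_set I leq" and "finite J" "\<And>j. j \<in> J \<Longrightarrow> i j \<in> I"
  shows "\<exists>k\<in>I. \<forall>j\<in>J. leq (i j) k"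
  using assms(2,3)
proof (induction J)
  case empty
  then show ?case using dir unfolding directed_set_def by blast
next
  case (insert a J)
  then obtain k where k: "k \<in> I" "\<forall>j\<in>J. leq (i j) k" by blast
  moreover have "i a \<in> I" using insert by simp
  ultimately obtain l where l: "l \<in> I" "leq k l" "leq (i a) l"
    using dir unfolding directed_set_def by blast
  have "leq (i j) l" if "j \<in> J" for j
  proof -
    have "i j \<in> I" "leq (i j) k" using that insert k by auto
    then show ?thesis using dir k(1) l unfolding directed_set_def by blast
  qed
  then show ?case using l by (intro bexI[of _ l]) auto
qed

text \<open>For each bisection \<open>V\<close> of a cover, the net eventually leaves a
  neighbourhood \<open>W V\<close> of some isotropy element in \<open>V\<close>. A unit of
  \<open>V\<close> close to \<open>x\<close> lies in \<open>W V\<close>, since \<open>s\<close> is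
  injective on \<open>V\<close>. A late net point close to \<open>x\<close> can therefore lie in no
  \<open>V\<close>, contradicting the cover.\<close>

lemma approach_if_net:
  assumes x: "x \<in> units G" and Y: "Y \<subseteq> units G"
    and dir: "directed_set I leq" and \<nu>: "\<nu> ` I \<subseteq> Y"
    and acc: "net_accumulation_points top I leq \<nu> \<inter> carrier (isotropy G x) = {x}"
  shows "{} \<notin> approach_sets Y x"
proof
  assume "{} \<in> approach_sets Y x"
  then obtain N \<U> where N: "Y \<inter> N - \<Union>\<U> = {}" "openin top N" "x \<in> N" "finite \<U>"
    "\<U> \<subseteq> nontrivial_bisections x" unfolding approach_sets_def by auto
  have ev: "eventually P (nhdsin top x) \<longleftrightarrow> (\<exists>N. openin top N \<and> x \<in> N \<and> (\<forall>y\<in>N. P y))" for P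
    using x by (subst eventually_nhdsin) auto
  have "\<exists>W i. openin top W \<and> x \<in> s ` (V \<inter> W) \<and> i \<in> I \<and> (\<forall>j\<in>I. leq i j \<longrightarrow> \<nu> j \<notin> W)" if "V \<in> \<U>" for V
  proof -
    have "\<exists>g\<in>V. g \<in> source_fibre G x \<and> g \<in> range_fibre G x \<and> g \<noteq> x"
      using N(5) that unfolding nontrivial_bisections_def by blast
    then obtain g where g: "g \<in> V" "g \<in> carrier (isotropy G x)" "g \<noteq> x" by auto
    then have "g \<notin> net_accumulation_points top I leq \<nu>" using acc by blast
    then obtain W i where "openin top W" "g \<in> W" "i \<in> I" "\<forall>j\<in>I. \<not> (leq i j \<and> \<nu> j \<in> W)"
      using g(2) unfolding net_accumulation_points_def by auto
    moreover have "x \<in> s ` (V \<inter> W)" using g \<open>g \<in> W\<close> by (intro image_eqI[of _ _ g]) auto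
    ultimately show ?thesis by blast
  qed
  then obtain W i where W: "\<And>V. V \<in> \<U> \<Longrightarrow> openin top (W V)" "\<And>V. V \<in> \<U> \<Longrightarrow> x \<in> s ` (V \<inter> W V)"
    "\<And>V. V \<in> \<U> \<Longrightarrow> i V \<in> I" "\<And>V j. V \<in> \<U> \<Longrightarrow> j \<in> I \<Longrightarrow> leq (i V) j \<Longrightarrow> \<nu> j \<notin> W V"
    by metis
  obtain k where k: "k \<in> I" "\<forall>V\<in>\<U>. leq (i V) k"
    using directed_set_upper_bound[OF dir N(4), of i] W(3) by blast
  have bis: "open_bisection G V" if "V \<in> \<U>" for V
    using that N(5) by (auto simp: nontrivial_bisections_def)
  have "\<forall>\<^sub>F y in nhdsin top x. \<forall>V\<in>\<U>. y \<in> s ` (V \<inter> W V)"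
  proof (intro eventually_ball_finite ballI N(4))
    fix V assume V: "V \<in> \<U>"
    have "openin top (s ` (V \<inter> W V))"
      using open_bisectionD(1)[OF bis[OF V]] W(1)[OF V] by (intro open_image_rs openin_Int)
    then show "\<forall>\<^sub>F y in nhdsin top x. y \<in> s ` (V \<inter> W V)" unfolding ev using W(2)[OF V] by blast
  qed
  moreover have "\<forall>\<^sub>F y in nhdsin top x. y \<in> N" unfolding ev using N by blast
  ultimately have "\<forall>\<^sub>F y in nhdsin top x. y \<in> N \<and> (\<forall>V\<in>\<U>. y \<in> s ` (V \<inter> W V))"
    by eventually_elim auto
  then obtain M where M: "openin top M" "x \<in> M" "\<And>y. y \<in> M \<Longrightarrow> y \<in> N \<and> (\<forall>V\<in>\<U>. y \<in> s ` (V \<inter> W V))"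
    unfolding ev by blast
  have "x \<in> net_accumulation_points top I leq \<nu>" using acc by blast
  then obtain j where j: "j \<in> I" "leq k j" "\<nu> j \<in> M"
    using M k(1) unfolding net_accumulation_points_def by blast
  then have \<nu>j: "\<nu> j \<in> Y" "\<nu> j \<in> units G" "\<nu> j \<in> N" using \<nu> Y M(3) by auto
  then obtain V where V: "V \<in> \<U>" "\<nu> j \<in> V" using N(1) by blast
  then obtain w where w: "w \<in> V" "w \<in> W V" "\<nu> j = s w" using M(3)[OF j(3)] by blast
  then have "s (\<nu> j) = s w" using \<nu>j by simp
  then have "\<nu> j = w" using inj_onD[OF open_bisectionD(3)[OF bis[OF V(1)]]] V(2) w(1) by blast
  then have "\<nu> j \<in> W V" using w by simp
  moreover have "leq (i V) j" using dir k j W(3) V(1) unfolding directed_set_def by blast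
  ultimately show False using W(4)[OF V(1) j(1)] by blast
qed

end

theorem corollary1p10:
  fixes G :: "'a top_groupoid" and Y :: "'a set" and x :: 'a
  assumes "etale_groupoid G"
    and "invariant_set G Y"
    and "x \<in> (units G \<inter> gtop G closure_of Y) - Y"
    and "\<And>\<H> :: 'a set set. finite \<H> \<Longrightarrow>
          (\<And>H. H \<in> \<H> \<Longrightarrow> subgroup H (isotropy G x) \<and>
             cyclic_group ((isotropy G x)\<lparr>carrier := H\<rparr>) \<and> H \<noteq> {x}) \<Longrightarrow>
          (\<Sum>H\<in>\<H>. if finite H then 1 / real (card H) else 0) < 1"
  shows
    "(weakly_contained (reduced_Cstar G) (regular_rep G x) (direct_sum_rep Y (regular_rep G))
        \<longleftrightarrow>
      \<not> (\<exists>(n::nat) g U N. n \<ge> 1 \<and>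
            (\<forall>k\<in>{1..n}. g k \<in> carrier (isotropy G x) - {x} \<and>
               open_bisection G (U k) \<and> g k \<in> U k) \<and>
            unit_neighbourhood G x N \<and> Y \<inter> N \<subseteq> (\<Union>k\<in>{1..n}. U k)))
     \<and>
     (weakly_contained (reduced_Cstar G) (regular_rep G x) (direct_sum_rep Y (regular_rep G))
        \<longleftrightarrow>
      (\<exists>(I :: ('a set \<times> 'a) set) leq \<nu>. directed_set I leq \<and> \<nu> ` I \<subseteq> Y \<and>
         net_accumulation_points (gtop G) I leq \<nu> \<inter> carrier (isotropy G x) = {x}))"
    (is "(?wc \<longleftrightarrow> \<not> ?cover) \<and> (?wc \<longleftrightarrow> ?net)")
proof -
  interpret etale_groupoid G by fact
  have xu: "x \<in> units G" and cl: "x \<in> gtop G closure_of Y" using assms(3) by auto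
  have Y: "Y \<subseteq> units G" using assms(2) by (simp add: invariant_set_def)
  \<comment> \<open>Both criteria, the cover and the net, are compared with whether the empty set
    belongs to the filter base.\<close>
  have cover: "{} \<in> approach_sets Y x \<longleftrightarrow> ?cover" using xu cl by (rule empty_approach_set_iff_cover)
  have net: "{} \<notin> approach_sets Y x \<longleftrightarrow> ?net"
  proof
    assume "{} \<notin> approach_sets Y x"
    with xu show ?net by (rule net_if_approach)
  next
    assume ?net
    then show "{} \<notin> approach_sets Y x" by (elim exE conjE) (rule approach_if_net[OF xu Y])
  qed
  have wc: ?wc if "{} \<notin> approach_sets Y x"
    by (rule weakly_contained_if_approach[OF xu Y approach_neq_bot]) (use xu that in auto)
  have "\<not> ?wc" if ?cover
  proof -
    obtain n :: nat and g U N where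
      g: "\<And>k. k \<in> {1..n} \<Longrightarrow> g k \<in> carrier (isotropy G x) - {x} \<and> open_bisection G (U k) \<and> g k \<in> U k"
      and N: "unit_neighbourhood G x N" "Y \<inter> N \<subseteq> (\<Union>k\<in>{1..n}. U k)" using \<open>?cover\<close> by blast
    obtain W where W: "openin (subtopology top (units G)) W" "x \<in> W" "W \<subseteq> N"
      using N(1) unfolding unit_neighbourhood_def by blast
    interpret I: group "isotropy G x" by (rule group_isotropy[OF xu])
    show ?thesis
    proof (rule not_weakly_contained_if_cover[OF xu assms(2)])
      show "finite {1..n}" by simp
      show "g k \<in> carrier (isotropy G x)" "open_bisection G (U k)" "g k \<in> U k" if "k \<in> {1..n}" for k
        using g[OF that] by auto
      show "openin top W" using W(1) open_units by (rule openin_trans_full)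
      show "x \<in> W" by fact
      show "Y \<inter> W \<subseteq> (\<Union>k\<in>{1..n}. U k)" using N W by blast
      show "(\<Sum>H\<in>(\<lambda>k. generate (isotropy G x) {g k}) ` {1..n}.
         if finite H then 1 / real (card H) else 0) < 1"
      proof (rule assms(4))
        fix H assume "H \<in> (\<lambda>k. generate (isotropy G x) {g k}) ` {1..n}"
        then obtain k where k: "k \<in> {1..n}" "H = generate (isotropy G x) {g k}" by blast
        have gk: "g k \<in> carrier (isotropy G x)" "g k \<noteq> x" using g[OF k(1)] by auto
        \<comment> \<open>The generated group in \<open>subgroup_generated\<close> is formed after
          intersecting the generators with the carrier, which changes nothing here.\<close>
        have "carrier (isotropy G x) \<inter> {g k} = {g k}" using gk(1) by blast
        then have "(isotropy G x)\<lparr>carrier := H\<rparr> = subgroup_generated (isotropy G x) {g k}"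
          unfolding subgroup_generated_def k(2) by simp
        moreover have "subgroup H (isotropy G x)"
          unfolding k(2) using gk(1) by (intro I.generate_is_subgroup) blast
        moreover have "g k \<in> H" unfolding k(2) by (rule generate.incl) simp
        ultimately show "subgroup H (isotropy G x) \<and>
             cyclic_group ((isotropy G x)\<lparr>carrier := H\<rparr>) \<and> H \<noteq> {x}"
          using I.cyclic_group_generated gk(2) by auto
      qed simp
    qed
  qed
  then show ?thesis using cover net wc by blast
qed

end
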